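(* Let $(\gamma_t,\eta_t)_{t\in I}$ and $(\gamma^n_t,\eta^n_t)_{t\in I}$, $n\in\mathbb N$, be generators. Consider the following objects that have $(\gamma_t,\eta_t)_t$ and $(\gamma^n_t,\eta^n_t)_t$ as their generators, respectively: $\ast$-convolution hemigroups $(\mathfrak c_{s,t})_{s\le t}$ and $(\mathfrak c^n_{s,t})_{s\le t}$; $\rhd$-convolution hemigroups $(\mathfrak m_{s,t})_{s\le t}$ and $(\mathfrak m^n_{s,t})_{s\le t}$; $\mathcal P$-DLCs $(f_t)_t$ and $(f^n_t)_t$; $\mathcal P$-REFs $(f_{s,t})_{s\le t}$ and $(f^n_{s,t})_{s\le t}$. Then the following are equivalent as $n\to\infty$: (1) $(\mathfrak c^n_{0,t})_t$ converges weakly to $(\mathfrak c_{0,t})_t$ locally uniformly on $I$; (2) $(\mathfrak c^n_{s,t})_{s\le t}$ converges weakly to $(\mathfrak c_{s,t})_{s\le t}$ locally uniformly on $I^2_\le$; (3) $(\mathfrak m^n_{0,t})_t$ converges weakly to $(\mathfrak m_{0,t})_t$ locally uniformly on $I$; (4) $(\mathfrak m^n_{s,t})_{s\le t}$ converges weakly to $(\mathfrak m_{s,t})_{s\le t}$ locally uniformly on $I^2_\le$; (5) $f^n_t(z)$ converges to $f_t(z)$ locally uniformly on $\mathbb C^+\times I$; (6) $f^n_{s,t}(z)$ converges to $f_{s,t}(z)$ locally uniformly on $\mathbb C^+\times I^2_\le$; (7) $(\gamma^n_t)_t$ converges to $(\gamma_t)_t$ locally uniformly on $I$, and $(\eta^n_t)_t$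 converges weakly to $(\eta_t)_t$ locally uniformly on $I$; (8) $(\gamma^n_t)_t$ converges to $(\gamma_t)_t$ locally uniformly on $I$, and $\eta^n_t$ converges weakly to $\eta_t$ for each $t\in I$.
   Context: $I$ is a fixed interval $[0,T_0)$ ($0<T_0\le+\infty$) or $[0,T_0]$ ($0<T_0<+\infty$), and $I^2_\le=\{(s,t)\in I^2:s\le t\}$. $\mathbb C^+$ is the open upper half-plane; $\mathbf P(\mathbb R)$, $\mathbf M(\mathbb R)$ are the sets of Borel probability measures and of finite nonnegative Borel measures on $\mathbb R$; $\widehat\mu(\xi)=\int e^{i\xi x}\mu(dx)$. For $\mu\in\mathbf P(\mathbb R)$ put $G_\mu(z)=\int\frac1{z-x}\mu(dx)$, $F_\mu=F[\mu]=1/G_\mu$ on $\mathbb C^+$, and $\mathcal P=\{F_\mu:\mu\in\mathbf P(\mathbb R)\}$. $\ast$ is classical convolution; monotone convolution $\rhd$ on $\mathbf P(\mathbb R)$ is determined by $F_{\mu\rhd\nu}=F_\mu\circ F_\nu$. For $\star\in\{\ast,\rhd\}$, a $\star$-convolution hemigroup is a family $(\mu_{s,t})_{(s,t)\in I^2_\le}$ in $\mathbf P(\mathbb R)$ with $\mu_{s,s}=\delta_0$, $\mu_{s,t}\star\mu_{t,u}=\mu_{s,u}$ for $s\le t\le u$, and $(s,t)\mapsto\mu_{s,t}$ weakly continuous. A $\mathcal P$-DLC is a family $(f_t)_{t\in I}\subset\mathcal P$ of univalent functions with $f_0=\mathrm{id}$, $f_s(\mathbb C^+)\supset f_t(\mathbb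 C^+)$ for $s\le t$, and $t\mapsto f_t$ continuous for locally uniform convergence. A $\mathcal P$-REF is a family $(f_{s,t})_{s\le t}\subset\mathcal P$ with $f_{s,s}=\mathrm{id}$, $f_{s,t}\circ f_{t,u}=f_{s,u}$ for $s\le t\le u$, and $(s,t)\mapsto f_{s,t}$ continuous for locally uniform convergence. A generator is a family $(\gamma_t,\eta_t)_{t\in I}$ in $\mathbb R\times\mathbf M(\mathbb R)$ such that $\gamma_0=0$ and $t\mapsto\gamma_t$ is continuous; $\eta_0=0$ and for every Borel $B\subset\mathbb R$ the function $t\mapsto\eta_t(B)$ is nondecreasing and continuous. Given a generator, let $\mathcal H$ be the Borel measure on $\mathbb R\times I$ with $\mathcal H(B\times(s,t])=\eta_t(B)-\eta_s(B)$ and $\mathcal H(\mathbb R\times\{0\})=0$. - The $\ast$-convolution hemigroup with this generator is the unique one with $\widehat{\mathfrak c}_{0,t}(\xi)=\exp\Big(i\gamma_t\xi+\int_{\mathbb R}\big(e^{i\xi x}-1-\frac{i\xi x}{1+x^2}\big)\frac{1+x^2}{x^2}\,\eta_t(dx)\Big)$ (integrand at $x=0$ equal to $-\xi^2/2$). - The $\mathcal P$-REF with this generator is the unique one satisfying $f_{s,t}(z)=z+\gamma_s-\gamma_t+\int_{\mathbb R\times[s,t]}\frac{1+xf_{r,t}(z)}{x-f_{r,t}(z)}\,\mathcal H(dx\,dr)$ for $s\le t$, $z\in\mathbb C^+$. - The $\mathcal P$-DLC with this generator is $f_t:=f_{0,t}$, and the $\rhd$-convolution hemigroup with this generator is the one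 determined by $F[\mathfrak m_{s,t}]=f_{s,t}$, where $(f_{s,t})$ is that $\mathcal P$-REF. For $\mathbb I=I$ or $I^2_\le$, $(\mu^n_\tau)_{\tau\in\mathbb I}$ converges weakly to $(\mu_\tau)_{\tau\in\mathbb I}$ locally uniformly on $\mathbb I$ if $\lim_{n}\sup_{\tau\in K}\big|\int f\,d\mu^n_\tau-\int f\,d\mu_\tau\big|=0$ for every compact $K\subset\mathbb I$ and every bounded continuous $f:\mathbb R\to\mathbb R$. *)

theory Defs
  imports "HOL-Probability.Probability" "HOL-Complex_Analysis.Complex_Analysis"
begin

text \<open>Families indexed by pairs of times are functions on \<^typ>\<open>real \<times> real\<close>; like the families indexed
  by a single time, they are constrained only on the index set (\<open>I\<close> or \<open>time_pairs I\<close>), and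
  functions on the upper half-plane are constrained only there.\<close>

definition time_interval :: "real set \<Rightarrow> bool" where
  "time_interval I \<longleftrightarrow> I = {0..} \<or> (\<exists>T\<^sub>0>0. I = {0..<T\<^sub>0} \<or> I = {0..T\<^sub>0})"

definition time_pairs :: "real set \<Rightarrow> (real \<times> real) set" where
  "time_pairs I = {(s, t). s \<in> I \<and> t \<in> I \<and> s \<le> t}"

definition upper_half_plane :: "complex set" ("\<complex>\<^sup>+") where
  "\<complex>\<^sup>+ = {z. Im z > 0}"

definition Cauchy_transform :: "real measure \<Rightarrow> complex \<Rightarrow> complex" where
  "Cauchy_transform \<mu> z = (CLINT x|\<mu>. 1 / (z - complex_of_real x))"

definition F_transform :: "real measure \<Rightarrow> complex \<Rightarrow> complex" where
  "F_transform \<mu> z = 1 / Cauchy_transform \<mu> z"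

definition F_class :: "(complex \<Rightarrow> complex) set" where
  "F_class = {f. \<exists>\<mu>. real_distribution \<mu> \<and> (\<forall>z\<in>\<complex>\<^sup>+. f z = F_transform \<mu> z)}"

definition monotone_convolution :: "real measure \<Rightarrow> real measure \<Rightarrow> real measure" where
  "monotone_convolution \<mu> \<nu> =
     (THE \<rho>. real_distribution \<rho> \<and> (\<forall>z\<in>\<complex>\<^sup>+. F_transform \<rho> z = F_transform \<mu> (F_transform \<nu> z)))"

text \<open>Weak convergence is always tested against bounded continuous functions: the library's
  \<^const>\<open>weak_conv_m\<close> only compares distribution functions, which for finite measures does not
  control the total mass.\<close>

definition weak_conv_finite :: "(nat \<Rightarrow> real measure) \<Rightarrow> real measure \<Rightarrow> bool" where
  "weak_conv_finite \<mu>n \<mu> \<longleftrightarrow>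
     (\<forall>f :: real \<Rightarrow> real. continuous_on UNIV f \<and> bounded (range f) \<longrightarrow>
        (\<lambda>n. \<integral>x. f x \<partial>\<mu>n n) \<longlonglongrightarrow> (\<integral>x. f x \<partial>\<mu>))"

definition weakly_continuous_on :: "'a::metric_space set \<Rightarrow> ('a \<Rightarrow> real measure) \<Rightarrow> bool" where
  "weakly_continuous_on S \<mu> \<longleftrightarrow>
     (\<forall>f :: real \<Rightarrow> real. continuous_on UNIV f \<and> bounded (range f) \<longrightarrow>
        continuous_on S (\<lambda>\<tau>. \<integral>x. f x \<partial>\<mu> \<tau>))"

text \<open>On the locally compact index sets used here, local uniformity is the same as uniformity on
  compact subsets.\<close>

definition loc_unif_conv ::
    "'a::metric_space set \<Rightarrow> (nat \<Rightarrow> 'a \<Rightarrow> 'b::metric_space) \<Rightarrow> ('a \<Rightarrow> 'b) \<Rightarrow> bool" where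
  "loc_unif_conv S fn f \<longleftrightarrow> (\<forall>K. compact K \<and> K \<subseteq> S \<longrightarrow> uniform_limit K fn f sequentially)"

definition weak_conv_loc_unif ::
    "'a::metric_space set \<Rightarrow> (nat \<Rightarrow> 'a \<Rightarrow> real measure) \<Rightarrow> ('a \<Rightarrow> real measure) \<Rightarrow> bool" where
  "weak_conv_loc_unif S \<mu>n \<mu> \<longleftrightarrow>
     (\<forall>K. compact K \<and> K \<subseteq> S \<longrightarrow>
       (\<forall>f :: real \<Rightarrow> real. continuous_on UNIV f \<and> bounded (range f) \<longrightarrow>
          uniform_limit K (\<lambda>n \<tau>. \<integral>x. f x \<partial>\<mu>n n \<tau>) (\<lambda>\<tau>. \<integral>x. f x \<partial>\<mu> \<tau>) sequentially))"

text \<open>Continuity of \<open>\<tau> \<mapsto> f \<tau>\<close> for the topology of locally uniform convergence on \<open>\<complex>\<^sup>+\<close>.\<close>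

definition loc_unif_continuous_on ::
    "'a::metric_space set \<Rightarrow> ('a \<Rightarrow> complex \<Rightarrow> complex) \<Rightarrow> bool" where
  "loc_unif_continuous_on S f \<longleftrightarrow>
     (\<forall>\<tau>\<in>S. \<forall>K. compact K \<and> K \<subseteq> \<complex>\<^sup>+ \<longrightarrow> uniform_limit K f (f \<tau>) (at \<tau> within S))"

definition convolution_hemigroup ::
    "real set \<Rightarrow> (real measure \<Rightarrow> real measure \<Rightarrow> real measure) \<Rightarrow> (real \<times> real \<Rightarrow> real measure) \<Rightarrow> bool"
  where
  "convolution_hemigroup I conv \<mu> \<longleftrightarrow>
     (\<forall>\<tau>\<in>time_pairs I. real_distribution (\<mu> \<tau>)) \<and>
     (\<forall>s\<in>I. \<mu> (s, s) = return borel 0) \<and>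
     (\<forall>s\<in>I. \<forall>t\<in>I. \<forall>u\<in>I. s \<le> t \<and> t \<le> u \<longrightarrow> conv (\<mu> (s, t)) (\<mu> (t, u)) = \<mu> (s, u)) \<and>
     weakly_continuous_on (time_pairs I) \<mu>"

definition P_DLC :: "real set \<Rightarrow> (real \<Rightarrow> complex \<Rightarrow> complex) \<Rightarrow> bool" where
  "P_DLC I f \<longleftrightarrow>
     (\<forall>t\<in>I. f t \<in> F_class \<and> f t holomorphic_on \<complex>\<^sup>+ \<and> inj_on (f t) \<complex>\<^sup>+) \<and>
     (\<forall>z\<in>\<complex>\<^sup>+. f 0 z = z) \<and>
     (\<forall>s\<in>I. \<forall>t\<in>I. s \<le> t \<longrightarrow> f t ` \<complex>\<^sup>+ \<subseteq> f s ` \<complex>\<^sup>+) \<and>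
     loc_unif_continuous_on I f"

definition P_REF :: "real set \<Rightarrow> (real \<times> real \<Rightarrow> complex \<Rightarrow> complex) \<Rightarrow> bool" where
  "P_REF I f \<longleftrightarrow>
     (\<forall>\<tau>\<in>time_pairs I. f \<tau> \<in> F_class) \<and>
     (\<forall>s\<in>I. \<forall>z\<in>\<complex>\<^sup>+. f (s, s) z = z) \<and>
     (\<forall>s\<in>I. \<forall>t\<in>I. \<forall>u\<in>I. s \<le> t \<and> t \<le> u \<longrightarrow> (\<forall>z\<in>\<complex>\<^sup>+. f (s, t) (f (t, u) z) = f (s, u) z)) \<and>
     loc_unif_continuous_on (time_pairs I) f"

definition generator :: "real set \<Rightarrow> (real \<Rightarrow> real) \<Rightarrow> (real \<Rightarrow> real measure) \<Rightarrow> bool" where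
  "generator I \<gamma> \<eta> \<longleftrightarrow>
     \<gamma> 0 = 0 \<and> continuous_on I \<gamma> \<and>
     (\<forall>t\<in>I. finite_borel_measure (\<eta> t)) \<and>
     \<eta> 0 = null_measure borel \<and>
     (\<forall>B\<in>sets borel. mono_on I (\<lambda>t. measure (\<eta> t) B) \<and> continuous_on I (\<lambda>t. measure (\<eta> t) B))"

text \<open>The Borel measure on \<open>\<real> \<times> I\<close> attached to \<open>\<eta>\<close>; for a generator it exists and is unique, so it is
  characterised by a predicate rather than by a choice operator.\<close>

definition generator_measure ::
    "real set \<Rightarrow> (real \<Rightarrow> real measure) \<Rightarrow> (real \<times> real) measure \<Rightarrow> bool" where
  "generator_measure I \<eta> H \<longleftrightarrow>
     sets H = sets (restrict_space borel (UNIV \<times> I)) \<and>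
     (\<forall>B\<in>sets borel. \<forall>(s, t)\<in>time_pairs I.
        emeasure H (B \<times> {s<..t}) = ennreal (measure (\<eta> t) B - measure (\<eta> s) B)) \<and>
     emeasure H (UNIV \<times> {0}) = 0"

definition LK_integrand :: "real \<Rightarrow> real \<Rightarrow> complex" where
  "LK_integrand \<xi> x =
     (if x = 0 then - (complex_of_real \<xi>)\<^sup>2 / 2
      else (iexp (\<xi> * x) - 1 - \<i> * complex_of_real (\<xi> * x / (1 + x\<^sup>2))) *
           complex_of_real ((1 + x\<^sup>2) / x\<^sup>2))"

definition classical_hemigroup_gen ::
    "real set \<Rightarrow> (real \<Rightarrow> real) \<Rightarrow> (real \<Rightarrow> real measure) \<Rightarrow> (real \<times> real \<Rightarrow> real measure) \<Rightarrow> bool" where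
  "classical_hemigroup_gen I \<gamma> \<eta> c \<longleftrightarrow>
     convolution_hemigroup I convolution c \<and>
     (\<forall>t\<in>I. \<forall>\<xi>. char (c (0, t)) \<xi> =
        exp (\<i> * complex_of_real (\<gamma> t * \<xi>) + (CLINT x|\<eta> t. LK_integrand \<xi> x)))"

definition P_REF_gen ::
    "real set \<Rightarrow> (real \<Rightarrow> real) \<Rightarrow> (real \<Rightarrow> real measure) \<Rightarrow> (real \<times> real \<Rightarrow> complex \<Rightarrow> complex) \<Rightarrow> bool" where
  "P_REF_gen I \<gamma> \<eta> f \<longleftrightarrow>
     P_REF I f \<and>
     (\<exists>H. generator_measure I \<eta> H \<and>
       (\<forall>(s, t)\<in>time_pairs I. \<forall>z\<in>\<complex>\<^sup>+.
          f (s, t) z = z + complex_of_real (\<gamma> s) - complex_of_real (\<gamma> t) +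
            (CLINT p:UNIV \<times> {s..t}|H.
               (case p of (x, r) \<Rightarrow>
                  (1 + complex_of_real x * f (r, t) z) / (complex_of_real x - f (r, t) z)))))"

definition P_DLC_gen ::
    "real set \<Rightarrow> (real \<Rightarrow> real) \<Rightarrow> (real \<Rightarrow> real measure) \<Rightarrow> (real \<Rightarrow> complex \<Rightarrow> complex) \<Rightarrow> bool" where
  "P_DLC_gen I \<gamma> \<eta> f \<longleftrightarrow>
     P_DLC I f \<and> (\<exists>g. P_REF_gen I \<gamma> \<eta> g \<and> (\<forall>t\<in>I. \<forall>z\<in>\<complex>\<^sup>+. f t z = g (0, t) z))"

definition monotone_hemigroup_gen ::
    "real set \<Rightarrow> (real \<Rightarrow> real) \<Rightarrow> (real \<Rightarrow> real measure) \<Rightarrow> (real \<times> real \<Rightarrow> real measure) \<Rightarrow> bool" where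
  "monotone_hemigroup_gen I \<gamma> \<eta> m \<longleftrightarrow>
     convolution_hemigroup I monotone_convolution m \<and>
     (\<exists>g. P_REF_gen I \<gamma> \<eta> g \<and> (\<forall>\<tau>\<in>time_pairs I. \<forall>z\<in>\<complex>\<^sup>+. F_transform (m \<tau>) z = g \<tau> z))"

definition all_equivalent :: "bool list \<Rightarrow> bool" where
  "all_equivalent Ps \<longleftrightarrow> (\<forall>P\<in>set Ps. \<forall>Q\<in>set Ps. P \<longleftrightarrow> Q)"

end

theory Submission
  imports Defs
begin

text \<open>
  Everything attached to a generator \<open>(\<gamma>, \<eta>)\<close> depends continuously on its time parameters, and the
  index sets are locally compact.  Locally uniform convergence is therefore the same as continuous
  convergence, that is, convergence of \<open>f\<^sub>n(\<tau>\<^sub>n)\<close> to \<open>f(\<tau>)\<close> along all convergent sequences of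
  parameters and all subsequences of the index.  This reduces locally uniform weak convergence to
  ordinary weak convergence of sequences of measures, where transforms can be used.

  Classical convolution.  The characteristic function of \<open>c\<^sub>0\<^sub>,\<^sub>t\<close> is the exponential of the
  Levy--Khintchine exponent of \<open>(\<gamma>\<^sub>t, \<eta>\<^sub>t)\<close>, which depends continuously on the pair.  Conversely, weak
  convergence of the laws makes the exponents, being continuous logarithms that vanish at \<open>0\<close>, converge
  uniformly on compact sets.  The average over \<open>h\<close> in \<open>[0, 1]\<close> of the second difference
  \<open>\<psi>(\<xi>) - (\<psi>(\<xi> + h) + \<psi>(\<xi> - h)) / 2\<close> of an exponent is the characteristic function of \<open>w \<eta>\<close> for a fixed
  weight \<open>w\<close> that is continuous, bounded and bounded away from \<open>0\<close>, so Levy's continuity theorem gives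
  the convergence of \<open>\<eta>\<close> and then that of \<open>\<gamma>\<close> (\<open>LK_convergence_converse\<close>).  For the increments, divide
  characteristic functions.

  Monotone convolution.  Weak convergence of laws is locally uniform convergence of their
  \<open>F\<close>-transforms (\<open>weak_conv_loc_unif_iff_F_transform\<close>), because the imaginary part of a Cauchy transform
  is a smoothing of the measure by a Cauchy density.  What remains is the link between generators and
  reverse evolution families.  Put \<open>\<Phi>\<^sub>t(w) = \<integral> (1 + x w) / (x - w) \<eta>\<^sub>t(dx) - \<gamma>\<^sub>t\<close>.  Over a short time
  interval the integral equation says that \<open>f\<^sub>s\<^sub>,\<^sub>t(z) - z\<close> equals \<open>\<Phi>\<^sub>t(z) - \<Phi>\<^sub>s(z)\<close> up to an error that is
  a small multiple of \<open>\<eta>\<^sub>t(\<real>) - \<eta>\<^sub>s(\<real>)\<close> (\<open>one_step\<close>).  Since these masses add up over a partition,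
  both directions follow:

    \<^item> Composing short steps, and propagating errors by a discrete Gronwall argument, shows that
      convergence of \<open>\<Phi>\<close> forces convergence of the flows (\<open>euler_comparison\<close>, \<open>REF_convergence\<close>).  A constant
      sequence of generators shows that the flow of a generator is unique.
    \<^item> Summing the displacements \<open>f\<^sub>s\<^sub>,\<^sub>t(z) - z\<close> over a partition recovers \<open>\<Phi>\<close> from the flow
      (\<open>telescoping_sum\<close>).  As \<open>\<Phi>\<^sub>t(\<i>) = \<i> \<eta>\<^sub>t(\<real>) - \<gamma>\<^sub>t\<close>, and \<open>\<Phi>\<^sub>t\<close> is otherwise an affine function of the
      Cauchy transform of \<open>\<eta>\<^sub>t\<close>, the generators converge (\<open>REF_convergence_converse\<close>).

  A decreasing chain determines its transition maps \<open>f\<^sub>s\<^sub>,\<^sub>t = f\<^sub>s\<^sup>-\<^sup>1 \<circ> f\<^sub>t\<close>, and by Hurwitz's theorem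
  convergence of the univalent maps \<open>f\<^sub>t\<close> passes to them (\<open>chain_convergence_imp_REF_convergence\<close>).  Finally
  \<open>t \<mapsto> \<eta>\<^sub>t\<close> is increasing with a continuous limit, so convergence at each time is automatically locally
  uniform in time (\<open>mono_uniform_limit\<close>).
\<close>

section \<open>Continuous convergence\<close>

text \<open>Continuous convergence.  The test runs over subsequences \<open>r\<close> of the index because points at which
  uniform convergence fails are given only along a subsequence.\<close>

definition cont_conv ::
    "'a::metric_space set \<Rightarrow> (nat \<Rightarrow> 'a \<Rightarrow> 'b::metric_space) \<Rightarrow> ('a \<Rightarrow> 'b) \<Rightarrow> bool" where
  "cont_conv S fn f \<longleftrightarrow>
     (\<forall>r \<tau> l. strict_mono r \<longrightarrow> range \<tau> \<subseteq> S \<longrightarrow> l \<in> S \<longrightarrow> \<tau> \<longlonglongrightarrow> l \<longrightarrow> (\<lambda>k. fn (r k) (\<tau> k)) \<longlonglongrightarrow> f l)"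

lemma cont_convD:
  "\<lbrakk>cont_conv S fn f; strict_mono r; \<And>k. \<tau> k \<in> S; l \<in> S; \<tau> \<longlonglongrightarrow> l\<rbrakk> \<Longrightarrow> (\<lambda>k. fn (r k) (\<tau> k)) \<longlonglongrightarrow> f l"
  unfolding cont_conv_def by blast

lemma cont_convI:
  assumes "\<And>r \<tau> l. strict_mono r \<Longrightarrow> (\<And>k. \<tau> k \<in> S) \<Longrightarrow> l \<in> S \<Longrightarrow> \<tau> \<longlonglongrightarrow> l \<Longrightarrow> (\<lambda>k. fn (r k) (\<tau> k)) \<longlonglongrightarrow> f l"
  shows "cont_conv S fn f"
  unfolding cont_conv_def using assms by (simp add: image_subset_iff)

lemma compact_insert_limit:
  fixes l :: "'a::heine_borel"
  assumes "\<tau> \<longlonglongrightarrow> l"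
  shows "compact (insert l (range \<tau>))"
  using assms by (rule compact_sequence_with_limit)

text \<open>If uniform convergence fails, points where it fails can be chosen along a subsequence and, by
  compactness, convergent; there continuous convergence and continuity of the limit contradict each other.\<close>

lemma uniform_limit_if_cont_conv:
  fixes fn :: "nat \<Rightarrow> 'a::metric_space \<Rightarrow> 'b::metric_space"
  assumes K: "compact K" and cont: "continuous_on K f" and cc: "cont_conv K fn f"
  shows "uniform_limit K fn f sequentially"
proof (rule ccontr)
  assume "\<not> ?thesis"
  then obtain e where e: "e > 0" and "\<not> (\<forall>\<^sub>F n in sequentially. \<forall>x\<in>K. dist (fn n x) (f x) < e)"
    by (auto simp: uniform_limit_iff)
  then have "\<forall>N. \<exists>n\<ge>N. \<exists>x\<in>K. dist (fn n x) (f x) \<ge> e"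
    by (auto simp: eventually_sequentially not_less)
  then have inf: "infinite {n. \<exists>x\<in>K. dist (fn n x) (f x) \<ge> e}"
    unfolding infinite_nat_iff_unbounded_le by blast
  obtain r :: "nat \<Rightarrow> nat" where r: "strict_mono r" "\<And>n. r n \<in> {n. \<exists>x\<in>K. dist (fn n x) (f x) \<ge> e}"
    using infinite_enumerate[OF inf] by blast
  then have "\<forall>n. \<exists>x\<in>K. dist (fn (r n) x) (f x) \<ge> e" by blast
  then obtain x where x: "\<And>n. x n \<in> K" "\<And>n. dist (fn (r n) (x n)) (f (x n)) \<ge> e"
    by metis
  obtain l q where l: "l \<in> K" "strict_mono q" "(x \<circ> q) \<longlonglongrightarrow> l"
    using K x(1) unfolding compact_def by blast
  have 1: "(\<lambda>k. fn (r (q k)) (x (q k))) \<longlonglongrightarrow> f l"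
    using cont_convD[OF cc, of "r \<circ> q" "x \<circ> q" l] l r(1) x(1) by (auto simp: strict_mono_o)
  have 2: "(\<lambda>k. f (x (q k))) \<longlonglongrightarrow> f l"
    using cont l x(1) unfolding continuous_on_sequentially by (auto simp: o_def)
  have "(\<lambda>k. dist (fn (r (q k)) (x (q k))) (f (x (q k)))) \<longlonglongrightarrow> dist (f l) (f l)"
    by (intro tendsto_dist 1 2)
  then have "eventually (\<lambda>k. dist (fn (r (q k)) (x (q k))) (f (x (q k))) < e) sequentially"
    using e by (auto simp: order_tendsto_iff)
  then show False
    using x(2) by (auto simp: eventually_sequentially not_less[symmetric])
qed

lemma cont_conv_subset: "cont_conv S fn f \<Longrightarrow> T \<subseteq> S \<Longrightarrow> cont_conv T fn f"
  unfolding cont_conv_def by blast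

text \<open>A convergent sequence together with its limit is a compact set, so uniform convergence on compact
  sets controls it.\<close>

lemma loc_unif_conv_iff_cont_conv:
  fixes fn :: "nat \<Rightarrow> 'a::heine_borel \<Rightarrow> 'b::metric_space"
  assumes cont: "continuous_on S f"
  shows "loc_unif_conv S fn f \<longleftrightarrow> cont_conv S fn f"
proof
  assume "cont_conv S fn f"
  then show "loc_unif_conv S fn f"
    unfolding loc_unif_conv_def
    by (intro allI impI uniform_limit_if_cont_conv)
       (blast intro: continuous_on_subset[OF cont] cont_conv_subset)+
next
  assume L: "loc_unif_conv S fn f"
  show "cont_conv S fn f"
    unfolding cont_conv_def
  proof (intro allI impI)
    fix r \<tau> l assume r: "strict_mono (r::nat\<Rightarrow>nat)" and \<tau>: "range \<tau> \<subseteq> S" "l \<in> S" "\<tau> \<longlonglongrightarrow> l"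
    define K where "K = insert l (range \<tau>)"
    have K: "compact K" "K \<subseteq> S" unfolding K_def using compact_insert_limit[OF \<tau>(3)] \<tau>(1,2) by simp_all
    then have "uniform_limit K fn f sequentially" using L by (auto simp: loc_unif_conv_def)
    then have ul: "uniform_limit K (\<lambda>n. fn (r n)) f sequentially"
      by (rule filterlim_compose[OF _ filterlim_subseq[OF r]])
    have 2: "(\<lambda>k. f (\<tau> k)) \<longlonglongrightarrow> f l"
      using \<tau> cont[unfolded continuous_on_sequentially, rule_format, of l \<tau>] by (simp add: o_def image_subset_iff)
    have "(\<lambda>k. dist (fn (r k) (\<tau> k)) (f (\<tau> k))) \<longlonglongrightarrow> 0"
      unfolding tendsto_iff
    proof (intro allI impI)
      fix e::real assume "e > 0"
      with ul have "\<forall>\<^sub>F n in sequentially. \<forall>x\<in>K. dist (fn (r n) x) (f x) < e"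
        by (auto simp: uniform_limit_iff)
      then show "\<forall>\<^sub>F x in sequentially. dist (dist (fn (r x) (\<tau> x)) (f (\<tau> x))) 0 < e"
        by eventually_elim (auto simp: K_def)
    qed
    from tendsto_add[OF this tendsto_dist[OF 2 tendsto_const[of "f l"]]]
    have "(\<lambda>k. dist (fn (r k) (\<tau> k)) (f (\<tau> k)) + dist (f (\<tau> k)) (f l)) \<longlonglongrightarrow> 0" by simp
    then have "(\<lambda>k. dist (fn (r k) (\<tau> k)) (f l)) \<longlonglongrightarrow> 0"
      by (rule tendsto_sandwich[OF _ _ tendsto_const, rotated 2]) (simp_all add: dist_triangle)
    then show "(\<lambda>k. fn (r k) (\<tau> k)) \<longlonglongrightarrow> f l"
      by (rule tendsto_dist_iff[THEN iffD2])
  qed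
qed

text \<open>The sequential form makes the continuity theorems for characteristic functions and Cauchy transforms
  applicable to families.\<close>

lemma weak_conv_loc_unif_iff_sequential:
  fixes S :: "'a::heine_borel set"
  assumes cont: "weakly_continuous_on S \<mu>"
  shows "weak_conv_loc_unif S \<mu>n \<mu> \<longleftrightarrow>
     (\<forall>r \<tau> l. strict_mono r \<longrightarrow> range \<tau> \<subseteq> S \<longrightarrow> l \<in> S \<longrightarrow> \<tau> \<longlonglongrightarrow> l \<longrightarrow>
        weak_conv_finite (\<lambda>k. \<mu>n (r k) (\<tau> k)) (\<mu> l))"
proof -
  have "weak_conv_loc_unif S \<mu>n \<mu> \<longleftrightarrow> (\<forall>f :: real \<Rightarrow> real. continuous_on UNIV f \<and> bounded (range f) \<longrightarrow>
          loc_unif_conv S (\<lambda>n \<tau>. \<integral>x. f x \<partial>\<mu>n n \<tau>) (\<lambda>\<tau>. \<integral>x. f x \<partial>\<mu> \<tau>))"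
    unfolding weak_conv_loc_unif_def loc_unif_conv_def by blast
  also have "\<dots> \<longleftrightarrow> (\<forall>f :: real \<Rightarrow> real. continuous_on UNIV f \<and> bounded (range f) \<longrightarrow>
          cont_conv S (\<lambda>n \<tau>. \<integral>x. f x \<partial>\<mu>n n \<tau>) (\<lambda>\<tau>. \<integral>x. f x \<partial>\<mu> \<tau>))"
    using cont loc_unif_conv_iff_cont_conv unfolding weakly_continuous_on_def by blast
  finally show ?thesis
    unfolding cont_conv_def weak_conv_finite_def by blast
qed

lemma weak_conv_finite_subseq:
  assumes "weak_conv_finite \<mu>n \<mu>" "strict_mono r"
  shows "weak_conv_finite (\<lambda>k. \<mu>n (r k)) \<mu>"
  unfolding weak_conv_finite_def
proof (intro allI impI)
  fix f :: "real \<Rightarrow> real" assume "continuous_on UNIV f \<and> bounded (range f)"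
  then have "(\<lambda>n. integral\<^sup>L (\<mu>n n) f) \<longlonglongrightarrow> integral\<^sup>L \<mu> f"
    using assms(1) by (simp add: weak_conv_finite_def)
  from LIMSEQ_subseq_LIMSEQ[OF this assms(2)]
  show "(\<lambda>k. integral\<^sup>L (\<mu>n (r k)) f) \<longlonglongrightarrow> integral\<^sup>L \<mu> f"
    by (simp add: o_def)
qed

lemma loc_unif_conv_const: "loc_unif_conv S (\<lambda>_. f) f"
  by (simp add: loc_unif_conv_def uniform_limit_iff)

lemma weak_conv_loc_unif_const: "weak_conv_loc_unif S (\<lambda>_. \<mu>) \<mu>"
  by (simp add: weak_conv_loc_unif_def uniform_limit_iff)

text \<open>Used to read off the continuity of a limit from a convergence theorem applied to a constant sequence.\<close>

lemma continuous_on_if_cont_conv_const: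
  fixes f :: "'a::metric_space \<Rightarrow> 'b::metric_space"
  assumes "cont_conv S (\<lambda>_. f) f"
  shows "continuous_on S f"
  unfolding continuous_on_sequentially
proof (intro allI ballI impI)
  fix x :: "nat \<Rightarrow> 'a" and a assume a: "a \<in> S" and x: "(\<forall>n. x n \<in> S) \<and> x \<longlonglongrightarrow> a"
  have "strict_mono (\<lambda>k::nat. k)" by (simp add: strict_mono_def)
  from cont_convD[OF assms this _ a] show "(f \<circ> x) \<longlonglongrightarrow> f a" using x by (simp add: comp_def)
qed

lemma loc_unif_conv_cong:
  assumes "\<And>n x. x \<in> S \<Longrightarrow> fn n x = gn n x" "\<And>x. x \<in> S \<Longrightarrow> f x = g x"
  shows "loc_unif_conv S fn f \<longleftrightarrow> loc_unif_conv S gn g"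
proof -
  have "uniform_limit K fn f sequentially \<longleftrightarrow> uniform_limit K gn g sequentially" if "K \<subseteq> S" for K
  proof -
    have "\<And>n x. x \<in> K \<Longrightarrow> fn n x = gn n x" "\<And>x. x \<in> K \<Longrightarrow> f x = g x" using assms that by blast+
    then show ?thesis unfolding uniform_limit_iff by simp
  qed
  then show ?thesis unfolding loc_unif_conv_def by blast
qed

lemma loc_unif_conv_compose:
  assumes "loc_unif_conv S' fn f" "continuous_on S j" "j ` S \<subseteq> S'"
  shows "loc_unif_conv S (\<lambda>n x. fn n (j x)) (\<lambda>x. f (j x))"
  unfolding loc_unif_conv_def
proof (intro allI impI, elim conjE)
  fix K assume K: "compact K" "K \<subseteq> S"
  have "compact (j ` K)" by (intro compact_continuous_image continuous_on_subset[OF assms(2)] K)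
  moreover have "j ` K \<subseteq> S'" using K assms(3) by auto
  ultimately have "uniform_limit (j ` K) fn f sequentially" using assms(1) by (simp add: loc_unif_conv_def)
  then show "uniform_limit K (\<lambda>n x. fn n (j x)) (\<lambda>x. f (j x)) sequentially" unfolding uniform_limit_iff by simp
qed

lemma weak_conv_loc_unif_compose:
  assumes "weak_conv_loc_unif S' \<mu>n \<mu>" "continuous_on S j" "j ` S \<subseteq> S'"
  shows "weak_conv_loc_unif S (\<lambda>n x. \<mu>n n (j x)) (\<lambda>x. \<mu> (j x))"
proof -
  have iff: "weak_conv_loc_unif S \<mu>n \<mu> \<longleftrightarrow> (\<forall>f :: real \<Rightarrow> real. continuous_on UNIV f \<and> bounded (range f) \<longrightarrow>
          loc_unif_conv S (\<lambda>n \<tau>. \<integral>x. f x \<partial>\<mu>n n \<tau>) (\<lambda>\<tau>. \<integral>x. f x \<partial>\<mu> \<tau>))" for S \<mu>n \<mu>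
    unfolding weak_conv_loc_unif_def loc_unif_conv_def by blast
  show ?thesis using assms(1) loc_unif_conv_compose[OF _ assms(2,3)] unfolding iff by blast
qed

lemma weakly_continuous_on_compose:
  assumes "weakly_continuous_on S' \<mu>" "continuous_on S j" "j ` S \<subseteq> S'"
  shows "weakly_continuous_on S (\<lambda>x. \<mu> (j x))"
  using assms(1) continuous_on_compose2[OF _ assms(2,3)] unfolding weakly_continuous_on_def by blast

text \<open>Polya's theorem: a monotone function is squeezed between its values at two nearby times, where pointwise
  convergence is enough.\<close>

lemma mono_uniform_limit:
  fixes F :: "real \<Rightarrow> real"
  assumes mono: "\<And>n s t. 0 \<le> s \<Longrightarrow> s \<le> t \<Longrightarrow> t \<le> b \<Longrightarrow> Fn n s \<le> Fn n t"
    and cont: "continuous_on {0..b} F" and conv: "\<And>t. t \<in> {0..b} \<Longrightarrow> (\<lambda>n. Fn n t) \<longlonglongrightarrow> F t"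
  shows "uniform_limit {0..b} Fn F sequentially"
proof (rule uniform_limit_if_cont_conv[OF compact_Icc cont], rule cont_convI)
  fix r :: "nat \<Rightarrow> nat" and \<tau> :: "nat \<Rightarrow> real" and l
  assume r: "strict_mono r" and \<tau>: "\<And>k. \<tau> k \<in> {0..b}" "l \<in> {0..b}" "\<tau> \<longlonglongrightarrow> l"
  show "(\<lambda>k. Fn (r k) (\<tau> k)) \<longlonglongrightarrow> F l"
  proof (rule LIMSEQ_I)
    fix e :: real assume e: "e > 0"
    then obtain d where d: "d > 0" "\<And>x. x \<in> {0..b} \<Longrightarrow> dist x l < d \<Longrightarrow> dist (F x) (F l) < e / 2"
      using cont \<tau>(2) unfolding continuous_on_iff by (meson half_gt_zero)
    define p where "p = max 0 (l - d / 2)"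
    define q where "q = min b (l + d / 2)"
    have pq: "p \<in> {0..b}" "q \<in> {0..b}" "dist p l < d" "dist q l < d"
      using \<tau>(2) d(1) by (auto simp: p_def q_def dist_real_def)
    have lim: "(\<lambda>k. Fn (r k) t) \<longlonglongrightarrow> F t" if "t \<in> {0..b}" for t
      using LIMSEQ_subseq_LIMSEQ[OF conv[OF that] r] by (simp add: o_def)
    have ev: "\<forall>\<^sub>F k in sequentially. dist (Fn (r k) p) (F p) < e / 2" "\<forall>\<^sub>F k in sequentially. dist (Fn (r k) q) (F q) < e / 2"
      "\<forall>\<^sub>F k in sequentially. dist (\<tau> k) l < d / 2"
      using tendstoD[OF lim[OF pq(1)], of "e / 2"] tendstoD[OF lim[OF pq(2)], of "e / 2"] tendstoD[OF \<tau>(3), of "d / 2"] e d(1) by auto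
    have "\<forall>\<^sub>F k in sequentially. norm (Fn (r k) (\<tau> k) - F l) < e"
      using ev
    proof eventually_elim
      case (elim k)
      have t: "p \<le> \<tau> k" "\<tau> k \<le> q" "0 \<le> p" "q \<le> b" "0 \<le> \<tau> k" "\<tau> k \<le> b"
      proof -
        have "l - d / 2 \<le> \<tau> k" "\<tau> k \<le> l + d / 2" using elim(3) unfolding dist_real_def by linarith+
        then show "p \<le> \<tau> k" "\<tau> k \<le> q" "0 \<le> p" "q \<le> b" "0 \<le> \<tau> k" "\<tau> k \<le> b"
          using \<tau>(1)[of k] by (auto simp: p_def q_def)
      qed
      have "Fn (r k) p \<le> Fn (r k) (\<tau> k)" "Fn (r k) (\<tau> k) \<le> Fn (r k) q"
        using mono t by auto
      then show ?case using elim(1,2) d(2)[OF pq(1,3)] d(2)[OF pq(2,4)] unfolding dist_real_def real_norm_def by linarith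
    qed
    then show "\<exists>no. \<forall>n\<ge>no. norm (Fn (r n) (\<tau> n) - F l) < e" by (simp add: eventually_sequentially)
  qed
qed

section \<open>Weak convergence of finite measures\<close>

lemma norm_integral_le_mass:
  fixes f :: "'a \<Rightarrow> 'b::{banach, second_countable_topology}"
  assumes M: "finite_measure M" and "0 \<le> B" "\<And>x. x \<in> space M \<Longrightarrow> norm (f x) \<le> B"
  shows "norm (integral\<^sup>L M f) \<le> B * measure M (space M)"
proof (cases "integrable M f")
  case True
  interpret finite_measure M by fact
  have "norm (integral\<^sup>L M f) \<le> (\<integral>x. norm (f x) \<partial>M)" by (rule integral_norm_bound)
  also have "\<dots> \<le> (\<integral>x. B \<partial>M)" using True assms by (intro integral_mono) auto
  finally show ?thesis by (simp add: mult.commute)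
next
  case False
  then show ?thesis using assms by (simp add: not_integrable_integral_eq)
qed

lemma (in finite_borel_measure) measurable_borel_M: "f \<in> borel_measurable borel \<Longrightarrow> f \<in> borel_measurable M"
  using M_is_borel by (simp add: measurable_def sets_eq_imp_space_eq)

lemma (in finite_borel_measure) integrable_bounded:
  fixes f :: "real \<Rightarrow> 'b::{banach, second_countable_topology}"
  assumes "f \<in> borel_measurable borel" "\<And>x. norm (f x) \<le> B"
  shows "integrable M f"
  using assms measurable_borel_M by (intro integrable_const_bound[where B=B]) auto

lemma weak_conv_m_imp_weak_conv_finite:
  assumes "\<And>n. real_distribution (Pn n)" "real_distribution P" "weak_conv_m Pn P"
  shows "weak_conv_finite Pn P"
  unfolding weak_conv_finite_def
proof (intro allI impI, elim conjE)
  fix f :: "real \<Rightarrow> real" assume f: "continuous_on UNIV f" "bounded (range f)"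
  then obtain B where B: "\<And>x. norm (f x) \<le> B" by (auto simp: bounded_iff)
  show "(\<lambda>n. integral\<^sup>L (Pn n) f) \<longlonglongrightarrow> integral\<^sup>L P f"
    by (rule weak_conv_imp_integral_bdd_continuous_conv[OF assms _ B])
       (use f in \<open>auto simp: continuous_on_eq_continuous_at\<close>)
qed

lemma weak_conv_finite_imp_weak_conv_m:
  assumes "\<And>n. real_distribution (Pn n)" "real_distribution P" "weak_conv_finite Pn P"
  shows "weak_conv_m Pn P"
  using assms
  by (intro integral_bdd_continuous_conv_imp_weak_conv)
     (auto simp: weak_conv_finite_def bounded_iff continuous_on_eq_continuous_at)

lemma weak_conv_finite_complex:
  fixes f :: "real \<Rightarrow> complex"
  assumes "weak_conv_finite \<nu>n \<nu>" and fin: "\<And>n. finite_borel_measure (\<nu>n n)" "finite_borel_measure \<nu>"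
    and f: "continuous_on UNIV f" "bounded (range f)"
  shows "(\<lambda>n. \<integral>x. f x \<partial>\<nu>n n) \<longlonglongrightarrow> (\<integral>x. f x \<partial>\<nu>)"
proof -
  obtain B where B: "\<And>x. norm (f x) \<le> B" using f by (auto simp: bounded_iff)
  have m: "f \<in> borel_measurable borel" using f by (simp add: borel_measurable_continuous_onI)
  have i: "integrable M f" if "finite_borel_measure M" for M
    using that finite_borel_measure.integrable_bounded m B by blast
  have "\<bar>Re (f x)\<bar> \<le> B" "\<bar>Im (f x)\<bar> \<le> B" for x
    using B[of x] abs_Re_le_cmod[of "f x"] abs_Im_le_cmod[of "f x"] by linarith+
  then have b: "bounded (range (\<lambda>x. Re (f x)))" "bounded (range (\<lambda>x. Im (f x)))"
    by (auto simp: bounded_iff)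
  have "(\<lambda>n. \<integral>x. Re (f x) \<partial>\<nu>n n) \<longlonglongrightarrow> (\<integral>x. Re (f x) \<partial>\<nu>)"
       "(\<lambda>n. \<integral>x. Im (f x) \<partial>\<nu>n n) \<longlonglongrightarrow> (\<integral>x. Im (f x) \<partial>\<nu>)"
    using assms(1) b f unfolding weak_conv_finite_def by (auto intro!: continuous_intros)
  then have "(\<lambda>n. Re (\<integral>x. f x \<partial>\<nu>n n)) \<longlonglongrightarrow> Re (\<integral>x. f x \<partial>\<nu>)"
       "(\<lambda>n. Im (\<integral>x. f x \<partial>\<nu>n n)) \<longlonglongrightarrow> Im (\<integral>x. f x \<partial>\<nu>)"
    by (simp_all add: integral_Re[OF i] integral_Im[OF i] fin)
  then show ?thesis by (simp add: tendsto_complex_iff)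
qed

lemma weak_conv_finite_mass:
  assumes "weak_conv_finite \<nu>n \<nu>" and fin: "\<And>n. finite_borel_measure (\<nu>n n)" "finite_borel_measure \<nu>"
  shows "(\<lambda>n. measure (\<nu>n n) UNIV) \<longlonglongrightarrow> measure \<nu> UNIV"
proof -
  have "(\<lambda>n. \<integral>x. (1::real) \<partial>\<nu>n n) \<longlonglongrightarrow> (\<integral>x. 1 \<partial>\<nu>)"
    using assms(1) unfolding weak_conv_finite_def by (elim allE[of _ "\<lambda>_. 1"]) auto
  then show ?thesis using fin by (simp add: finite_borel_measure.borel_UNIV)
qed

text \<open>The null measure is sent to a point mass so that the result is always a probability measure.\<close>

definition normalized :: "real measure \<Rightarrow> real measure" where
  "normalized M = (if measure M UNIV = 0 then return borel 0 else density M (\<lambda>_. ennreal (1 / measure M UNIV)))"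

lemma normalized_real_distribution:
  assumes "finite_borel_measure M"
  shows "real_distribution (normalized M)"
proof (cases "measure M UNIV = 0")
  case True
  then show ?thesis
    by (simp add: normalized_def real_distribution_def real_distribution_axioms_def prob_space_return)
next
  case False
  interpret finite_borel_measure M by fact
  have "emeasure (density M (\<lambda>_. ennreal (1 / measure M UNIV))) (space M) = ennreal (1 / measure M UNIV) * emeasure M (space M)"
    by (subst emeasure_density) (auto simp: nn_integral_cmult_indicator)
  also have "\<dots> = 1"
    using False by (simp add: emeasure_eq_measure borel_UNIV flip: ennreal_mult')
  finally have "prob_space (density M (\<lambda>_. ennreal (1 / measure M UNIV)))"
    by (intro prob_spaceI) simp
  then show ?thesis using False M_is_borel
    by (auto simp: normalized_def real_distribution_def real_distribution_axioms_def)
qed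

lemma integral_normalized:
  fixes f :: "real \<Rightarrow> 'b::{banach, second_countable_topology}"
  assumes "finite_borel_measure M" "f \<in> borel_measurable borel" "measure M UNIV \<noteq> 0"
  shows "(\<integral>x. f x \<partial>normalized M) = (1 / measure M UNIV) *\<^sub>R (\<integral>x. f x \<partial>M)"
proof -
  interpret finite_borel_measure M by fact
  have "f \<in> borel_measurable M" using assms(2) by (rule measurable_borel_M)
  then show ?thesis using assms(3) by (simp add: normalized_def integral_density)
qed

text \<open>A family of test functions that detects weak convergence of probability measures also detects it for
  finite measures whose masses converge: divide by the masses if the limit mass is positive, and otherwise all
  integrals of bounded functions tend to \<open>0\<close>.  It is applied to exponentials and to resolvents.\<close>

lemma weak_conv_finite_from_test_family:
  fixes \<phi> :: "'j \<Rightarrow> real \<Rightarrow> complex"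
  assumes det: "\<And>Pn P. \<lbrakk>\<And>n. real_distribution (Pn n); real_distribution P;
        \<And>j. j \<in> J \<Longrightarrow> (\<lambda>n. \<integral>x. \<phi> j x \<partial>Pn n) \<longlonglongrightarrow> (\<integral>x. \<phi> j x \<partial>P)\<rbrakk> \<Longrightarrow> weak_conv_m Pn P"
    and meas: "\<And>j. j \<in> J \<Longrightarrow> \<phi> j \<in> borel_measurable borel"
    and fin: "\<And>n. finite_borel_measure (\<nu>n n)" "finite_borel_measure \<nu>"
    and mass: "(\<lambda>n. measure (\<nu>n n) UNIV) \<longlonglongrightarrow> measure \<nu> UNIV"
    and test: "\<And>j. j \<in> J \<Longrightarrow> (\<lambda>n. \<integral>x. \<phi> j x \<partial>\<nu>n n) \<longlonglongrightarrow> (\<integral>x. \<phi> j x \<partial>\<nu>)"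
  shows "weak_conv_finite \<nu>n \<nu>"
proof (cases "measure \<nu> UNIV = 0")
  case True
  show ?thesis unfolding weak_conv_finite_def
  proof (intro allI impI, elim conjE)
    fix f :: "real \<Rightarrow> real" assume f: "bounded (range f)"
    then obtain B where B: "\<And>x. norm (f x) \<le> B" by (auto simp: bounded_iff)
    have B0: "0 \<le> B" using B[of 0] norm_ge_zero order_trans by blast
    have le: "norm (\<integral>x. f x \<partial>M) \<le> B * measure M UNIV" if "finite_borel_measure M" for M
    proof -
      interpret finite_borel_measure M by fact
      show ?thesis using norm_integral_le_mass[OF finite_measure_axioms B0, of f] B by (simp add: borel_UNIV)
    qed
    have "(\<lambda>n. B * measure (\<nu>n n) UNIV) \<longlonglongrightarrow> B * 0"
      using mass True by (intro tendsto_intros) simp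
    then have "(\<lambda>n. \<integral>x. f x \<partial>\<nu>n n) \<longlonglongrightarrow> 0"
      using le fin by (intro Lim_null_comparison[of "\<lambda>n. \<integral>x. f x \<partial>\<nu>n n" "\<lambda>n. B * measure (\<nu>n n) UNIV"]) auto
    moreover have "(\<integral>x. f x \<partial>\<nu>) = 0" using le[OF fin(2)] True by simp
    ultimately show "(\<lambda>n. \<integral>x. f x \<partial>\<nu>n n) \<longlonglongrightarrow> (\<integral>x. f x \<partial>\<nu>)" by simp
  qed
next
  case False
  have ev: "\<forall>\<^sub>F n in sequentially. measure (\<nu>n n) UNIV \<noteq> 0"
    using tendsto_imp_eventually_ne[OF mass False] .
  have norm_conv: "(\<lambda>n. \<integral>x. f x \<partial>normalized (\<nu>n n)) \<longlonglongrightarrow> (\<integral>x. f x \<partial>normalized \<nu>)"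
    if "f \<in> borel_measurable borel" "(\<lambda>n. \<integral>x. f x \<partial>\<nu>n n) \<longlonglongrightarrow> (\<integral>x. f x \<partial>\<nu>)" for f :: "real \<Rightarrow> complex"
  proof -
    have "(\<lambda>n. (1 / measure (\<nu>n n) UNIV) *\<^sub>R (\<integral>x. f x \<partial>\<nu>n n)) \<longlonglongrightarrow> (1 / measure \<nu> UNIV) *\<^sub>R (\<integral>x. f x \<partial>\<nu>)"
      by (intro tendsto_intros mass that False)
    moreover have "\<forall>\<^sub>F n in sequentially. (\<integral>x. f x \<partial>normalized (\<nu>n n)) = (1 / measure (\<nu>n n) UNIV) *\<^sub>R (\<integral>x. f x \<partial>\<nu>n n)"
      using ev by eventually_elim (simp add: integral_normalized fin that)
    ultimately show ?thesis
      by (simp add: integral_normalized[OF fin(2) that(1) False] tendsto_cong)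
  qed
  have nd: "\<And>n. real_distribution (normalized (\<nu>n n))" "real_distribution (normalized \<nu>)"
    using normalized_real_distribution fin by auto
  have "weak_conv_m (\<lambda>n. normalized (\<nu>n n)) (normalized \<nu>)"
    using norm_conv test meas nd by (intro det) auto
  then have w: "weak_conv_finite (\<lambda>n. normalized (\<nu>n n)) (normalized \<nu>)"
    by (rule weak_conv_m_imp_weak_conv_finite[OF nd])
  show ?thesis unfolding weak_conv_finite_def
  proof (intro allI impI)
    fix f :: "real \<Rightarrow> real" assume f: "continuous_on UNIV f \<and> bounded (range f)"
    then have m: "f \<in> borel_measurable borel" by (simp add: borel_measurable_continuous_onI)
    have "(\<lambda>n. measure (\<nu>n n) UNIV * (\<integral>x. f x \<partial>normalized (\<nu>n n))) \<longlonglongrightarrow> measure \<nu> UNIV * (\<integral>x. f x \<partial>normalized \<nu>)"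
      using w f mass by (intro tendsto_intros) (auto simp: weak_conv_finite_def)
    moreover have "\<forall>\<^sub>F n in sequentially. measure (\<nu>n n) UNIV * (\<integral>x. f x \<partial>normalized (\<nu>n n)) = (\<integral>x. f x \<partial>\<nu>n n)"
      using ev by eventually_elim (simp add: integral_normalized fin m)
    ultimately show "(\<lambda>n. \<integral>x. f x \<partial>\<nu>n n) \<longlonglongrightarrow> (\<integral>x. f x \<partial>\<nu>)"
      by (simp add: integral_normalized fin m False tendsto_cong)
  qed
qed

text \<open>Levy's continuity theorem for finite measures; the value at \<open>0\<close> supplies the masses.\<close>

lemma weak_conv_finite_from_char:
  assumes fin: "\<And>n. finite_borel_measure (\<nu>n n)" "finite_borel_measure \<nu>"
    and conv: "\<And>\<xi>. (\<lambda>n. char (\<nu>n n) \<xi>) \<longlonglongrightarrow> char \<nu> \<xi>"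
  shows "weak_conv_finite \<nu>n \<nu>"
proof (rule weak_conv_finite_from_test_family[where J = UNIV and \<phi> = "\<lambda>\<xi> x. iexp (\<xi> * x)"])
  show "weak_conv_m Pn P" if "\<And>n. real_distribution (Pn n)" "real_distribution P"
      "\<And>\<xi>. \<xi> \<in> UNIV \<Longrightarrow> (\<lambda>n. \<integral>x. iexp (\<xi> * x) \<partial>Pn n) \<longlonglongrightarrow> (\<integral>x. iexp (\<xi> * x) \<partial>P)" for Pn P
    using that by (intro levy_continuity) (auto simp: char_def)
  have "char M 0 = measure M UNIV" if "finite_borel_measure M" for M
    using that by (simp add: char_def finite_borel_measure.borel_UNIV scaleR_conv_of_real)
  then have "(\<lambda>n. complex_of_real (measure (\<nu>n n) UNIV)) \<longlonglongrightarrow> complex_of_real (measure \<nu> UNIV)"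
    using conv[of 0] fin by simp
  then show "(\<lambda>n. measure (\<nu>n n) UNIV) \<longlonglongrightarrow> measure \<nu> UNIV"
    by (rule tendsto_of_real_iff[THEN iffD1])
qed (use conv fin in \<open>auto simp: char_def\<close>)

section \<open>Cauchy transforms and weak convergence\<close>

lemma UHP_iff: "z \<in> \<complex>\<^sup>+ \<longleftrightarrow> Im z > 0"
  by (simp add: upper_half_plane_def)

lemma Im_le_norm_diff_real: "\<bar>Im z\<bar> \<le> cmod (z - complex_of_real x)"
  using abs_Im_le_cmod[of "z - complex_of_real x"] by simp

lemma UHP_neq_real: "Im z > 0 \<Longrightarrow> z - complex_of_real x \<noteq> 0"
  by (metis Im_complex_of_real diff_eq_diff_eq diff_self less_irrefl minus_complex.simps(2))

lemma norm_resolvent_le: "Im z > 0 \<Longrightarrow> norm (1 / (z - complex_of_real x)) \<le> 1 / Im z"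
  using Im_le_norm_diff_real[of z x] by (simp add: norm_divide frac_le)

lemma norm_resolvent_diff_le:
  assumes "Im z > 0" "Im w > 0"
  shows "norm (1 / (z - complex_of_real x) - 1 / (w - complex_of_real x)) \<le> norm (z - w) / (Im z * Im w)"
proof -
  have "1 / (z - complex_of_real x) - 1 / (w - complex_of_real x)
      = (w - z) * (1 / (z - complex_of_real x)) * (1 / (w - complex_of_real x))"
    using UHP_neq_real[OF assms(1), of x] UHP_neq_real[OF assms(2), of x] by (simp add: field_simps)
  then have "norm (1 / (z - complex_of_real x) - 1 / (w - complex_of_real x))
      = norm (w - z) * norm (1 / (z - complex_of_real x)) * norm (1 / (w - complex_of_real x))"
    by (simp only: norm_mult)
  also have "\<dots> \<le> norm (w - z) * (1 / Im z) * (1 / Im w)"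
    using assms by (intro mult_mono norm_resolvent_le) auto
  finally show ?thesis by (simp add: norm_minus_commute)
qed

lemma continuous_resolvent: "Im z > 0 \<Longrightarrow> continuous_on UNIV (\<lambda>x. 1 / (z - complex_of_real x))"
  using UHP_neq_real by (intro continuous_intros) auto

lemma bounded_resolvent: "Im z > 0 \<Longrightarrow> bounded (range (\<lambda>x. 1 / (z - complex_of_real x)))"
  using norm_resolvent_le by (fastforce simp: bounded_iff)

lemma measurable_resolvent [measurable]: "(\<lambda>x. 1 / (z - complex_of_real x)) \<in> borel_measurable borel"
  by measurable

lemma integrable_resolvent:
  assumes "finite_borel_measure \<mu>" "Im z > 0"
  shows "integrable \<mu> (\<lambda>x. 1 / (z - complex_of_real x))"
  using finite_borel_measure.integrable_bounded[OF assms(1) measurable_resolvent norm_resolvent_le[OF assms(2)]] .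

text \<open>The resolvents are Lipschitz in \<open>z\<close> uniformly in \<open>x\<close>, so moving points \<open>z\<^sub>n\<close> cause no tightness problem.\<close>

lemma Cauchy_transform_diff_le:
  assumes "finite_borel_measure \<mu>" "Im z > 0" "Im w > 0"
  shows "norm (Cauchy_transform \<mu> z - Cauchy_transform \<mu> w) \<le> norm (z - w) / (Im z * Im w) * measure \<mu> UNIV"
proof -
  interpret finite_borel_measure \<mu> by fact
  have "Cauchy_transform \<mu> z - Cauchy_transform \<mu> w =
      (CLINT x|\<mu>. 1 / (z - complex_of_real x) - 1 / (w - complex_of_real x))"
    unfolding Cauchy_transform_def using assms integrable_resolvent by (subst Bochner_Integration.integral_diff) auto
  also have "norm \<dots> \<le> norm (z - w) / (Im z * Im w) * measure \<mu> (space \<mu>)"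
    using assms by (intro norm_integral_le_mass finite_measure_axioms norm_resolvent_diff_le) auto
  finally show ?thesis by (simp add: borel_UNIV)
qed

lemma Cauchy_transform_tendsto:
  assumes w: "weak_conv_finite \<mu>n \<mu>" and fin: "\<And>n. finite_borel_measure (\<mu>n n)" "finite_borel_measure \<mu>"
    and z: "zn \<longlonglongrightarrow> z" "\<And>n. Im (zn n) > 0" "Im z > 0"
  shows "(\<lambda>n. Cauchy_transform (\<mu>n n) (zn n)) \<longlonglongrightarrow> Cauchy_transform \<mu> z"
proof -
  have 1: "(\<lambda>n. Cauchy_transform (\<mu>n n) z) \<longlonglongrightarrow> Cauchy_transform \<mu> z"
    unfolding Cauchy_transform_def
    by (rule weak_conv_finite_complex[OF w fin continuous_resolvent[OF z(3)] bounded_resolvent[OF z(3)]])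
  have "(\<lambda>n. norm (zn n - z) / (Im (zn n) * Im z) * measure (\<mu>n n) UNIV) \<longlonglongrightarrow> norm (z - z) / (Im z * Im z) * measure \<mu> UNIV"
    by (intro tendsto_intros weak_conv_finite_mass[OF w fin] z(1)) (use z(3) in simp)
  then have "(\<lambda>n. norm (zn n - z) / (Im (zn n) * Im z) * measure (\<mu>n n) UNIV) \<longlonglongrightarrow> 0" by simp
  then have "(\<lambda>n. Cauchy_transform (\<mu>n n) (zn n) - Cauchy_transform (\<mu>n n) z) \<longlonglongrightarrow> 0"
    by (rule Lim_null_comparison[rotated])
       (rule always_eventually, rule allI, rule Cauchy_transform_diff_le[OF fin(1) z(2,3)])
  from tendsto_add[OF this 1] show ?thesis by simp
qed

lemma Im_resolvent: "Im (1 / (z - complex_of_real x)) = - Im z * (norm (1 / (z - complex_of_real x)))\<^sup>2"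
  by (simp add: Im_divide norm_divide power_divide cmod_power2)

lemma Im_Cauchy_transform:
  assumes "finite_borel_measure \<mu>" "Im z > 0"
  shows "Im (Cauchy_transform \<mu> z) = - Im z * (\<integral>x. (norm (1 / (z - complex_of_real x)))\<^sup>2 \<partial>\<mu>)"
proof -
  have "Im (Cauchy_transform \<mu> z) = (\<integral>x. Im (1 / (z - complex_of_real x)) \<partial>\<mu>)"
    unfolding Cauchy_transform_def by (rule integral_Im[symmetric]) (rule integrable_resolvent[OF assms])
  then show ?thesis by (simp add: Im_resolvent)
qed

text \<open>With \<open>A = \<integral> |z - x|\<^sup>-\<^sup>2 d\<mu>\<close> one has \<open>- Im G(z) = Im z \<cdot> A\<close>, and \<open>|G(z)|\<^sup>2 \<le> A\<close> by the Cauchy--Schwarz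
  inequality, whence \<open>Im (1 / G(z)) \<ge> Im z\<close>.\<close>

lemma F_transform_Im_ge:
  assumes "real_distribution \<mu>" "Im z > 0"
  shows "Cauchy_transform \<mu> z \<noteq> 0" "Im (F_transform \<mu> z) \<ge> Im z"
proof -
  interpret real_distribution \<mu> by fact
  let ?h = "\<lambda>x. norm (1 / (z - complex_of_real x))"
  let ?G = "Cauchy_transform \<mu> z"
  have m: "?h \<in> borel_measurable borel" by measurable
  have b: "norm ((?h x)\<^sup>2) \<le> (1 / Im z)\<^sup>2" for x
    using norm_resolvent_le[OF assms(2), of x] by (simp add: power_mono)
  have i1: "integrable \<mu> ?h"
    using norm_resolvent_le[OF assms(2)] by (intro integrable_bounded[OF m, of "1 / Im z"]) auto
  have i2: "integrable \<mu> (\<lambda>x. (?h x)\<^sup>2)"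
    using m by (intro integrable_bounded[OF _ b]) measurable
  have "norm ?G \<le> (\<integral>x. ?h x \<partial>\<mu>)" unfolding Cauchy_transform_def by (rule integral_norm_bound)
  then have "(norm ?G)\<^sup>2 \<le> (\<integral>x. ?h x \<partial>\<mu>)\<^sup>2" by (simp add: power_mono)
  also have "\<dots> \<le> (\<integral>x. (?h x)\<^sup>2 \<partial>\<mu>)"
    using variance_eq[OF i1 i2] variance_positive[of ?h] by simp
  finally have le: "(norm ?G)\<^sup>2 \<le> (\<integral>x. (?h x)\<^sup>2 \<partial>\<mu>)" .
  have "(\<integral>x. (?h x)\<^sup>2 \<partial>\<mu>) > 0"
  proof (rule ccontr)
    assume "\<not> ?thesis"
    then have "(\<integral>x. (?h x)\<^sup>2 \<partial>\<mu>) = 0" by (smt (verit, best) le zero_le_power2)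
    then have "AE x in \<mu>. (?h x)\<^sup>2 = 0" using integral_nonneg_eq_0_iff_AE[OF i2] by auto
    then have "AE x in \<mu>. False" using UHP_neq_real[OF assms(2)] by auto
    then show False using AE_False by auto
  qed
  then have neg: "Im ?G < 0"
    using Im_Cauchy_transform[OF finite_borel_measure_M assms(2)] assms(2) by (simp add: mult_pos_pos)
  then show nz: "?G \<noteq> 0" by auto
  have "Im (F_transform \<mu> z) = - Im ?G / (norm ?G)\<^sup>2"
    by (simp add: F_transform_def Im_divide cmod_power2)
  also have "- Im ?G = Im z * (\<integral>x. (?h x)\<^sup>2 \<partial>\<mu>)"
    using Im_Cauchy_transform[OF finite_borel_measure_M assms(2)] by simp
  finally have "Im (F_transform \<mu> z) = Im z * ((\<integral>x. (?h x)\<^sup>2 \<partial>\<mu>) / (norm ?G)\<^sup>2)" by simp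
  moreover have "(\<integral>x. (?h x)\<^sup>2 \<partial>\<mu>) / (norm ?G)\<^sup>2 \<ge> 1" using le nz by (simp add: le_divide_eq_1)
  ultimately show "Im (F_transform \<mu> z) \<ge> Im z"
    using assms(2) mult_left_mono[of 1 _ "Im z"] by fastforce
qed

text \<open>The density of the Cauchy distribution with scale \<open>y\<close>, which is the Poisson kernel of the upper half-plane.\<close>

definition cauchy_density :: "real \<Rightarrow> real \<Rightarrow> real" where
  "cauchy_density y s = y / (pi * (s\<^sup>2 + y\<^sup>2))"

lemma cauchy_density_nonneg: "y > 0 \<Longrightarrow> cauchy_density y s \<ge> 0"
  by (simp add: cauchy_density_def)

lemma measurable_cauchy_density [measurable]: "cauchy_density y \<in> borel_measurable borel"
  unfolding cauchy_density_def[abs_def] by measurable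

lemma cauchy_density_1: "integrable lborel (cauchy_density 1)" "(\<integral>s. cauchy_density 1 s \<partial>lborel) = 1"
proof -
  have i: "integrable lborel (\<lambda>x::real. inverse (1 + x\<^sup>2))"
    using integrable_inverse_1_plus_square by (simp add: set_integrable_def)
  have v: "(\<integral>x. inverse (1 + x\<^sup>2) \<partial>lborel) = pi"
    using LBINT_inverse_1_plus_square by (simp add: interval_lebesgue_integral_def set_lebesgue_integral_def)
  have e: "cauchy_density 1 = (\<lambda>x. (1 / pi) * inverse (1 + x\<^sup>2))"
    by (auto simp: cauchy_density_def divide_simps add.commute)
  show "integrable lborel (cauchy_density 1)" unfolding e using i by simp
  show "(\<integral>s. cauchy_density 1 s \<partial>lborel) = 1" unfolding e using v by simp
qed

lemma cauchy_density_scale: "y > 0 \<Longrightarrow> y * cauchy_density y (y * s) = cauchy_density 1 s"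
proof -
  assume "y > 0"
  then have "(y * s)\<^sup>2 + y\<^sup>2 = y\<^sup>2 * (s\<^sup>2 + 1)" by (simp add: algebra_simps power2_eq_square)
  then show ?thesis using \<open>y > 0\<close> by (simp add: cauchy_density_def power2_eq_square)
qed

lemma cauchy_density_convolve:
  fixes f :: "real \<Rightarrow> real"
  assumes "y > 0"
  shows "(\<integral>u. f u * cauchy_density y (u - x) \<partial>lborel) = (\<integral>s. f (x + y * s) * cauchy_density 1 s \<partial>lborel)"
proof -
  have "(\<integral>u. f u * cauchy_density y (u - x) \<partial>lborel) =
      \<bar>y\<bar> *\<^sub>R (\<integral>s. f (x + y * s) * cauchy_density y (x + y * s - x) \<partial>lborel)"
    using assms by (intro lborel_integral_real_affine) auto
  also have "\<dots> = (\<integral>s. y * (f (x + y * s) * cauchy_density y (y * s)) \<partial>lborel)"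
    using assms by simp
  also have "\<dots> = (\<integral>s. f (x + y * s) * cauchy_density 1 s \<partial>lborel)"
    using cauchy_density_scale[OF assms] by (intro Bochner_Integration.integral_cong) (auto simp: algebra_simps)
  finally show ?thesis .
qed

lemma cauchy_density_shift_integrable:
  assumes "y > 0"
  shows "integrable lborel (\<lambda>u. cauchy_density y (u - x))" "(\<integral>u. cauchy_density y (u - x) \<partial>lborel) = 1"
proof -
  have "(\<lambda>s. cauchy_density y (x + y * s - x)) = (\<lambda>s. (1 / y) * cauchy_density 1 s)"
    using cauchy_density_scale[OF assms] assms by (auto simp: field_simps)
  then have "integrable lborel (\<lambda>s. cauchy_density y (x + y * s - x))"
    using cauchy_density_1(1) by simp
  then show "integrable lborel (\<lambda>u. cauchy_density y (u - x))"
    using lborel_integrable_real_affine_iff[of y "\<lambda>u. cauchy_density y (u - x)" x] assms by simp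
  show "(\<integral>u. cauchy_density y (u - x) \<partial>lborel) = 1"
    using cauchy_density_convolve[OF assms, of "\<lambda>_. 1" x] cauchy_density_1(2) by simp
qed

lemma Im_resolvent_cauchy_density:
  assumes "y > 0"
  shows "- Im (1 / (Complex u y - complex_of_real x)) / pi = cauchy_density y (u - x)"
  using assms by (simp add: cauchy_density_def Im_divide)

text \<open>On the line of height \<open>y\<close> the imaginary part of the Cauchy transform is the density of the convolution of
  \<open>M\<close> with the Cauchy distribution of scale \<open>y\<close>.\<close>

lemma cauchy_smoothing_density:
  assumes "finite_borel_measure M" "y > 0"
  shows "- Im (Cauchy_transform M (Complex u y)) / pi = (\<integral>x. cauchy_density y (u - x) \<partial>M)"
proof -
  have "Im (Cauchy_transform M (Complex u y)) = (\<integral>x. Im (1 / (Complex u y - complex_of_real x)) \<partial>M)"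
    unfolding Cauchy_transform_def
    by (rule integral_Im[symmetric]) (rule integrable_resolvent[OF assms(1)], simp add: assms(2))
  then have "- Im (Cauchy_transform M (Complex u y)) / pi = (\<integral>x. - Im (1 / (Complex u y - complex_of_real x)) / pi \<partial>M)"
    by simp
  then show ?thesis unfolding Im_resolvent_cauchy_density[OF assms(2)] .
qed

lemma cauchy_smoothing_Fubini:
  fixes f :: "real \<Rightarrow> real"
  assumes M: "real_distribution M" and y: "y > 0"
    and f: "f \<in> borel_measurable borel" "\<And>x. \<bar>f x\<bar> \<le> 1"
  shows "(\<integral>u. f u * (\<integral>x. cauchy_density y (u - x) \<partial>M) \<partial>lborel)
       = (\<integral>x. (\<integral>s. f (x + y * s) * cauchy_density 1 s \<partial>lborel) \<partial>M)"
    and "integrable lborel (\<lambda>u. f u * (\<integral>x. cauchy_density y (u - x) \<partial>M))"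
proof -
  interpret real_distribution M by fact
  interpret P: pair_sigma_finite M lborel
    by (simp add: pair_sigma_finite_def lborel.sigma_finite_measure_axioms sigma_finite_measure_axioms)
  define g where "g = (\<lambda>(x, u). f u * cauchy_density y (u - x))"
  have fm[measurable]: "f \<in> borel_measurable borel" by fact
  have gm: "g \<in> borel_measurable (M \<Otimes>\<^sub>M lborel)"
    unfolding g_def by measurable
  have bd: "norm (g (x, u)) \<le> cauchy_density y (u - x)" for x u
    using f(2)[of u] cauchy_density_nonneg[OF y, of "u - x"]
    by (simp add: g_def abs_mult mult_left_le_one_le)
  have gi: "integrable lborel (\<lambda>u. g (x, u))" for x
    by (rule Bochner_Integration.integrable_bound[OF cauchy_density_shift_integrable(1)[OF y, of x]])
       (use bd cauchy_density_nonneg[OF y] in \<open>auto simp: g_def\<close>)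
  have gi2: "(\<integral>u. norm (g (x, u)) \<partial>lborel) \<le> 1" for x
  proof -
    have "(\<integral>u. norm (g (x, u)) \<partial>lborel) \<le> (\<integral>u. cauchy_density y (u - x) \<partial>lborel)"
      using gi bd cauchy_density_shift_integrable(1)[OF y] by (intro integral_mono) auto
    then show ?thesis using cauchy_density_shift_integrable(2)[OF y] by simp
  qed
  have int: "integrable (M \<Otimes>\<^sub>M lborel) g"
  proof (rule P.Fubini_integrable[OF gm])
    show "integrable M (\<lambda>x. \<integral>u. norm (g (x, u)) \<partial>lborel)"
    proof (rule integrable_const_bound[where B = 1])
      show "(\<lambda>x. \<integral>u. norm (g (x, u)) \<partial>lborel) \<in> borel_measurable M"
        using gm by measurable
    qed (use gi2 in auto)
    show "AE x in M. integrable lborel (\<lambda>u. g (x, u))" using gi by auto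
  qed
  have s: "(\<integral>u. (\<integral>x. g (x, u) \<partial>M) \<partial>lborel) = (\<integral>x. (\<integral>u. g (x, u) \<partial>lborel) \<partial>M)"
    using P.integral_snd[of "\<lambda>x u. g (x, u)"] P.integral_fst[of "\<lambda>x u. g (x, u)"] int by (simp add: split_def)
  have e: "(\<integral>x. g (x, u) \<partial>M) = f u * (\<integral>x. cauchy_density y (u - x) \<partial>M)" for u
    by (simp add: g_def)
  show "(\<integral>u. f u * (\<integral>x. cauchy_density y (u - x) \<partial>M) \<partial>lborel)
       = (\<integral>x. (\<integral>s. f (x + y * s) * cauchy_density 1 s \<partial>lborel) \<partial>M)"
    using s unfolding e by (simp add: g_def cauchy_density_convolve[OF y])
  show "integrable lborel (\<lambda>u. f u * (\<integral>x. cauchy_density y (u - x) \<partial>M))"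
    using P.integrable_snd[of "\<lambda>x u. g (x, u)"] int unfolding e by (simp add: split_def)
qed

text \<open>Smoothing changes the integral of a Lipschitz function by an amount that does not depend on the measure.\<close>

lemma cauchy_smoothing_error:
  fixes f :: "real \<Rightarrow> real"
  assumes M: "real_distribution M" and y: "y > 0"
    and f: "f \<in> borel_measurable borel" "\<And>x. \<bar>f x\<bar> \<le> 1" and lip: "\<And>x x'. \<bar>f x - f x'\<bar> \<le> min 1 (C * \<bar>x - x'\<bar>)"
  shows "\<bar>(\<integral>x. f x \<partial>M) - (\<integral>u. f u * (\<integral>x. cauchy_density y (u - x) \<partial>M) \<partial>lborel)\<bar>
      \<le> (\<integral>s. min 1 (C * (y * \<bar>s\<bar>)) * cauchy_density 1 s \<partial>lborel)"
proof -
  interpret real_distribution M by fact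
  let ?g = "\<lambda>x. \<integral>s. f (x + y * s) * cauchy_density 1 s \<partial>lborel"
  let ?e = "\<integral>s. min 1 (C * (y * \<bar>s\<bar>)) * cauchy_density 1 s \<partial>lborel"
  have fm[measurable]: "f \<in> borel_measurable borel" by fact
  have C: "C \<ge> 0" using order_trans[OF abs_ge_zero lip[of 0 1]] by simp
  have i1: "integrable lborel (\<lambda>s. f (x + y * s) * cauchy_density 1 s)" for x
    using f(2) cauchy_density_nonneg[of 1]
    by (intro Bochner_Integration.integrable_bound[OF cauchy_density_1(1)])
       (auto simp: abs_mult mult_left_le_one_le)
  have i2: "integrable lborel (\<lambda>s. min 1 (C * (y * \<bar>s\<bar>)) * cauchy_density 1 s)"
    using cauchy_density_nonneg[of 1] C y
    by (intro Bochner_Integration.integrable_bound[OF cauchy_density_1(1)])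
       (auto simp: abs_mult intro!: mult_left_le_one_le)
  have d: "\<bar>f x - ?g x\<bar> \<le> ?e" for x
  proof -
    have "f x - ?g x = (\<integral>s. f x * cauchy_density 1 s - f (x + y * s) * cauchy_density 1 s \<partial>lborel)"
      using cauchy_density_1 i1 by (subst Bochner_Integration.integral_diff) auto
    also have "\<bar>\<dots>\<bar> \<le> (\<integral>s. min 1 (C * (y * \<bar>s\<bar>)) * cauchy_density 1 s \<partial>lborel)"
    proof (rule integral_abs_bound_integral)
      show "integrable lborel (\<lambda>s. f x * cauchy_density 1 s - f (x + y * s) * cauchy_density 1 s)"
        using cauchy_density_1(1) i1 by auto
      show "\<bar>f x * cauchy_density 1 s - f (x + y * s) * cauchy_density 1 s\<bar> \<le> min 1 (C * (y * \<bar>s\<bar>)) * cauchy_density 1 s" for s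
      proof -
        have "\<bar>f x * cauchy_density 1 s - f (x + y * s) * cauchy_density 1 s\<bar> = \<bar>f x - f (x + y * s)\<bar> * cauchy_density 1 s"
          using cauchy_density_nonneg[of 1 s] by (simp add: abs_mult flip: left_diff_distrib)
        also have "\<dots> \<le> min 1 (C * (y * \<bar>s\<bar>)) * cauchy_density 1 s"
          using lip[of x "x + y * s"] y cauchy_density_nonneg[of 1 s] by (intro mult_right_mono) (simp_all add: abs_mult)
        finally show ?thesis .
      qed
    qed (rule i2)
    finally show ?thesis .
  qed
  have fi: "integrable M f" using f(2) by (intro integrable_bounded[OF fm]) auto
  have gb: "\<bar>?g x\<bar> \<le> 1" for x
  proof -
    have "\<bar>?g x\<bar> \<le> (\<integral>s. cauchy_density 1 s \<partial>lborel)"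
      using cauchy_density_1(1) i1 f(2) cauchy_density_nonneg[of 1]
      by (intro integral_abs_bound_integral) (auto simp: abs_mult mult_left_le_one_le)
    then show ?thesis using cauchy_density_1(2) by simp
  qed
  have gm: "?g \<in> borel_measurable borel" by measurable
  have gi: "integrable M ?g" using gb by (intro integrable_bounded[OF gm]) auto
  have "(\<integral>x. f x \<partial>M) - (\<integral>x. ?g x \<partial>M) = (\<integral>x. f x - ?g x \<partial>M)"
    using fi gi by simp
  also have "\<bar>\<dots>\<bar> \<le> (\<integral>x. ?e \<partial>M)"
    by (rule integral_abs_bound_integral) (use fi gi d in auto)
  also have "\<dots> = ?e" using prob_space by simp
  finally show ?thesis using cauchy_smoothing_Fubini(1)[OF M y f] by simp
qed

lemma cauchy_smoothing_error_tendsto: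
  fixes C :: real
  assumes C: "C \<ge> 0"
  shows "(\<lambda>k. \<integral>s. min 1 (C * (1 / real (k + 2) * \<bar>s\<bar>)) * cauchy_density 1 s \<partial>lborel) \<longlonglongrightarrow> 0"
proof -
  have "(\<lambda>k. \<integral>s. min 1 (C * (1 / real (k + 2) * \<bar>s\<bar>)) * cauchy_density 1 s \<partial>lborel) \<longlonglongrightarrow> integral\<^sup>L lborel (\<lambda>s::real. 0)"
  proof (rule integral_dominated_convergence[where w = "cauchy_density 1"])
    show "AE s in lborel. (\<lambda>k. min 1 (C * (1 / real (k + 2) * \<bar>s\<bar>)) * cauchy_density 1 s) \<longlonglongrightarrow> 0"
    proof (rule AE_I2)
      fix s :: real
      have "(\<lambda>k. 1 / real (k + 2)) \<longlonglongrightarrow> 0"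
        using LIMSEQ_ignore_initial_segment[OF lim_1_over_n[where ?'a = real], of 2] by simp
      then have "(\<lambda>k. min 1 (C * (1 / real (k + 2) * \<bar>s\<bar>)) * cauchy_density 1 s) \<longlonglongrightarrow> min 1 (C * (0 * \<bar>s\<bar>)) * cauchy_density 1 s"
        by (intro tendsto_intros)
      then show "(\<lambda>k. min 1 (C * (1 / real (k + 2) * \<bar>s\<bar>)) * cauchy_density 1 s) \<longlonglongrightarrow> 0" by simp
    qed
    show "AE s in lborel. norm (min 1 (C * (1 / real (k + 2) * \<bar>s\<bar>)) * cauchy_density 1 s) \<le> cauchy_density 1 s" for k
      using cauchy_density_nonneg[of 1] C by (auto simp: abs_mult intro!: mult_left_le_one_le)
  qed (use cauchy_density_1(1) in measurable)
  then show ?thesis by simp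
qed

lemma cts_step_lipschitz:
  assumes "a < b"
  shows "\<bar>cts_step a b x - cts_step a b x'\<bar> \<le> min 1 (1 / (b - a) * \<bar>x - x'\<bar>)"
proof -
  define u where "u = (\<lambda>x. (b - x) / (b - a))"
  have c: "cts_step a b x = max 0 (min 1 (u x))" for x
    using assms by (auto simp: cts_step_def u_def divide_simps)
  have "u x - u x' = - (1 / (b - a) * (x - x'))" using assms by (simp add: u_def divide_simps)
  then have "\<bar>u x - u x'\<bar> = 1 / (b - a) * \<bar>x - x'\<bar>" using assms by (simp add: abs_mult)
  moreover have "\<bar>max 0 (min 1 (u x)) - max 0 (min 1 (u x'))\<bar> \<le> min 1 \<bar>u x - u x'\<bar>" by linarith
  ultimately show ?thesis by (simp only: c)
qed

lemma cts_step_bounded: "a < b \<Longrightarrow> \<bar>cts_step a b x\<bar> \<le> 1"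
  by (auto simp: cts_step_def divide_simps)

lemma measurable_cts_step: "a < b \<Longrightarrow> cts_step a b \<in> borel_measurable borel"
  by (intro borel_measurable_continuous_onI uniformly_continuous_imp_continuous cts_step_uniformly_continuous)

text \<open>The smoothed measures have densities that converge pointwise and have integral \<open>1\<close>; by Scheffe's lemma they
  converge in \<open>L\<^sup>1\<close>.\<close>

lemma cauchy_smoothing_tendsto:
  fixes f :: "real \<Rightarrow> real"
  assumes Pn: "\<And>n. real_distribution (Pn n)" and P: "real_distribution P"
    and conv: "\<And>u. (\<lambda>n. Cauchy_transform (Pn n) (Complex u y)) \<longlonglongrightarrow> Cauchy_transform P (Complex u y)"
    and y: "y > 0" and f: "f \<in> borel_measurable borel" "\<And>x. \<bar>f x\<bar> \<le> 1"
  shows "(\<lambda>n. \<integral>u. f u * (\<integral>x. cauchy_density y (u - x) \<partial>Pn n) \<partial>lborel)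
     \<longlonglongrightarrow> (\<integral>u. f u * (\<integral>x. cauchy_density y (u - x) \<partial>P) \<partial>lborel)"
proof -
  let ?p = "\<lambda>M u. \<integral>x. cauchy_density y (u - x) \<partial>M"
  have pos: "?p M u \<ge> 0" for M u by (rule Bochner_Integration.integral_nonneg) (rule cauchy_density_nonneg[OF y])
  have int: "integrable lborel (?p M)" "(\<integral>u. ?p M u \<partial>lborel) = 1" if "real_distribution M" for M
  proof -
    interpret real_distribution M by fact
    show "integrable lborel (?p M)" using cauchy_smoothing_Fubini(2)[OF that y, of "\<lambda>_. 1"] by simp
    show "(\<integral>u. ?p M u \<partial>lborel) = 1"
      using cauchy_smoothing_Fubini(1)[OF that y, of "\<lambda>_. 1"] cauchy_density_1(2) prob_space by simp
  qed
  have nn: "(\<integral>\<^sup>+u. norm (?p M u) \<partial>lborel) = 1" if "real_distribution M" for M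
    using nn_integral_eq_integral[OF int(1)[OF that]] int(2)[OF that] pos by simp
  have "(\<lambda>n. \<integral>\<^sup>+ u. norm (?p (Pn n) u - ?p P u) \<partial>lborel) \<longlonglongrightarrow> 0"
  proof (rule Scheffe_lemma2)
    have fb: "finite_borel_measure M" if "real_distribution M" for M
      using that real_distribution.finite_borel_measure_M by blast
    show "AE u in lborel. (\<lambda>n. ?p (Pn n) u) \<longlonglongrightarrow> ?p P u"
    proof (rule AE_I2)
      fix u
      have "(\<lambda>n. - Im (Cauchy_transform (Pn n) (Complex u y)) / pi) \<longlonglongrightarrow> - Im (Cauchy_transform P (Complex u y)) / pi"
        by (intro tendsto_intros conv) simp
      then show "(\<lambda>n. ?p (Pn n) u) \<longlonglongrightarrow> ?p P u"
        by (simp only: cauchy_smoothing_density[OF fb[OF Pn] y] cauchy_smoothing_density[OF fb[OF P] y])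
    qed
    show "?p (Pn n) \<in> borel_measurable lborel" for n
      using int(1)[OF Pn] by (rule borel_measurable_integrable)
    show "integrable lborel (?p P)" by (rule int(1)[OF P])
    show "(\<integral>\<^sup>+u. norm (?p (Pn n) u) \<partial>lborel) \<le> (\<integral>\<^sup>+u. norm (?p P u) \<partial>lborel)" for n
      by (simp only: nn[OF Pn] nn[OF P] order_refl)
  qed
  note L1 = this
  have contract: "norm (f u * a - f u * b) \<le> norm (a - b)" for u a b
    using mult_left_le_one_le[of "\<bar>a - b\<bar>" "\<bar>f u\<bar>"] f(2)[of u] by (simp add: abs_mult flip: right_diff_distrib)
  have le: "ennreal \<bar>(\<integral>u. f u * ?p (Pn n) u \<partial>lborel) - (\<integral>u. f u * ?p P u \<partial>lborel)\<bar>
      \<le> (\<integral>\<^sup>+ u. norm (?p (Pn n) u - ?p P u) \<partial>lborel)" for n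
  proof -
    have i: "integrable lborel (\<lambda>u. f u * ?p (Pn n) u)" "integrable lborel (\<lambda>u. f u * ?p P u)"
      using cauchy_smoothing_Fubini(2)[OF Pn y f] cauchy_smoothing_Fubini(2)[OF P y f] by auto
    then have "ennreal \<bar>(\<integral>u. f u * ?p (Pn n) u \<partial>lborel) - (\<integral>u. f u * ?p P u \<partial>lborel)\<bar> =
        ennreal (norm (\<integral>u. f u * ?p (Pn n) u - f u * ?p P u \<partial>lborel))"
      by simp
    also have "\<dots> \<le> (\<integral>\<^sup>+ u. norm (f u * ?p (Pn n) u - f u * ?p P u) \<partial>lborel)"
      using i by (intro integral_norm_bound_ennreal) auto
    also have "\<dots> \<le> (\<integral>\<^sup>+ u. norm (?p (Pn n) u - ?p P u) \<partial>lborel)"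
      by (intro nn_integral_mono ennreal_leI contract)
    finally show ?thesis .
  qed
  have "(\<lambda>n. ennreal \<bar>(\<integral>u. f u * ?p (Pn n) u \<partial>lborel) - (\<integral>u. f u * ?p P u \<partial>lborel)\<bar>) \<longlonglongrightarrow> 0"
    by (rule tendsto_sandwich[OF _ _ tendsto_const L1]) (rule always_eventually, simp add: le del: real_norm_def)+
  then have "(\<lambda>n. \<bar>(\<integral>u. f u * ?p (Pn n) u \<partial>lborel) - (\<integral>u. f u * ?p P u \<partial>lborel)\<bar>) \<longlonglongrightarrow> 0"
    by (simp add: tendsto_ennreal_iff flip: ennreal_0)
  then show ?thesis by (simp add: LIM_zero_iff tendsto_rabs_zero_iff)
qed

text \<open>The functions \<open>cts_step\<close> are Lipschitz and determine weak convergence.  For a fixed small height both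
  smoothing errors are small uniformly in the measure, and the smoothed integrals converge.  Only heights below
  \<open>1\<close> are used, so nothing has to be known about the Cauchy transforms at \<open>\<i>\<close>, where the factor \<open>1 + z\<^sup>2\<close> relating
  them to the integral equation vanishes.\<close>

lemma weak_conv_m_from_Cauchy_transform:
  assumes Pn: "\<And>n. real_distribution (Pn n)" and P: "real_distribution P"
    and conv: "\<And>z. 0 < Im z \<Longrightarrow> Im z < 1 \<Longrightarrow> (\<lambda>n. Cauchy_transform (Pn n) z) \<longlonglongrightarrow> Cauchy_transform P z"
  shows "weak_conv_m Pn P"
proof (rule integral_cts_step_conv_imp_weak_conv[OF Pn P])
  fix a b :: real assume ab: "a < b"
  let ?f = "cts_step a b"
  let ?C = "1 / (b - a)"
  let ?p = "\<lambda>y M u. \<integral>x. cauchy_density y (u - x) \<partial>M"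
  let ?e = "\<lambda>k. \<integral>s. min 1 (?C * (1 / real (k + 2) * \<bar>s\<bar>)) * cauchy_density 1 s \<partial>lborel"
  note f = measurable_cts_step[OF ab] cts_step_bounded[OF ab] cts_step_lipschitz[OF ab]
  show "(\<lambda>n. integral\<^sup>L (Pn n) ?f) \<longlonglongrightarrow> integral\<^sup>L P ?f"
  proof (rule LIMSEQ_I)
    fix r :: real assume r: "r > 0"
    have "?e \<longlonglongrightarrow> 0" using ab by (intro cauchy_smoothing_error_tendsto) simp
    from LIMSEQ_D[OF this, of "r / 3"] r obtain k where "norm (?e k - 0) < r / 3" by (meson divide_pos_pos order_refl zero_less_numeral)
    then have k: "?e k < r / 3" by (simp only: real_norm_def diff_0_right abs_less_iff)
    define y where "y = 1 / real (k + 2)"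
    have y: "0 < y" "y < 1" unfolding y_def by (auto simp: divide_simps)
    have err: "\<bar>(\<integral>x. ?f x \<partial>M) - (\<integral>u. ?f u * ?p y M u \<partial>lborel)\<bar> < r / 3" if "real_distribution M" for M
      using cauchy_smoothing_error[OF that y(1) f] k unfolding y_def by linarith
    have "(\<lambda>n. \<integral>u. ?f u * ?p y (Pn n) u \<partial>lborel) \<longlonglongrightarrow> (\<integral>u. ?f u * ?p y P u \<partial>lborel)"
      using conv y by (intro cauchy_smoothing_tendsto[OF Pn P _ y(1) f(1,2)]) auto
    from LIMSEQ_D[OF this, of "r / 3"] r obtain N where N: "\<And>n. n \<ge> N \<Longrightarrow>
        norm ((\<integral>u. ?f u * ?p y (Pn n) u \<partial>lborel) - (\<integral>u. ?f u * ?p y P u \<partial>lborel)) < r / 3"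
      by (meson divide_pos_pos zero_less_numeral)
    show "\<exists>N. \<forall>n\<ge>N. norm (integral\<^sup>L (Pn n) ?f - integral\<^sup>L P ?f) < r"
    proof (intro exI allI impI)
      fix n assume "n \<ge> N"
      from N[OF this] err[OF Pn[of n]] err[OF P]
      show "norm (integral\<^sup>L (Pn n) ?f - integral\<^sup>L P ?f) < r" unfolding real_norm_def by linarith
    qed
  qed
qed

lemma weak_conv_finite_from_Cauchy_transform:
  assumes fin: "\<And>n. finite_borel_measure (\<mu>n n)" "finite_borel_measure \<mu>"
    and mass: "(\<lambda>n. measure (\<mu>n n) UNIV) \<longlonglongrightarrow> measure \<mu> UNIV"
    and conv: "\<And>z. 0 < Im z \<Longrightarrow> Im z < 1 \<Longrightarrow> (\<lambda>n. Cauchy_transform (\<mu>n n) z) \<longlonglongrightarrow> Cauchy_transform \<mu> z"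
  shows "weak_conv_finite \<mu>n \<mu>"
proof (rule weak_conv_finite_from_test_family[where J = "{z. 0 < Im z \<and> Im z < 1}" and
      \<phi> = "\<lambda>z x. 1 / (z - complex_of_real x)"])
  show "weak_conv_m Pn P" if "\<And>n. real_distribution (Pn n)" "real_distribution P"
      "\<And>z. z \<in> {z. 0 < Im z \<and> Im z < 1} \<Longrightarrow> (\<lambda>n. CLINT x|Pn n. 1 / (z - complex_of_real x)) \<longlonglongrightarrow> (CLINT x|P. 1 / (z - complex_of_real x))" for Pn P
    by (rule weak_conv_m_from_Cauchy_transform[OF that(1,2)]) (use that(3) in \<open>simp add: Cauchy_transform_def\<close>)
qed (use fin mass conv in \<open>auto simp: Cauchy_transform_def\<close>)

text \<open>Cauchy transforms vanish nowhere on the upper half-plane, so it does not matter whether \<open>G\<close> or \<open>F = 1 / G\<close> converges.\<close>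

lemma weak_conv_loc_unif_iff_F_transform:
  fixes S :: "'a::heine_borel set"
  assumes \<mu>: "\<And>\<tau>. \<tau> \<in> S \<Longrightarrow> real_distribution (\<mu> \<tau>)" "\<And>n \<tau>. \<tau> \<in> S \<Longrightarrow> real_distribution (\<mu>n n \<tau>)"
    and h: "\<And>\<tau> z. \<tau> \<in> S \<Longrightarrow> z \<in> \<complex>\<^sup>+ \<Longrightarrow> F_transform (\<mu> \<tau>) z = h \<tau> z"
      "\<And>n \<tau> z. \<tau> \<in> S \<Longrightarrow> z \<in> \<complex>\<^sup>+ \<Longrightarrow> F_transform (\<mu>n n \<tau>) z = hn n \<tau> z"
    and wc: "weakly_continuous_on S \<mu>" and hc: "continuous_on (\<complex>\<^sup>+ \<times> S) (\<lambda>(z, \<tau>). h \<tau> z)"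
  shows "weak_conv_loc_unif S \<mu>n \<mu> \<longleftrightarrow> loc_unif_conv (\<complex>\<^sup>+ \<times> S) (\<lambda>n (z, \<tau>). hn n \<tau> z) (\<lambda>(z, \<tau>). h \<tau> z)"
  unfolding weak_conv_loc_unif_iff_sequential[OF wc] loc_unif_conv_iff_cont_conv[OF hc]
proof (intro iffI allI impI)
  have fb: "finite_borel_measure M" if "real_distribution M" for M
    using that real_distribution.finite_borel_measure_M by blast
  assume W: "\<forall>r \<tau> l. strict_mono r \<longrightarrow> range \<tau> \<subseteq> S \<longrightarrow> l \<in> S \<longrightarrow> \<tau> \<longlonglongrightarrow> l \<longrightarrow> weak_conv_finite (\<lambda>k. \<mu>n (r k) (\<tau> k)) (\<mu> l)"
  show "cont_conv (\<complex>\<^sup>+ \<times> S) (\<lambda>n (z, \<tau>). hn n \<tau> z) (\<lambda>(z, \<tau>). h \<tau> z)"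
  proof (rule cont_convI)
    fix r :: "nat \<Rightarrow> nat" and p :: "nat \<Rightarrow> complex \<times> 'a" and l
    assume r: "strict_mono r" and p: "\<And>k. p k \<in> \<complex>\<^sup>+ \<times> S" "l \<in> \<complex>\<^sup>+ \<times> S" "p \<longlonglongrightarrow> l"
    have m: "fst (p k) \<in> \<complex>\<^sup>+" "snd (p k) \<in> S" "fst l \<in> \<complex>\<^sup>+" "snd l \<in> S" for k
      using p(1)[of k] p(2) by (auto simp: mem_Times_iff)
    have lim: "(\<lambda>k. fst (p k)) \<longlonglongrightarrow> fst l" "(\<lambda>k. snd (p k)) \<longlonglongrightarrow> snd l"
      by (intro tendsto_fst tendsto_snd p(3))+
    have "weak_conv_finite (\<lambda>k. \<mu>n (r k) (snd (p k))) (\<mu> (snd l))"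
      using W[rule_format, of r "\<lambda>k. snd (p k)" "snd l"] r m lim(2) by auto
    then have "(\<lambda>k. Cauchy_transform (\<mu>n (r k) (snd (p k))) (fst (p k))) \<longlonglongrightarrow> Cauchy_transform (\<mu> (snd l)) (fst l)"
      by (rule Cauchy_transform_tendsto[OF _ fb[OF \<mu>(2)[OF m(2)]] fb[OF \<mu>(1)[OF m(4)]] lim(1)]) (use m in \<open>simp_all add: UHP_iff\<close>)
    moreover have "Cauchy_transform (\<mu> (snd l)) (fst l) \<noteq> 0"
      using F_transform_Im_ge(1)[OF \<mu>(1)[OF m(4)]] m(3) by (simp add: UHP_iff)
    ultimately have "(\<lambda>k. F_transform (\<mu>n (r k) (snd (p k))) (fst (p k))) \<longlonglongrightarrow> F_transform (\<mu> (snd l)) (fst l)"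
      unfolding F_transform_def by (intro tendsto_intros)
    then show "(\<lambda>k. case p k of (z, \<tau>) \<Rightarrow> hn (r k) \<tau> z) \<longlonglongrightarrow> (case l of (z, \<tau>) \<Rightarrow> h \<tau> z)"
      by (simp add: h(1)[OF m(4,3)] h(2)[OF m(2,1)] split_def)
  qed
next
  have fb: "finite_borel_measure M" if "real_distribution M" for M
    using that real_distribution.finite_borel_measure_M by blast
  fix r \<tau> l
  assume C: "cont_conv (\<complex>\<^sup>+ \<times> S) (\<lambda>n (z, \<tau>). hn n \<tau> z) (\<lambda>(z, \<tau>). h \<tau> z)"
    and r: "strict_mono (r :: nat \<Rightarrow> nat)" and \<tau>: "range \<tau> \<subseteq> S" "l \<in> S" "\<tau> \<longlonglongrightarrow> l"
  have m: "\<tau> k \<in> S" for k using \<tau>(1) by auto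
  show "weak_conv_finite (\<lambda>k. \<mu>n (r k) (\<tau> k)) (\<mu> l)"
  proof (rule weak_conv_m_imp_weak_conv_finite[OF \<mu>(2)[OF m] \<mu>(1)[OF \<tau>(2)]],
         rule weak_conv_m_from_Cauchy_transform[OF \<mu>(2)[OF m] \<mu>(1)[OF \<tau>(2)]])
    fix z :: complex assume z: "0 < Im z"
    then have zU: "z \<in> \<complex>\<^sup>+" by (simp add: UHP_iff)
    have "(\<lambda>k. (z, \<tau> k)) \<longlonglongrightarrow> (z, l)" by (intro tendsto_intros \<tau>(3))
    from cont_convD[OF C r _ _ this] have "(\<lambda>k. hn (r k) (\<tau> k) z) \<longlonglongrightarrow> h l z"
      using m \<tau>(2) zU by simp
    then have "(\<lambda>k. F_transform (\<mu>n (r k) (\<tau> k)) z) \<longlonglongrightarrow> F_transform (\<mu> l) z"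
      by (simp add: h(1)[OF \<tau>(2) zU] h(2)[OF m zU])
    then have "(\<lambda>k. 1 / F_transform (\<mu>n (r k) (\<tau> k)) z) \<longlonglongrightarrow> 1 / F_transform (\<mu> l) z"
      using F_transform_Im_ge(1)[OF \<mu>(1)[OF \<tau>(2)] z] by (intro tendsto_intros) (auto simp: F_transform_def)
    then show "(\<lambda>k. Cauchy_transform (\<mu>n (r k) (\<tau> k)) z) \<longlonglongrightarrow> Cauchy_transform (\<mu> l) z"
      by (simp add: F_transform_def)
  qed
qed

section \<open>Levy--Khintchine exponents\<close>

lemma one_plus_square_nonzero: "1 + (x::real)\<^sup>2 \<noteq> 0"
  by (smt (verit) zero_le_power2)

text \<open>Form of the integrand in which the singularity at \<open>x = 0\<close> is cancelled by Taylor's formula.\<close>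

lemma LK_integrand_near:
  assumes "x \<noteq> 0"
  shows "LK_integrand \<xi> x = (iexp (\<xi> * x) - 1 - \<i> * complex_of_real (\<xi> * x)) * complex_of_real ((1 + x\<^sup>2) / x\<^sup>2)
     + \<i> * complex_of_real (\<xi> * x)"
proof -
  have "\<xi> * x / (1 + x\<^sup>2) * ((1 + x\<^sup>2) / x\<^sup>2) = \<xi> * x * ((1 + x\<^sup>2) / x\<^sup>2) - \<xi> * x"
    using assms one_plus_square_nonzero[of x] by (simp add: divide_simps) (simp add: algebra_simps power2_eq_square)
  then have a: "complex_of_real (\<xi> * x / (1 + x\<^sup>2)) * complex_of_real ((1 + x\<^sup>2) / x\<^sup>2)
      = complex_of_real (\<xi> * x) * complex_of_real ((1 + x\<^sup>2) / x\<^sup>2) - complex_of_real (\<xi> * x)"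
    by (simp only: of_real_mult[symmetric] of_real_diff[symmetric])
  have "(E - 1 - \<i> * a) * q = (E - 1 - \<i> * u) * q + \<i> * u" if "a * q = u * q - u" for E a q u
  proof -
    have "(E - 1 - \<i> * a) * q = (E - 1) * q - \<i> * (a * q)" by (simp add: algebra_simps)
    then show ?thesis unfolding that by (simp add: algebra_simps)
  qed
  from this[OF a] show ?thesis using assms by (simp add: LK_integrand_def)
qed

text \<open>Form of the integrand in which boundedness for large \<open>x\<close> is visible.\<close>

lemma LK_integrand_far:
  assumes "x \<noteq> 0"
  shows "LK_integrand \<xi> x = (iexp (\<xi> * x) - 1) * complex_of_real ((1 + x\<^sup>2) / x\<^sup>2) - \<i> * complex_of_real (\<xi> / x)"
proof -
  have "\<xi> * x / (1 + x\<^sup>2) * ((1 + x\<^sup>2) / x\<^sup>2) = \<xi> / x"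
    using assms one_plus_square_nonzero[of x] by (simp add: divide_simps power2_eq_square)
  then have a: "complex_of_real (\<xi> * x / (1 + x\<^sup>2)) * complex_of_real ((1 + x\<^sup>2) / x\<^sup>2) = complex_of_real (\<xi> / x)"
    by (simp only: of_real_mult[symmetric])
  have "(E - 1 - \<i> * a) * q = (E - 1) * q - \<i> * b" if "a * q = b" for E a q b
    unfolding that[symmetric] by (simp add: algebra_simps)
  from this[OF a] show ?thesis using assms by (simp add: LK_integrand_def)
qed

lemma norm_iexp_2: "cmod (iexp u - 1 - \<i> * complex_of_real u) \<le> u\<^sup>2 / 2"
  using iexp_approx1[of u 1] by (simp add: diff_diff_eq numeral_2_eq_2)

lemma norm_iexp_3: "cmod (iexp u - 1 - \<i> * complex_of_real u + complex_of_real (u\<^sup>2 / 2)) \<le> \<bar>u\<bar> ^ 3 / 6"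
proof -
  have "(\<Sum>k\<le>2. (\<i> * complex_of_real u) ^ k / fact k) = 1 + \<i> * complex_of_real u - complex_of_real (u\<^sup>2 / 2)"
    by (simp add: numeral_2_eq_2 power_mult_distrib)
  then show ?thesis using iexp_approx1[of u 2] by (simp add: eval_nat_numeral algebra_simps)
qed

lemma cos_approx_4: "\<bar>1 - cos u - u\<^sup>2 / 2\<bar> \<le> (u::real) ^ 4 / 24"
proof -
  have p: "(\<i> * complex_of_real u) ^ 2 = - complex_of_real (u\<^sup>2)" "(\<i> * complex_of_real u) ^ 3 = - (\<i> * complex_of_real (u ^ 3))"
    by (simp_all add: power_mult_distrib power3_eq_cube[of \<i>])
  have "(\<Sum>k\<le>3. (\<i> * complex_of_real u) ^ k / fact k) = 1 + \<i> * complex_of_real u + (\<i> * complex_of_real u) ^ 2 / 2 + (\<i> * complex_of_real u) ^ 3 / 6"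
    by (simp add: numeral_3_eq_3 numeral_2_eq_2 fact_numeral)
  also have "\<dots> = 1 + \<i> * complex_of_real u - complex_of_real (u\<^sup>2 / 2) - \<i> * complex_of_real (u ^ 3 / 6)"
    unfolding p by simp
  finally have S: "(\<Sum>k\<le>3. (\<i> * complex_of_real u) ^ k / fact k) = 1 + \<i> * complex_of_real u - complex_of_real (u\<^sup>2 / 2) - \<i> * complex_of_real (u ^ 3 / 6)" .
  have "cmod (iexp u - (1 + \<i> * complex_of_real u - complex_of_real (u\<^sup>2 / 2) - \<i> * complex_of_real (u ^ 3 / 6))) \<le> \<bar>u\<bar> ^ Suc 3 / fact (Suc 3)"
    using iexp_approx1[of u 3] unfolding S .
  also have "\<bar>u\<bar> ^ Suc 3 / fact (Suc 3) = u ^ 4 / 24"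
    by (simp add: eval_nat_numeral fact_numeral)
  finally have "cmod (iexp u - (1 + \<i> * complex_of_real u - complex_of_real (u\<^sup>2 / 2) - \<i> * complex_of_real (u ^ 3 / 6))) \<le> u ^ 4 / 24" .
  moreover have "Re (iexp u - (1 + \<i> * complex_of_real u - complex_of_real (u\<^sup>2 / 2) - \<i> * complex_of_real (u ^ 3 / 6))) = cos u - 1 + u\<^sup>2 / 2"
    by (simp only: minus_complex.simps plus_complex.simps Re_complex_of_real Re_exp Im_complex_of_real Re_i_times Im_i_times one_complex.simps) simp
  ultimately show ?thesis using abs_Re_le_cmod[of "iexp u - (1 + \<i> * complex_of_real u - complex_of_real (u\<^sup>2 / 2) - \<i> * complex_of_real (u ^ 3 / 6))"] by linarith
qed

lemma norm_LK_integrand: "norm (LK_integrand \<xi> x) \<le> 4 + \<bar>\<xi>\<bar> + \<xi>\<^sup>2"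
proof -
  consider "x = 0" | "x \<noteq> 0" "\<bar>x\<bar> \<le> 1" | "1 < \<bar>x\<bar>" by linarith
  then show ?thesis
  proof cases
    case 1
    then show ?thesis by (simp add: LK_integrand_def norm_divide norm_power)
  next
    case 2
    then have x2: "x\<^sup>2 \<le> 1" "x\<^sup>2 > 0" by (auto simp: abs_square_le_1)
    have "norm (LK_integrand \<xi> x) \<le> cmod (iexp (\<xi> * x) - 1 - \<i> * complex_of_real (\<xi> * x)) * ((1 + x\<^sup>2) / x\<^sup>2) + \<bar>\<xi> * x\<bar>"
      unfolding LK_integrand_near[OF 2(1)]
      by (rule norm_triangle_le) (simp add: norm_mult abs_of_nonneg del: of_real_mult of_real_divide)
    also have "\<dots> \<le> (\<xi> * x)\<^sup>2 / 2 * ((1 + x\<^sup>2) / x\<^sup>2) + \<bar>\<xi> * x\<bar>"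
      using norm_iexp_2[of "\<xi> * x"] x2 by (intro add_mono mult_right_mono) auto
    also have "(\<xi> * x)\<^sup>2 / 2 * ((1 + x\<^sup>2) / x\<^sup>2) = \<xi>\<^sup>2 * ((1 + x\<^sup>2) / 2)"
      using x2 by (simp add: power_mult_distrib)
    also have "\<xi>\<^sup>2 * ((1 + x\<^sup>2) / 2) \<le> \<xi>\<^sup>2 * 1" using x2 by (intro mult_left_mono) auto
    finally show ?thesis using 2 mult_left_le[of "\<bar>x\<bar>" "\<bar>\<xi>\<bar>"] by (simp add: abs_mult)
  next
    case 3
    then have x: "x \<noteq> 0" "x\<^sup>2 > 1"
      using one_less_power[OF 3, of 2] by auto
    have "norm (LK_integrand \<xi> x) \<le> cmod (iexp (\<xi> * x) - 1) * ((1 + x\<^sup>2) / x\<^sup>2) + \<bar>\<xi> / x\<bar>"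
      unfolding LK_integrand_far[OF x(1)]
      by (rule norm_triangle_le_diff) (simp add: norm_mult abs_of_nonneg del: of_real_mult of_real_divide)
    also have "\<dots> \<le> 2 * 2 + \<bar>\<xi>\<bar>"
    proof (intro add_mono mult_mono)
      show "cmod (iexp (\<xi> * x) - 1) \<le> 2"
        using norm_triangle_ineq4[of "iexp (\<xi> * x)" 1] by simp
      show "(1 + x\<^sup>2) / x\<^sup>2 \<le> 2" using x by (simp add: divide_simps)
      show "\<bar>\<xi> / x\<bar> \<le> \<bar>\<xi>\<bar>" using 3 by (simp add: divide_simps mult_le_cancel_left1)
    qed auto
    finally show ?thesis by (simp add: add_increasing2)
  qed
qed

lemma LK_integrand_0 [simp]: "LK_integrand 0 x = 0"
  by (simp add: LK_integrand_def)

lemma isCont_LK_integrand_param: "isCont (\<lambda>\<xi>. LK_integrand \<xi> x) \<xi>"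
proof (cases "x = 0")
  case True
  then show ?thesis by (simp add: LK_integrand_def)
next
  case False
  then show ?thesis unfolding LK_integrand_far[OF False] by (intro continuous_intros)
qed

text \<open>Away from \<open>0\<close> the integrand is a continuous expression.  At \<open>0\<close> the Taylor expansion of order two bounds the
  distance to \<open>- \<xi>\<^sup>2 / 2\<close>.\<close>

lemma isCont_LK_integrand: "isCont (LK_integrand \<xi>) x"
proof (cases "x = 0")
  case False
  let ?f = "\<lambda>x. (iexp (\<xi> * x) - 1) * complex_of_real ((1 + x\<^sup>2) / x\<^sup>2) - \<i> * complex_of_real (\<xi> / x)"
  have "isCont ?f x" using False by (intro continuous_intros) auto
  moreover have "\<forall>\<^sub>F y in nhds x. y \<noteq> 0"
    using False by (intro t1_space_nhds) auto
  then have "\<forall>\<^sub>F y in nhds x. LK_integrand \<xi> y = ?f y"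
    by eventually_elim (rule LK_integrand_far)
  ultimately show ?thesis by (subst isCont_cong) auto
next
  case True
  let ?b = "\<lambda>x. \<bar>\<xi>\<bar> ^ 3 * \<bar>x\<bar> / 6 * (1 + x\<^sup>2) + \<xi>\<^sup>2 / 2 * x\<^sup>2 + \<bar>\<xi> * x\<bar>"
  have b: "norm (LK_integrand \<xi> x - (- (complex_of_real \<xi>)\<^sup>2 / 2)) \<le> ?b x" if "x \<noteq> 0" for x
  proof -
    define u where "u = \<xi> * x"
    define q where "q = (1 + x\<^sup>2) / x\<^sup>2"
    have q: "q \<ge> 0" "u\<^sup>2 * q = \<xi>\<^sup>2 * (1 + x\<^sup>2)" "\<bar>u\<bar>^3 * q = \<bar>\<xi>\<bar>^3 * \<bar>x\<bar> * (1 + x\<^sup>2)"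
      using that by (auto simp: q_def u_def power_mult_distrib abs_mult power2_eq_square power3_eq_cube field_simps)
    define A where "A = iexp u - 1 - \<i> * complex_of_real u + complex_of_real (u\<^sup>2 / 2)"
    have "u\<^sup>2 / 2 * q = \<xi>\<^sup>2 / 2 * x\<^sup>2 + \<xi>\<^sup>2 / 2" using q(2) by (simp add: algebra_simps)
    then have B: "complex_of_real (u\<^sup>2 / 2) * complex_of_real q = complex_of_real (\<xi>\<^sup>2 / 2 * x\<^sup>2) + complex_of_real (\<xi>\<^sup>2 / 2)"
      by (simp only: of_real_mult[symmetric] of_real_add[symmetric])
    have e: "(E - U) * Q + V - - Z = (E - U + S) * Q - T + V" if "S * Q = T + Z" for E U V Q S T Z :: complex
      using that by (simp add: algebra_simps)
    have "LK_integrand \<xi> x - (- (complex_of_real \<xi>)\<^sup>2 / 2) = A * complex_of_real q - complex_of_real (\<xi>\<^sup>2 / 2 * x\<^sup>2) + \<i> * complex_of_real u"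
      unfolding LK_integrand_near[OF that] u_def[symmetric] q_def[symmetric] A_def
      using e[OF B, of "iexp u - 1" "\<i> * complex_of_real u" "\<i> * complex_of_real u"] by simp
    also have "norm \<dots> \<le> norm A * q + \<xi>\<^sup>2 / 2 * x\<^sup>2 + \<bar>u\<bar>"
    proof -
      have "norm (A * complex_of_real q - complex_of_real (\<xi>\<^sup>2 / 2 * x\<^sup>2) + \<i> * complex_of_real u)
          \<le> norm (A * complex_of_real q) + norm (complex_of_real (\<xi>\<^sup>2 / 2 * x\<^sup>2)) + norm (\<i> * complex_of_real u)"
        by (rule order_trans[OF norm_triangle_ineq]) (intro add_mono norm_triangle_ineq4 order_refl)
      then show ?thesis using q(1) by (simp add: norm_mult abs_of_nonneg del: of_real_mult of_real_divide)
    qed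
    also have "\<dots> \<le> \<bar>u\<bar> ^ 3 / 6 * q + \<xi>\<^sup>2 / 2 * x\<^sup>2 + \<bar>u\<bar>"
      using norm_iexp_3[of u] q(1) unfolding A_def by (intro add_mono mult_right_mono) auto
    also have "\<bar>u\<bar> ^ 3 / 6 * q = \<bar>\<xi>\<bar> ^ 3 * \<bar>x\<bar> / 6 * (1 + x\<^sup>2)" using q(3) by simp
    finally show ?thesis by (simp add: u_def)
  qed
  have "(?b \<longlongrightarrow> ?b 0) (at 0)" by (intro tendsto_intros) simp
  then have "(?b \<longlongrightarrow> 0) (at 0)" by simp
  then have "((\<lambda>x. LK_integrand \<xi> x - (- (complex_of_real \<xi>)\<^sup>2 / 2)) \<longlongrightarrow> 0) (at 0)"
    by (rule Lim_null_comparison[rotated]) (use b in \<open>simp add: eventually_at_filter del: diff_minus_eq_add\<close>)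
  then have "(LK_integrand \<xi> \<longlongrightarrow> - (complex_of_real \<xi>)\<^sup>2 / 2) (at 0)"
    by (rule LIM_zero_cancel)
  then show ?thesis
    unfolding True isCont_def by (simp add: LK_integrand_def[of \<xi> 0])
qed

lemma continuous_LK_integrand: "continuous_on UNIV (LK_integrand \<xi>)"
  by (simp add: continuous_on_eq_continuous_at isCont_LK_integrand)

lemma bounded_LK_integrand: "bounded (range (LK_integrand \<xi>))"
  using norm_LK_integrand[of \<xi>] by (auto simp: bounded_iff)

lemma measurable_LK_integrand: "LK_integrand \<xi> \<in> borel_measurable borel"
  by (simp add: borel_measurable_continuous_onI continuous_LK_integrand)

lemma integrable_LK_integrand: "finite_borel_measure \<eta> \<Longrightarrow> integrable \<eta> (LK_integrand \<xi>)"
  by (rule finite_borel_measure.integrable_bounded[OF _ measurable_LK_integrand norm_LK_integrand])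

lemma Re_LK_integrand:
  assumes "x \<noteq> 0"
  shows "- Re (LK_integrand h x) = (1 - cos (h * x)) * ((1 + x\<^sup>2) / x\<^sup>2)"
proof -
  have R: "- Re ((E - 1) * complex_of_real q - \<i> * complex_of_real b) = (1 - Re E) * q" for E q b
    by (simp add: algebra_simps)
  show ?thesis unfolding LK_integrand_far[OF assms] R by (simp add: Re_exp)
qed

text \<open>Second differences in \<open>\<xi>\<close> remove the linear compensator and leave an exponential in \<open>x\<close> times a nonnegative
  weight.\<close>

lemma LK_integrand_second_difference:
  "LK_integrand \<xi> x - (LK_integrand (\<xi> + h) x + LK_integrand (\<xi> - h) x) / 2 = iexp (\<xi> * x) * complex_of_real (- Re (LK_integrand h x))"
proof (cases "x = 0")
  case True
  have z: "LK_integrand \<xi> 0 = complex_of_real (- \<xi>\<^sup>2 / 2)" for \<xi> by (simp add: LK_integrand_def)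
  have "- \<xi>\<^sup>2 / 2 - (- (\<xi> + h)\<^sup>2 / 2 + - (\<xi> - h)\<^sup>2 / 2) / 2 = h\<^sup>2 / 2"
    by (simp add: power2_eq_square field_simps)
  from arg_cong[OF this, of complex_of_real] have "complex_of_real (- \<xi>\<^sup>2 / 2) - (complex_of_real (- (\<xi> + h)\<^sup>2 / 2) + complex_of_real (- (\<xi> - h)\<^sup>2 / 2)) / 2 = complex_of_real (h\<^sup>2 / 2)"
    by (simp only: of_real_add of_real_diff of_real_divide of_real_numeral)
  then show ?thesis unfolding True z by simp
next
  case False
  have c: "iexp ((\<xi> + h) * x) + iexp ((\<xi> - h) * x) = 2 * iexp (\<xi> * x) * complex_of_real (cos (h * x))"
  proof -
    have C: "complex_of_real (cos (h * x)) = (iexp (h * x) + iexp (- (h * x))) / 2"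
      by (simp add: cos_of_real[symmetric] cos_exp_eq)
    have e: "iexp ((\<xi> + h) * x) = iexp (\<xi> * x) * iexp (h * x)" "iexp ((\<xi> - h) * x) = iexp (\<xi> * x) * iexp (- (h * x))"
      unfolding exp_add[symmetric] by (simp_all add: algebra_simps)
    have d: "a * b + a * b' = 2 * a * ((b + b') / 2)" for a b b' :: complex by (simp add: distrib_left)
    show ?thesis unfolding e C by (rule d)
  qed
  have r: "((a - 1) * q - \<i> * A) - (((b - 1) * q - \<i> * B) + ((d - 1) * q - \<i> * D)) / 2 = (a - (b + d) / 2) * q"
    if "2 * A = B + D" for a b d q A B D :: complex
  proof -
    have A: "A = (B + D) / 2" using that by (simp add: field_simps)
    show ?thesis unfolding A by (simp add: algebra_simps add_divide_distrib diff_divide_distrib)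
  qed
  have t: "(a - 2 * a * C / 2) * q = a * ((1 - C) * q)" for a C q :: complex
    by (simp add: algebra_simps)
  have s: "2 * complex_of_real (\<xi> / x) = complex_of_real ((\<xi> + h) / x) + complex_of_real ((\<xi> - h) / x)"
    by (simp add: add_divide_distrib diff_divide_distrib)
  have "LK_integrand \<xi> x - (LK_integrand (\<xi> + h) x + LK_integrand (\<xi> - h) x) / 2 =
     (iexp (\<xi> * x) - (iexp ((\<xi> + h) * x) + iexp ((\<xi> - h) * x)) / 2) * complex_of_real ((1 + x\<^sup>2) / x\<^sup>2)"
    unfolding LK_integrand_far[OF False] by (rule r[OF s])
  also have "\<dots> = iexp (\<xi> * x) * complex_of_real ((1 - cos (h * x)) * ((1 + x\<^sup>2) / x\<^sup>2))"
    unfolding c unfolding of_real_mult[of "1 - cos (h * x)"] of_real_diff of_real_1 by (rule t)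
  finally show ?thesis unfolding Re_LK_integrand[OF False] .
qed

definition LK_exponent :: "real \<Rightarrow> real measure \<Rightarrow> real \<Rightarrow> complex" where
  "LK_exponent \<gamma> \<eta> \<xi> = \<i> * complex_of_real (\<gamma> * \<xi>) + (CLINT x|\<eta>. LK_integrand \<xi> x)"

lemma LK_exponent_0 [simp]: "LK_exponent \<gamma> \<eta> 0 = 0"
  by (simp add: LK_exponent_def)

lemma LK_exponent_tendsto:
  assumes "\<gamma>n \<longlonglongrightarrow> \<gamma>" "weak_conv_finite \<eta>n \<eta>"
    and "\<And>n. finite_borel_measure (\<eta>n n)" "finite_borel_measure \<eta>"
  shows "(\<lambda>n. LK_exponent (\<gamma>n n) (\<eta>n n) \<xi>) \<longlonglongrightarrow> LK_exponent \<gamma> \<eta> \<xi>"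
  unfolding LK_exponent_def
  by (intro tendsto_intros assms(1) weak_conv_finite_complex[OF assms(2-4) continuous_LK_integrand bounded_LK_integrand])

lemma isCont_LK_exponent:
  assumes "finite_borel_measure \<eta>"
  shows "isCont (LK_exponent \<gamma> \<eta>) \<xi>"
proof -
  interpret finite_borel_measure \<eta> by fact
  have "isCont (\<lambda>\<xi>. CLINT x|\<eta>. LK_integrand \<xi> x) \<xi>"
    unfolding continuous_at_sequentially
  proof safe
    fix X :: "nat \<Rightarrow> real" assume X: "X \<longlonglongrightarrow> \<xi>"
    then have "Bseq X" by (simp add: convergent_imp_Bseq convergentI)
    then obtain K where K: "\<And>n. \<bar>X n\<bar> \<le> K" by (auto simp: Bseq_def)
    have bd: "norm (LK_integrand (X n) x) \<le> 4 + K + K\<^sup>2" for n x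
      using norm_LK_integrand[of "X n" x] K[of n] power_mono[OF K[of n], of 2] by simp
    show "((\<lambda>\<xi>. CLINT x|\<eta>. LK_integrand \<xi> x) \<circ> X) \<longlonglongrightarrow> (CLINT x|\<eta>. LK_integrand \<xi> x)"
      unfolding comp_def
    proof (rule integral_dominated_convergence[where w = "\<lambda>_. 4 + K + K\<^sup>2"])
      show "AE x in \<eta>. (\<lambda>n. LK_integrand (X n) x) \<longlonglongrightarrow> LK_integrand \<xi> x"
        by (rule AE_I2, rule isCont_tendsto_compose[OF isCont_LK_integrand_param X])
    qed (use bd in \<open>auto intro!: measurable_borel_M measurable_LK_integrand\<close>)
  qed
  then show ?thesis unfolding LK_exponent_def[abs_def] by (intro continuous_intros)
qed

text \<open>By Skorohod's theorem the laws are realised by random variables that converge pointwise, which allows the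
  argument of the characteristic function to vary.\<close>

lemma char_loc_unif:
  assumes Pn: "\<And>n. real_distribution (Pn n)" and P: "real_distribution P" and w: "weak_conv_finite Pn P"
  shows "cont_conv UNIV (\<lambda>n \<xi>. char (Pn n) \<xi>) (char P)"
  unfolding cont_conv_def
proof (intro allI impI)
  fix r :: "nat \<Rightarrow> nat" and \<tau> :: "nat \<Rightarrow> real" and l assume r: "strict_mono r" and \<tau>: "\<tau> \<longlonglongrightarrow> l"
  have "weak_conv_m (\<lambda>k. Pn (r k)) P"
    by (rule weak_conv_finite_imp_weak_conv_m[OF Pn P weak_conv_finite_subseq[OF w r]])
  from Skorohod[OF Pn P this] obtain \<Omega> :: "real measure" and Yn Y where
    Y: "prob_space \<Omega>" "\<And>n. Yn n \<in> measurable \<Omega> borel" "\<And>n. distr \<Omega> borel (Yn n) = Pn (r n)"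
      "Y \<in> measurable \<Omega> lborel" "distr \<Omega> borel Y = P" "\<And>x. x \<in> space \<Omega> \<Longrightarrow> (\<lambda>n. Yn n x) \<longlonglongrightarrow> Y x"
    by blast
  interpret prob_space \<Omega> by (rule Y(1))
  have Ym[measurable]: "Y \<in> borel_measurable \<Omega>" using Y(4) by simp
  note Y(2)[measurable]
  have 1: "char (Pn (r k)) \<xi> = (CLINT x|\<Omega>. iexp (\<xi> * Yn k x))" for k \<xi>
    unfolding char_def Y(3)[symmetric] by (rule integral_distr) measurable
  have 2: "char P \<xi> = (CLINT x|\<Omega>. iexp (\<xi> * Y x))" for \<xi>
    unfolding char_def Y(5)[symmetric] by (rule integral_distr) measurable
  show "(\<lambda>k. char (Pn (r k)) (\<tau> k)) \<longlonglongrightarrow> char P l"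
    unfolding 1 2
  proof (rule integral_dominated_convergence[where w = "\<lambda>_. 1"])
    show "AE x in \<Omega>. (\<lambda>k. iexp (\<tau> k * Yn k x)) \<longlonglongrightarrow> iexp (l * Y x)"
      by (rule AE_I2, intro tendsto_intros \<tau> Y(6))
  qed (auto)
qed

text \<open>The difference between \<open>\<delta>\<close> and the principal logarithm of \<open>exp \<circ> \<delta>\<close> is continuous with values in
  \<open>2 \<pi> \<i> \<int>\<close>, hence constant, and it vanishes at \<open>0\<close>.\<close>

lemma small_exp_imp_small:
  fixes \<delta> :: "real \<Rightarrow> complex"
  assumes cont: "continuous_on {-R..R} \<delta>" and "\<delta> 0 = 0" "R \<ge> 0"
    and small: "\<And>\<xi>. \<xi> \<in> {-R..R} \<Longrightarrow> norm (exp (\<delta> \<xi>) - 1) < 1" and \<xi>: "\<xi> \<in> {-R..R}"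
  shows "\<delta> \<xi> = Ln (exp (\<delta> \<xi>))"
proof -
  let ?S = "{-R..R}"
  define h where "h = (\<lambda>\<xi>. \<delta> \<xi> - Ln (exp (\<delta> \<xi>)))"
  have np: "exp (\<delta> \<xi>) \<notin> \<real>\<^sub>\<le>\<^sub>0" if "\<xi> \<in> ?S" for \<xi>
  proof
    assume "exp (\<delta> \<xi>) \<in> \<real>\<^sub>\<le>\<^sub>0"
    then have "Re (exp (\<delta> \<xi>) - 1) \<le> -1" by (simp add: complex_nonpos_Reals_iff)
    with abs_Re_le_cmod[of "exp (\<delta> \<xi>) - 1"] small[OF that] show False by linarith
  qed
  have "h constant_on ?S"
  proof (rule continuous_discrete_range_constant)
    show "continuous_on ?S h" unfolding h_def by (intro continuous_intros cont np)
    show "\<exists>e>0. \<forall>y. y \<in> ?S \<and> h y \<noteq> h x \<longrightarrow> e \<le> norm (h y - h x)" if "x \<in> ?S" for x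
    proof (intro exI[of _ "2 * pi"] conjI allI impI)
      fix y assume "y \<in> ?S \<and> h y \<noteq> h x"
      have "exp (h z) = 1" for z by (simp add: h_def exp_diff)
      then obtain n :: int where n: "h y = h x + (of_int (2 * n) * pi) * \<i>" using exp_eq by metis
      then have "n \<noteq> 0" using \<open>y \<in> ?S \<and> h y \<noteq> h x\<close> by auto
      have "norm (h y - h x) = 2 * \<bar>real_of_int n\<bar> * pi" using n by (simp add: norm_mult)
      also have "\<dots> \<ge> 2 * 1 * pi" using \<open>n \<noteq> 0\<close> by (intro mult_right_mono mult_left_mono) auto
      finally show "2 * pi \<le> norm (h y - h x)" by simp
    qed simp
  qed simp
  then have "h \<xi> = h 0" using \<xi> \<open>R \<ge> 0\<close> unfolding constant_on_def by (metis atLeastAtMost_iff neg_le_0_iff_le)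
  then show ?thesis using assms(2) by (simp add: h_def)
qed

text \<open>The quotients of the characteristic functions tend to \<open>1\<close> uniformly on compact sets, and the difference of
  the exponents is the principal logarithm of such a quotient.\<close>

lemma LK_exponent_uniform_limit:
  assumes Pn: "\<And>n. real_distribution (Pn n)" and P: "real_distribution P" and w: "weak_conv_finite Pn P"
    and fin: "\<And>n. finite_borel_measure (\<eta>n n)" "finite_borel_measure \<eta>"
    and charn: "\<And>n \<xi>. char (Pn n) \<xi> = exp (LK_exponent (\<gamma>n n) (\<eta>n n) \<xi>)"
    and char: "\<And>\<xi>. char P \<xi> = exp (LK_exponent \<gamma> \<eta> \<xi>)"
    and R: "R \<ge> 0"
  shows "uniform_limit {-R..R} (\<lambda>n. LK_exponent (\<gamma>n n) (\<eta>n n)) (LK_exponent \<gamma> \<eta>) sequentially"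
proof (rule uniform_limitI)
  fix e :: real assume e: "e > 0"
  let ?S = "{-R..R}"
  define \<delta> where "\<delta> = (\<lambda>n \<xi>. LK_exponent (\<gamma>n n) (\<eta>n n) \<xi> - LK_exponent \<gamma> \<eta> \<xi>)"
  have ed: "exp (\<delta> n \<xi>) = char (Pn n) \<xi> / char P \<xi>" for n \<xi> by (simp add: \<delta>_def charn char exp_diff)
  have nz: "char P \<xi> \<noteq> 0" for \<xi> by (simp add: char)
  have "isCont Ln 1" by (rule continuous_at_Ln) simp
  then obtain d where d: "d > 0" "\<And>w. norm (w - 1) < d \<Longrightarrow> norm (Ln w) < e"
    using e unfolding continuous_at_eps_delta by (metis dist_norm Ln_1 diff_zero)
  have "uniform_limit ?S (\<lambda>n \<xi>. char (Pn n) \<xi> / char P \<xi>) (\<lambda>\<xi>. 1) sequentially"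
  proof (rule uniform_limit_if_cont_conv)
    show "cont_conv ?S (\<lambda>n \<xi>. char (Pn n) \<xi> / char P \<xi>) (\<lambda>\<xi>. 1)"
      unfolding cont_conv_def
    proof (intro allI impI)
      fix r :: "nat \<Rightarrow> nat" and \<tau> :: "nat \<Rightarrow> real" and l assume r: "strict_mono r" and \<tau>: "\<tau> \<longlonglongrightarrow> l"
      have "(\<lambda>k. char (Pn (r k)) (\<tau> k) / char P (\<tau> k)) \<longlonglongrightarrow> char P l / char P l"
        by (intro tendsto_divide nz cont_convD[OF char_loc_unif[OF Pn P w] r _ _ \<tau>]
            isCont_tendsto_compose[OF real_distribution.isCont_char[OF P] \<tau>]) auto
      then show "(\<lambda>k. char (Pn (r k)) (\<tau> k) / char P (\<tau> k)) \<longlonglongrightarrow> 1" by (simp add: nz)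
    qed
  qed auto
  then have "\<forall>\<^sub>F n in sequentially. \<forall>\<xi>\<in>?S. dist (char (Pn n) \<xi> / char P \<xi>) 1 < min d 1"
    using d(1) by (intro uniform_limitD) auto
  then show "\<forall>\<^sub>F n in sequentially. \<forall>\<xi>\<in>?S. dist (LK_exponent (\<gamma>n n) (\<eta>n n) \<xi>) (LK_exponent \<gamma> \<eta> \<xi>) < e"
  proof eventually_elim
    case (elim n)
    have sm: "norm (exp (\<delta> n \<xi>) - 1) < min d 1" if "\<xi> \<in> ?S" for \<xi>
      using elim that by (simp only: ed dist_norm)
    have c: "continuous_on ?S (\<delta> n)"
      unfolding \<delta>_def
      by (intro continuous_intros continuous_at_imp_continuous_on ballI isCont_LK_exponent fin)
    show ?case
    proof
      fix \<xi> assume \<xi>: "\<xi> \<in> ?S"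
      have "\<delta> n \<xi> = Ln (exp (\<delta> n \<xi>))"
        by (rule small_exp_imp_small[OF c _ R _ \<xi>]) (use sm in \<open>auto simp: \<delta>_def\<close>)
      moreover have "norm (Ln (exp (\<delta> n \<xi>))) < e" using d(2) sm[OF \<xi>] by simp
      ultimately show "dist (LK_exponent (\<gamma>n n) (\<eta>n n) \<xi>) (LK_exponent \<gamma> \<eta> \<xi>) < e"
        by (simp add: \<delta>_def dist_norm)
    qed
  qed
qed

text \<open>Restricting the space, rather than multiplying by an indicator, makes bounds for \<open>h\<close> in \<open>[0, 1]\<close> hold at
  every point of the space.\<close>

definition unit_lborel :: "real measure" where
  "unit_lborel = restrict_space lborel {0..1}"

lemma space_unit_lborel [simp]: "space unit_lborel = {0..1}"
  by (simp add: unit_lborel_def space_restrict_space)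

lemma measurable_unit_lborel: "f \<in> borel_measurable borel \<Longrightarrow> f \<in> borel_measurable unit_lborel"
  unfolding unit_lborel_def by (rule measurable_restrict_space1) simp

interpretation unit_lborel: prob_space unit_lborel
  by (rule prob_spaceI) (simp add: unit_lborel_def emeasure_restrict_space space_restrict_space)

definition LK_weight :: "real \<Rightarrow> real" where
  "LK_weight x = (\<integral>h. - Re (LK_integrand h x) \<partial>unit_lborel)"

lemma LK_joint_measurable [measurable]:
  "(\<lambda>p. LK_integrand (fst p) (snd p)) \<in> borel_measurable (borel \<Otimes>\<^sub>M borel)"
  unfolding LK_integrand_def by measurable

lemma LK_param_measurable [measurable]: "(\<lambda>h. LK_integrand h x) \<in> borel_measurable borel"
  by (intro borel_measurable_continuous_onI continuous_at_imp_continuous_on ballI isCont_LK_integrand_param)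

lemma neg_Re_LK_bounds: "0 \<le> - Re (LK_integrand h x)" "h \<in> {0..1} \<Longrightarrow> - Re (LK_integrand h x) \<le> 6"
proof -
  show "0 \<le> - Re (LK_integrand h x)"
  proof (cases "x = 0")
    case True
    then have "LK_integrand h x = complex_of_real (- h\<^sup>2 / 2)" by (simp add: LK_integrand_def)
    then show ?thesis by simp
  next
    case False
    then show ?thesis unfolding Re_LK_integrand[OF False] by (intro mult_nonneg_nonneg) auto
  qed
  assume h: "h \<in> {0..1}"
  then have "h\<^sup>2 \<le> 1" "\<bar>h\<bar> \<le> 1" by (simp_all add: abs_square_le_1)
  then show "- Re (LK_integrand h x) \<le> 6"
    using norm_LK_integrand[of h x] abs_Re_le_cmod[of "LK_integrand h x"] by linarith
qed

lemma neg_Re_LK_integrable: "integrable unit_lborel (\<lambda>h. - Re (LK_integrand h x))"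
  by (rule unit_lborel.integrable_const_bound[where B = 6])
     (use neg_Re_LK_bounds in \<open>auto intro!: measurable_unit_lborel AE_I2\<close>)

lemma LK_weight_le: "0 \<le> LK_weight x" "LK_weight x \<le> 6"
proof -
  show "0 \<le> LK_weight x" unfolding LK_weight_def by (intro Bochner_Integration.integral_nonneg neg_Re_LK_bounds)
  have "LK_weight x \<le> (\<integral>h. 6 \<partial>unit_lborel)" unfolding LK_weight_def
    by (intro integral_mono neg_Re_LK_integrable) (use neg_Re_LK_bounds in auto)
  then show "LK_weight x \<le> 6" using unit_lborel.prob_space by simp
qed

lemma isCont_LK_weight: "isCont LK_weight x"
  unfolding continuous_at_sequentially
proof safe
  fix X :: "nat \<Rightarrow> real" assume X: "X \<longlonglongrightarrow> x"
  show "(LK_weight \<circ> X) \<longlonglongrightarrow> LK_weight x"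
    unfolding comp_def LK_weight_def
  proof (rule integral_dominated_convergence[where w = "\<lambda>_. 6"])
    show "AE h in unit_lborel. (\<lambda>n. - Re (LK_integrand h (X n))) \<longlonglongrightarrow> - Re (LK_integrand h x)"
      by (rule AE_I2, intro tendsto_intros isCont_tendsto_compose[OF isCont_LK_integrand X])
    show "AE h in unit_lborel. norm (- Re (LK_integrand h (X n))) \<le> 6" for n
      by (rule AE_I2) (use neg_Re_LK_bounds in \<open>simp del: minus_le_iff\<close>)
  qed (auto intro!: measurable_unit_lborel)
qed

lemma integral_cos_unit:
  assumes "x \<noteq> 0"
  shows "(\<integral>h. (1 - cos (h * x)) \<partial>unit_lborel) = 1 - sin x / x"
proof -
  have "has_bochner_integral lborel (\<lambda>h. indicator {0..1} h *\<^sub>R (1 - cos (h * x))) ((1 - sin (1 * x) / x) - (0 - sin (0 * x) / x))"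
    using assms
    by (intro has_bochner_integral_FTC_Icc) (auto intro!: derivative_eq_intros continuous_intros simp: has_real_derivative_iff_has_vector_derivative[symmetric])
  then show ?thesis
    by (simp add: unit_lborel_def integral_restrict_space has_bochner_integral_integral_eq)
qed

lemma integral_square_unit: "(\<integral>h. h\<^sup>2 / 3 \<partial>unit_lborel) = 1 / 9"
proof -
  have "has_bochner_integral lborel (\<lambda>h. indicator {0..1} h *\<^sub>R (h\<^sup>2 / 3)) ((1^3 / 9) - (0^3 / 9 :: real))"
    by (intro has_bochner_integral_FTC_Icc) (auto intro!: derivative_eq_intros continuous_intros simp: has_real_derivative_iff_has_vector_derivative[symmetric])
  from has_bochner_integral_integral_eq[OF this] show ?thesis
    by (simp add: unit_lborel_def integral_restrict_space has_bochner_integral_integral_eq)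
qed

text \<open>For small \<open>x\<close> use \<open>1 - cos u \<ge> u\<^sup>2 / 3\<close> for \<open>|u| \<le> 2\<close>.  For large \<open>x\<close> the average of \<open>1 - cos (h x)\<close> over \<open>h\<close>
  is \<open>1 - sin x / x\<close>, which is at least \<open>1 / 2\<close>; averaging over \<open>h\<close> is what keeps the weight away from \<open>0\<close> at
  infinity.\<close>

lemma LK_weight_ge: "LK_weight x \<ge> 1 / 9"
proof (cases "\<bar>x\<bar> \<le> 2")
  case True
  have "h\<^sup>2 / 3 \<le> - Re (LK_integrand h x)" if h: "h \<in> {0..1}" for h
  proof (cases "x = 0")
    case True
    then have "LK_integrand h x = complex_of_real (- h\<^sup>2 / 2)" by (simp add: LK_integrand_def)
    then show ?thesis by simp
  next
    case False
    define u where "u = h * x"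
    have "\<bar>u\<bar> \<le> 1 * 2" unfolding u_def abs_mult using h True by (intro mult_mono) auto
    then have "u\<^sup>2 \<le> 2\<^sup>2" using power_mono[of "\<bar>u\<bar>" 2 2] by simp
    then have "u\<^sup>2 * u\<^sup>2 \<le> 2\<^sup>2 * u\<^sup>2" by (intro mult_right_mono) auto
    then have "u ^ 4 \<le> 4 * u\<^sup>2" by (simp add: power2_eq_square eval_nat_numeral algebra_simps)
    then have c: "u\<^sup>2 / 3 \<le> 1 - cos u" using cos_approx_4[of u] unfolding abs_le_iff by linarith
    have "h\<^sup>2 / 3 = u\<^sup>2 / 3 * (1 / x\<^sup>2)" using False by (simp add: u_def power_mult_distrib)
    also have "\<dots> \<le> (1 - cos u) * ((1 + x\<^sup>2) / x\<^sup>2)"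
      using c by (intro mult_mono divide_right_mono) auto
    finally show ?thesis unfolding Re_LK_integrand[OF False] u_def .
  qed
  then have "(\<integral>h. h\<^sup>2 / 3 \<partial>unit_lborel) \<le> LK_weight x" unfolding LK_weight_def
    by (intro integral_mono neg_Re_LK_integrable unit_lborel.integrable_const_bound[where B = 1])
       (auto intro!: measurable_unit_lborel AE_I2 order_trans[OF power_le_one])
  then show ?thesis using integral_square_unit by simp
next
  case False
  then have x: "x \<noteq> 0" "\<bar>x\<bar> > 2" by auto
  have "1 - cos (h * x) \<le> - Re (LK_integrand h x)" for h
    unfolding Re_LK_integrand[OF x(1)] using x(1) mult_left_mono[of 1 "(1 + x\<^sup>2) / x\<^sup>2" "1 - cos (h * x)"]
    by (simp add: divide_simps)
  then have "(\<integral>h. (1 - cos (h * x)) \<partial>unit_lborel) \<le> LK_weight x" unfolding LK_weight_def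
    by (intro integral_mono neg_Re_LK_integrable unit_lborel.integrable_const_bound[where B = 2])
       (auto intro!: measurable_unit_lborel AE_I2 simp: abs_le_iff intro: order_trans[OF _ cos_ge_minus_one])
  moreover have "\<bar>sin x / x\<bar> \<le> 1 / 2" 
  proof -
    have "\<bar>sin x\<bar> * 2 \<le> \<bar>x\<bar>" using x(2) abs_sin_le_one[of x] by linarith
    then show ?thesis using x(1) by (simp add: abs_divide divide_simps)
  qed
  ultimately show ?thesis unfolding integral_cos_unit[OF x(1)] abs_le_iff by linarith
qed

definition LK_weighted :: "real measure \<Rightarrow> real measure" where
  "LK_weighted \<eta> = density \<eta> (\<lambda>x. ennreal (LK_weight x))"

lemma measurable_LK_weight: "LK_weight \<in> borel_measurable borel"
  by (intro borel_measurable_continuous_onI continuous_at_imp_continuous_on ballI isCont_LK_weight)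

lemma finite_LK_weighted:
  assumes "finite_borel_measure \<eta>"
  shows "finite_borel_measure (LK_weighted \<eta>)"
proof -
  interpret finite_borel_measure \<eta> by fact
  have "(\<integral>\<^sup>+x. ennreal (LK_weight x) \<partial>\<eta>) \<le> (\<integral>\<^sup>+x. 6 \<partial>\<eta>)"
    using LK_weight_le(2) by (intro nn_integral_mono) (simp add: ennreal_leI flip: ennreal_numeral)
  also have "\<dots> < \<infinity>" by (simp add: ennreal_mult_eq_top_iff less_top[symmetric])
  finally have fin': "(\<integral>\<^sup>+x. ennreal (LK_weight x) \<partial>\<eta>) \<noteq> \<infinity>" by simp
  have "emeasure (LK_weighted \<eta>) (space \<eta>) = (\<integral>\<^sup>+x. ennreal (LK_weight x) * indicator (space \<eta>) x \<partial>\<eta>)"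
    unfolding LK_weighted_def using measurable_borel_M[OF measurable_LK_weight]
    by (intro emeasure_density) auto
  also have "\<dots> = (\<integral>\<^sup>+x. ennreal (LK_weight x) \<partial>\<eta>)" by (rule nn_integral_cong) simp
  finally have "emeasure (LK_weighted \<eta>) (space (LK_weighted \<eta>)) \<noteq> \<infinity>"
    using fin' by (simp add: LK_weighted_def)
  then show ?thesis
    by (simp add: finite_borel_measure_def finite_borel_measure_axioms_def finite_measureI LK_weighted_def M_is_borel)
qed

lemma integral_LK_weighted:
  fixes f :: "real \<Rightarrow> 'b::{banach, second_countable_topology}"
  assumes "finite_borel_measure \<eta>" "f \<in> borel_measurable borel"
  shows "(\<integral>x. f x \<partial>LK_weighted \<eta>) = (\<integral>x. LK_weight x *\<^sub>R f x \<partial>\<eta>)"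
proof -
  interpret finite_borel_measure \<eta> by fact
  show ?thesis unfolding LK_weighted_def
    using measurable_borel_M[OF measurable_LK_weight] measurable_borel_M[OF assms(2)] LK_weight_le(1)
    by (subst integral_density) auto
qed

text \<open>Integrate the second difference formula over \<open>h\<close> and exchange the integrals.  The linear term \<open>\<i> \<gamma> \<xi>\<close> has
  vanishing second differences, so the formula holds for every \<open>\<gamma>\<close>.\<close>

lemma char_LK_weighted:
  assumes fin: "finite_borel_measure \<eta>"
  shows "char (LK_weighted \<eta>) \<xi> =
    (\<integral>h. LK_exponent \<gamma> \<eta> \<xi> - (LK_exponent \<gamma> \<eta> (\<xi> + h) + LK_exponent \<gamma> \<eta> (\<xi> - h)) / 2 \<partial>unit_lborel)"
proof -
  interpret finite_borel_measure \<eta> by fact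
  interpret P: pair_sigma_finite \<eta> unit_lborel
    by (simp add: pair_sigma_finite_def unit_lborel.sigma_finite_measure_axioms sigma_finite_measure_axioms)
  define g where "g = (\<lambda>(x, h). iexp (\<xi> * x) * complex_of_real (- Re (LK_integrand h x)))"
  have [measurable_cong]: "sets \<eta> = sets borel" by (rule M_is_borel)
  have snd_m[measurable]: "snd \<in> borel_measurable (\<eta> \<Otimes>\<^sub>M unit_lborel)"
    by (rule measurable_compose[OF measurable_snd, of "\<lambda>x. x", unfolded]) (rule measurable_unit_lborel, simp)
  have pm: "(\<lambda>p. (snd p, fst p)) \<in> measurable (\<eta> \<Otimes>\<^sub>M unit_lborel) (borel \<Otimes>\<^sub>M borel)" by measurable
  have Lm[measurable]: "(\<lambda>p. LK_integrand (snd p) (fst p)) \<in> borel_measurable (\<eta> \<Otimes>\<^sub>M unit_lborel)"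
    using measurable_compose[OF pm LK_joint_measurable] by simp
  have gm: "g \<in> borel_measurable (\<eta> \<Otimes>\<^sub>M unit_lborel)"
    unfolding g_def split_def by measurable
  have gb: "norm (g (x, h)) \<le> 6" if "h \<in> {0..1}" for x h
    using neg_Re_LK_bounds(1)[of h x] neg_Re_LK_bounds(2)[OF that, of x] by (simp add: g_def norm_mult)
  have gi: "integrable unit_lborel (\<lambda>h. g (x, h))" for x
  proof (rule unit_lborel.integrable_const_bound[where B = 6])
    have "(\<lambda>h. g (x, h)) \<in> borel_measurable borel" unfolding g_def by simp
    then show "(\<lambda>h. g (x, h)) \<in> borel_measurable unit_lborel" by (rule measurable_unit_lborel)
  qed (auto intro!: AE_I2 gb)
  have gi2: "(\<integral>h. norm (g (x, h)) \<partial>unit_lborel) \<le> 6" for x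
  proof -
    have "(\<integral>h. norm (g (x, h)) \<partial>unit_lborel) \<le> (\<integral>h. 6 \<partial>unit_lborel)"
      using gi gb by (intro integral_mono) auto
    then show ?thesis using unit_lborel.prob_space by simp
  qed
  have int: "integrable (\<eta> \<Otimes>\<^sub>M unit_lborel) g"
  proof (rule P.Fubini_integrable[OF gm])
    show "integrable \<eta> (\<lambda>x. \<integral>h. norm (g (x, h)) \<partial>unit_lborel)"
    proof (rule integrable_const_bound[where B = 6])
      show "(\<lambda>x. \<integral>h. norm (g (x, h)) \<partial>unit_lborel) \<in> borel_measurable \<eta>"
        using gm by measurable
    qed (use gi2 in \<open>auto intro!: AE_I2\<close>)
    show "AE x in \<eta>. integrable unit_lborel (\<lambda>h. g (x, h))" using gi by auto
  qed
  have s: "(\<integral>h. (\<integral>x. g (x, h) \<partial>\<eta>) \<partial>unit_lborel) = (\<integral>x. (\<integral>h. g (x, h) \<partial>unit_lborel) \<partial>\<eta>)"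
    using P.integral_snd[of "\<lambda>x h. g (x, h)"] P.integral_fst[of "\<lambda>x h. g (x, h)"] int by (simp add: split_def)
  have L: "(\<integral>x. g (x, h) \<partial>\<eta>) = LK_exponent \<gamma> \<eta> \<xi> - (LK_exponent \<gamma> \<eta> (\<xi> + h) + LK_exponent \<gamma> \<eta> (\<xi> - h)) / 2" for h
  proof -
    note i = integrable_LK_integrand[OF fin]
    have "(\<integral>x. g (x, h) \<partial>\<eta>) = (\<integral>x. LK_integrand \<xi> x - (LK_integrand (\<xi> + h) x + LK_integrand (\<xi> - h) x) / 2 \<partial>\<eta>)"
      unfolding LK_integrand_second_difference g_def by simp
    also have "\<dots> = (\<integral>x. LK_integrand \<xi> x \<partial>\<eta>) - ((\<integral>x. LK_integrand (\<xi> + h) x \<partial>\<eta>) + (\<integral>x. LK_integrand (\<xi> - h) x \<partial>\<eta>)) / 2"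
      using i by simp
    also have "\<dots> = LK_exponent \<gamma> \<eta> \<xi> - (LK_exponent \<gamma> \<eta> (\<xi> + h) + LK_exponent \<gamma> \<eta> (\<xi> - h)) / 2"
      unfolding LK_exponent_def by (simp add: field_simps)
    finally show ?thesis .
  qed
  have R: "(\<integral>h. g (x, h) \<partial>unit_lborel) = LK_weight x *\<^sub>R iexp (\<xi> * x)" for x
  proof -
    have "(\<integral>h. g (x, h) \<partial>unit_lborel) = iexp (\<xi> * x) * (\<integral>h. complex_of_real (- Re (LK_integrand h x)) \<partial>unit_lborel)"
      unfolding g_def by (simp only: case_prod_conv Bochner_Integration.integral_mult_right_zero)
    also have "(\<integral>h. complex_of_real (- Re (LK_integrand h x)) \<partial>unit_lborel) = complex_of_real (LK_weight x)"
      unfolding LK_weight_def by (rule integral_complex_of_real)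
    finally show ?thesis by (simp add: scaleR_conv_of_real mult.commute)
  qed
  show ?thesis
    unfolding char_def s[unfolded L R, symmetric]
    by (rule trans[OF _ s[unfolded L R, symmetric]]) (rule integral_LK_weighted[OF fin], simp)
qed

text \<open>Uniform convergence of the exponents on compact sets gives convergence of the averaged second differences,
  that is, of the characteristic functions of the weighted measures.  The weight is bounded away from \<open>0\<close> and can be
  divided out.  The number \<open>\<gamma>\<close> is then recovered from the value of the exponent at \<open>1\<close>.\<close>

theorem LK_convergence_converse:
  assumes Pn: "\<And>n. real_distribution (Pn n)" and P: "real_distribution P" and w: "weak_conv_finite Pn P"
    and fin: "\<And>n. finite_borel_measure (\<eta>n n)" "finite_borel_measure \<eta>"
    and charn: "\<And>n \<xi>. char (Pn n) \<xi> = exp (LK_exponent (\<gamma>n n) (\<eta>n n) \<xi>)"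
    and char: "\<And>\<xi>. char P \<xi> = exp (LK_exponent \<gamma> \<eta> \<xi>)"
  shows "weak_conv_finite \<eta>n \<eta>" "\<gamma>n \<longlonglongrightarrow> \<gamma>"
proof -
  let ?E = "\<lambda>n. LK_exponent (\<gamma>n n) (\<eta>n n)" and ?L = "LK_exponent \<gamma> \<eta>"
  let ?D = "\<lambda>\<psi> \<xi> h. \<psi> \<xi> - (\<psi> (\<xi> + h) + \<psi> (\<xi> - h)) / (2::complex)"
  have ul: "uniform_limit {-R..R} ?E ?L sequentially" if "R \<ge> 0" for R
    by (rule LK_exponent_uniform_limit[OF Pn P w fin charn char that])
  have Lm: "LK_exponent g e \<in> borel_measurable borel" if "finite_borel_measure e" for g e
    by (intro borel_measurable_continuous_onI continuous_at_imp_continuous_on ballI isCont_LK_exponent that)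
  have Dm: "(\<lambda>h. ?D (LK_exponent g e) \<xi> h) \<in> borel_measurable unit_lborel" if "finite_borel_measure e" for g e \<xi>
  proof (rule measurable_unit_lborel)
    note [measurable] = Lm[OF that]
    show "(\<lambda>h. ?D (LK_exponent g e) \<xi> h) \<in> borel_measurable borel" by measurable
  qed
  have cd: "(\<lambda>n. char (LK_weighted (\<eta>n n)) \<xi>) \<longlonglongrightarrow> char (LK_weighted \<eta>) \<xi>" for \<xi>
  proof -
    let ?R = "\<bar>\<xi>\<bar> + 1"
    have "uniform_limit {0..1} (\<lambda>n h. ?D (?E n) \<xi> h) (\<lambda>h. ?D ?L \<xi> h) sequentially"
    proof (rule uniform_limitI)
      fix e :: real assume e: "e > 0"
      have "\<forall>\<^sub>F n in sequentially. \<forall>x\<in>{-?R..?R}. dist (?E n x) (?L x) < e / 2"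
        using ul[of ?R] e by (intro uniform_limitD) auto
      then show "\<forall>\<^sub>F n in sequentially. \<forall>h\<in>{0..1}. dist (?D (?E n) \<xi> h) (?D ?L \<xi> h) < e"
      proof eventually_elim
        case (elim n)
        show ?case
        proof
          fix h :: real assume h: "h \<in> {0..1}"
          let ?d = "\<lambda>x. ?E n x - ?L x"
          have b: "norm (?d x) < e / 2" if "x \<in> {-?R..?R}" for x
            using elim that by (simp only: dist_norm)
          have eq: "?D (?E n) \<xi> h - ?D ?L \<xi> h = ?d \<xi> - (?d (\<xi> + h) + ?d (\<xi> - h)) / 2"
            by (simp add: field_simps)
          have "norm (?D (?E n) \<xi> h - ?D ?L \<xi> h) \<le> norm (?d \<xi>) + (norm (?d (\<xi> + h)) + norm (?d (\<xi> - h))) / 2"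
            unfolding eq by (rule order_trans[OF norm_triangle_ineq4]) (auto simp: norm_divide intro: norm_triangle_ineq)
          also have "\<dots> < e"
          proof -
            have "\<xi> \<in> {-?R..?R}" "\<xi> + h \<in> {-?R..?R}" "\<xi> - h \<in> {-?R..?R}" using h by auto
            from this[THEN b] show ?thesis by argo
          qed
          finally show "dist (?D (?E n) \<xi> h) (?D ?L \<xi> h) < e" by (simp only: dist_norm)
        qed
      qed
    qed
    note u = this
    have "(\<lambda>n. \<integral>h. ?D (?E n) \<xi> h \<partial>unit_lborel) \<longlonglongrightarrow> (\<integral>h. ?D ?L \<xi> h \<partial>unit_lborel)"
    proof (rule tendstoI)
      fix e :: real assume e: "e > 0"
      have Li: "integrable unit_lborel (\<lambda>h. ?D (LK_exponent g eta) \<xi> h)" if "finite_borel_measure eta" for g eta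
      proof -
        have c: "continuous_on UNIV (LK_exponent g eta)"
          by (intro continuous_at_imp_continuous_on ballI isCont_LK_exponent that)
        have "continuous_on {0..1} (\<lambda>h. LK_exponent g eta (\<xi> + h))" "continuous_on {0..1} (\<lambda>h. LK_exponent g eta (\<xi> - h))"
          by (rule continuous_on_compose2[OF c], intro continuous_intros, simp)+
        then have "continuous_on {0..1} (\<lambda>h. ?D (LK_exponent g eta) \<xi> h)"
          by (intro continuous_on_diff continuous_on_divide continuous_on_add continuous_on_const) auto
        then have "bounded ((\<lambda>h. ?D (LK_exponent g eta) \<xi> h) ` {0..1})"
          by (intro compact_imp_bounded compact_continuous_image) auto
        then obtain B where "\<forall>y \<in> (\<lambda>h. ?D (LK_exponent g eta) \<xi> h) ` {0..1}. norm y \<le> B" unfolding bounded_iff by blast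
        then show ?thesis
          by (intro unit_lborel.integrable_const_bound[where B = B] Dm that AE_I2) (drule bspec, rule imageI, simp_all only: space_unit_lborel)
      qed
      have "\<forall>\<^sub>F n in sequentially. \<forall>h\<in>{0..1}. dist (?D (?E n) \<xi> h) (?D ?L \<xi> h) < e / 2"
        using u e by (intro uniform_limitD) auto
      then show "\<forall>\<^sub>F n in sequentially. dist (\<integral>h. ?D (?E n) \<xi> h \<partial>unit_lborel) (\<integral>h. ?D ?L \<xi> h \<partial>unit_lborel) < e"
      proof eventually_elim
        case (elim n)
        have eq: "(\<integral>h. ?D (?E n) \<xi> h \<partial>unit_lborel) - (\<integral>h. ?D ?L \<xi> h \<partial>unit_lborel) = (\<integral>h. ?D (?E n) \<xi> h - ?D ?L \<xi> h \<partial>unit_lborel)"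
          by (rule Bochner_Integration.integral_diff[symmetric]) (rule Li[OF fin(1)], rule Li[OF fin(2)])
        have "norm (\<integral>h. ?D (?E n) \<xi> h - ?D ?L \<xi> h \<partial>unit_lborel) \<le> e / 2 * measure unit_lborel (space unit_lborel)"
        proof (rule norm_integral_le_mass[OF unit_lborel.finite_measure_axioms])
          show "norm (?D (?E n) \<xi> h - ?D ?L \<xi> h) \<le> e / 2" if "h \<in> space unit_lborel" for h
            using elim that unfolding dist_norm space_unit_lborel by (blast intro: less_imp_le)
        qed (use e in simp)
        then have "norm (\<integral>h. ?D (?E n) \<xi> h - ?D ?L \<xi> h \<partial>unit_lborel) \<le> e / 2"
          by (simp only: unit_lborel.prob_space mult_1_right)
        then show ?case using e unfolding dist_norm eq by argo
      qed
    qed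
    moreover have "char (LK_weighted (\<eta>n n)) \<xi> = (\<integral>h. ?D (?E n) \<xi> h \<partial>unit_lborel)" for n
      by (rule char_LK_weighted[OF fin(1)])
    moreover have "char (LK_weighted \<eta>) \<xi> = (\<integral>h. ?D ?L \<xi> h \<partial>unit_lborel)"
      by (rule char_LK_weighted[OF fin(2)])
    ultimately show ?thesis by (simp only:)
  qed
  have wc: "weak_conv_finite (\<lambda>n. LK_weighted (\<eta>n n)) (LK_weighted \<eta>)"
    by (rule weak_conv_finite_from_char[OF finite_LK_weighted[OF fin(1)] finite_LK_weighted[OF fin(2)] cd])
  show we: "weak_conv_finite \<eta>n \<eta>"
    unfolding weak_conv_finite_def
  proof (intro allI impI, elim conjE)
    fix f :: "real \<Rightarrow> real" assume f: "continuous_on UNIV f" "bounded (range f)"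
    then obtain B where B: "\<And>x. \<bar>f x\<bar> \<le> B" by (auto simp: bounded_iff)
    have nz: "LK_weight x > 0" for x using LK_weight_ge[of x] by linarith
    have wcont: "continuous_on UNIV LK_weight"
      by (intro continuous_at_imp_continuous_on ballI isCont_LK_weight)
    have c: "continuous_on UNIV (\<lambda>x. f x / LK_weight x)"
      using nz by (intro continuous_on_divide f(1) wcont) (auto simp: less_le)
    have "\<bar>f x / LK_weight x\<bar> \<le> B / (1 / 9)" for x
      unfolding abs_divide using B[of x] LK_weight_ge[of x] by (intro frac_le) auto
    then have b: "bounded (range (\<lambda>x. f x / LK_weight x))" by (auto simp: bounded_iff)
    have e: "(\<integral>x. f x / LK_weight x \<partial>LK_weighted M) = (\<integral>x. f x \<partial>M)" if "finite_borel_measure M" for M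
      using nz by (subst integral_LK_weighted[OF that]) (auto intro!: borel_measurable_continuous_onI c simp: less_le intro: Bochner_Integration.integral_cong)
    have "(\<lambda>n. \<integral>x. f x / LK_weight x \<partial>LK_weighted (\<eta>n n)) \<longlonglongrightarrow> (\<integral>x. f x / LK_weight x \<partial>LK_weighted \<eta>)"
      using wc c b unfolding weak_conv_finite_def by blast
    then show "(\<lambda>n. integral\<^sup>L (\<eta>n n) f) \<longlonglongrightarrow> integral\<^sup>L \<eta> f"
      by (simp only: e[OF fin(1)] e[OF fin(2)])
  qed
  have "(\<lambda>n. ?E n 1) \<longlonglongrightarrow> ?L 1"
    by (rule tendsto_uniform_limitI[OF ul[of 1]]) auto
  moreover have "(\<lambda>n. CLINT x|\<eta>n n. LK_integrand 1 x) \<longlonglongrightarrow> (CLINT x|\<eta>. LK_integrand 1 x)"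
    by (rule weak_conv_finite_complex[OF we fin continuous_LK_integrand bounded_LK_integrand])
  ultimately have "(\<lambda>n. ?E n 1 - (CLINT x|\<eta>n n. LK_integrand 1 x)) \<longlonglongrightarrow> ?L 1 - (CLINT x|\<eta>. LK_integrand 1 x)"
    by (rule tendsto_diff)
  then have "(\<lambda>n. \<i> * complex_of_real (\<gamma>n n)) \<longlonglongrightarrow> \<i> * complex_of_real \<gamma>"
    by (simp add: LK_exponent_def)
  from tendsto_Im[OF this] show "\<gamma>n \<longlonglongrightarrow> \<gamma>" by simp
qed

lemma char_convolution:
  assumes M: "real_distribution M" and N: "real_distribution N"
  shows "char (convolution M N) t = char M t * char N t"
proof -
  interpret M: real_distribution M by (rule M)
  interpret N: real_distribution N by (rule N)
  interpret P: pair_prob_space M N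
    unfolding pair_prob_space_def pair_sigma_finite_def
    by (intro conjI M.prob_space_axioms N.prob_space_axioms M.sigma_finite_measure_axioms N.sigma_finite_measure_axioms)
  have e: "convolution M N = distr (M \<Otimes>\<^sub>M N) borel (\<lambda>p. fst p + snd p)"
    by (simp add: convolution_def case_prod_beta')
  have i: "integrable (M \<Otimes>\<^sub>M N) (\<lambda>p. iexp (t * (fst p + snd p)))"
    by (rule P.integrable_const_bound[where B = 1]) (simp, measurable)
  have "char (convolution M N) t = (\<integral>p. iexp (t * (fst p + snd p)) \<partial>(M \<Otimes>\<^sub>M N))"
    unfolding char_def e by (rule integral_distr) measurable
  moreover have "(\<integral>p. iexp (t * (fst p + snd p)) \<partial>(M \<Otimes>\<^sub>M N)) = (\<integral>x. \<integral>y. iexp (t * (x + y)) \<partial>N \<partial>M)"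
    using P.integral_fst'[OF i] by simp
  moreover have "iexp (t * (x + y)) = iexp (t * x) * iexp (t * y)" for x y
    by (simp add: exp_add[symmetric] algebra_simps)
  ultimately show ?thesis unfolding char_def
    by (simp only: Bochner_Integration.integral_mult_right_zero Bochner_Integration.integral_mult_left_zero)
qed

section \<open>Integration against the measure of a generator\<close>

text \<open>The kernel of the Nevanlinna representation, which drives the integral equation.\<close>

definition nev_kernel :: "complex \<Rightarrow> real \<Rightarrow> complex" where
  "nev_kernel w x = (1 + complex_of_real x * w) / (complex_of_real x - w)"

lemma nev_kernel_resolvent:
  assumes "Im w > 0"
  shows "nev_kernel w x = w - (1 + w\<^sup>2) * (1 / (w - complex_of_real x))"
  using UHP_neq_real[OF assms, of x] by (simp add: nev_kernel_def divide_simps power2_eq_square) (simp add: algebra_simps)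

text \<open>Bounds for the kernel, and for its Lipschitz constant, on the region \<open>Im w \<ge> d\<close>, \<open>|w| \<le> R\<close>, uniformly in \<open>x\<close>.\<close>

definition kernel_bound :: "real \<Rightarrow> real \<Rightarrow> real" where
  "kernel_bound d R = R + (1 + R\<^sup>2) * (1 / d)"

definition kernel_lip :: "real \<Rightarrow> real \<Rightarrow> real" where
  "kernel_lip d R = 1 + 2 * R * (1 / d) + (1 + R\<^sup>2) * (1 / d * (1 / d))"

lemma kernel_consts_pos: "d > 0 \<Longrightarrow> R \<ge> 0 \<Longrightarrow> kernel_bound d R \<ge> 0 \<and> kernel_lip d R \<ge> 1"
  by (auto simp: kernel_bound_def kernel_lip_def intro!: add_nonneg_nonneg mult_nonneg_nonneg)

lemma norm_resolvent_le': "d > 0 \<Longrightarrow> Im w \<ge> d \<Longrightarrow> norm (1 / (w - complex_of_real x)) \<le> 1 / d"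
  by (rule order_trans[OF norm_resolvent_le]) (auto intro: frac_le)

lemma norm_nev_kernel:
  assumes "d > 0" "Im w \<ge> d" "norm w \<le> R"
  shows "norm (nev_kernel w x) \<le> kernel_bound d R"
proof -
  have i: "Im w > 0" using assms by linarith
  have "norm (1 + w\<^sup>2) \<le> norm (1::complex) + norm (w\<^sup>2)" by (rule norm_triangle_ineq)
  also have "\<dots> \<le> 1 + R\<^sup>2" using power_mono[OF assms(3), of 2] by (simp add: norm_power)
  finally have "norm (1 + w\<^sup>2) * norm (1 / (w - complex_of_real x)) \<le> (1 + R\<^sup>2) * (1 / d)"
    using norm_resolvent_le'[OF assms(1,2)] by (intro mult_mono) auto
  moreover have "norm (nev_kernel w x) \<le> norm w + norm ((1 + w\<^sup>2) * (1 / (w - complex_of_real x)))"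
    unfolding nev_kernel_resolvent[OF i] by (rule norm_triangle_ineq4)
  ultimately show ?thesis unfolding kernel_bound_def norm_mult using assms(3) by linarith
qed

lemma nev_kernel_lipschitz:
  assumes "d > 0" "Im w \<ge> d" "norm w \<le> R" "Im v \<ge> d" "norm v \<le> R"
  shows "norm (nev_kernel w x - nev_kernel v x) \<le> kernel_lip d R * norm (w - v)"
proof -
  have i: "Im w > 0" "Im v > 0" using assms by linarith+
  have R0: "0 \<le> R" by (rule order_trans[OF norm_ge_zero assms(3)])
  let ?r = "\<lambda>w. 1 / (w - complex_of_real x)"
  have eq: "nev_kernel w x - nev_kernel v x = (w - v) - ((w - v) * (w + v) * ?r w + (1 + v\<^sup>2) * (?r w - ?r v))"
    unfolding nev_kernel_resolvent[OF i(1)] nev_kernel_resolvent[OF i(2)]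
    by (simp only: power2_eq_square ring_distribs) (simp add: algebra_simps)
  have "norm ((w - v) * (w + v) * ?r w) \<le> norm (w - v) * (2 * R) * (1 / d)"
    unfolding norm_mult
    using norm_resolvent_le'[OF assms(1,2)] norm_triangle_ineq[of w v] assms R0
    by (intro mult_mono) auto
  moreover have "norm ((1 + v\<^sup>2) * (?r w - ?r v)) \<le> (1 + R\<^sup>2) * (norm (w - v) * (1 / d * (1 / d)))"
    unfolding norm_mult
  proof (intro mult_mono)
    have "norm (1 + v\<^sup>2) \<le> norm (1::complex) + norm (v\<^sup>2)" by (rule norm_triangle_ineq)
    also have "\<dots> \<le> 1 + R\<^sup>2" using power_mono[OF assms(5), of 2] by (simp add: norm_power)
    finally show "norm (1 + v\<^sup>2) \<le> 1 + R\<^sup>2" .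
    have "norm (?r w - ?r v) \<le> norm (w - v) / (Im w * Im v)" by (rule norm_resolvent_diff_le[OF i])
    also have "\<dots> \<le> norm (w - v) / (d * d)" using assms i by (intro divide_left_mono mult_mono) auto
    finally show "norm (?r w - ?r v) \<le> norm (w - v) * (1 / d * (1 / d))" by simp
  qed auto
  moreover have "norm (nev_kernel w x - nev_kernel v x) \<le> norm (w - v) +
      (norm ((w - v) * (w + v) * ?r w) + norm ((1 + v\<^sup>2) * (?r w - ?r v)))"
    unfolding eq by (rule order_trans[OF norm_triangle_ineq4]) (intro add_mono order_refl norm_triangle_ineq)
  moreover have "kernel_lip d R * norm (w - v) = norm (w - v) + (norm (w - v) * (2 * R) * (1 / d) + (1 + R\<^sup>2) * (norm (w - v) * (1 / d * (1 / d))))"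
    unfolding kernel_lip_def by (simp add: algebra_simps add_divide_distrib)
  ultimately show ?thesis by linarith
qed

lemma measurable_nev_kernel [measurable]: "nev_kernel w \<in> borel_measurable borel"
  unfolding nev_kernel_def[abs_def] by measurable

lemma time_interval_props:
  assumes "time_interval I"
  shows "0 \<in> I" "\<And>t. t \<in> I \<Longrightarrow> 0 \<le> t" "\<And>t r. t \<in> I \<Longrightarrow> 0 \<le> r \<Longrightarrow> r \<le> t \<Longrightarrow> r \<in> I"
  using assms unfolding time_interval_def by auto

locale generator_with_measure =
  fixes I :: "real set" and \<gamma> :: "real \<Rightarrow> real" and \<eta> :: "real \<Rightarrow> real measure" and H :: "(real \<times> real) measure"
  assumes time: "time_interval I" and gen: "generator I \<gamma> \<eta>" and meas: "generator_measure I \<eta> H"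
begin

definition mass :: "real \<Rightarrow> real" where "mass t = measure (\<eta> t) UNIV"

lemmas zero_in = time_interval_props(1)[OF time]
lemmas nonneg_time = time_interval_props(2)[OF time]
lemmas down_closed = time_interval_props(3)[OF time]

lemma fin_eta: "t \<in> I \<Longrightarrow> finite_borel_measure (\<eta> t)"
  using gen by (auto simp: generator_def)

lemma continuous_gamma: "continuous_on I \<gamma>" and gamma_0: "\<gamma> 0 = 0" and eta_0: "\<eta> 0 = null_measure borel"
  using gen by (auto simp: generator_def)

lemma mass_mono: "s \<in> I \<Longrightarrow> t \<in> I \<Longrightarrow> s \<le> t \<Longrightarrow> mass s \<le> mass t"
  using gen unfolding generator_def mass_def by (auto dest!: bspec[of _ _ UNIV] elim: mono_onD)

lemma continuous_mass: "continuous_on I mass"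
  using gen unfolding generator_def mass_def[abs_def] by (auto dest!: bspec[of _ _ UNIV])

lemma mass_nonneg: "mass t \<ge> 0" by (simp add: mass_def)

lemma mass_0: "mass 0 = 0" by (simp add: mass_def eta_0)

lemma sets_H: "sets H = sets (restrict_space borel (UNIV \<times> I))"
  using meas by (simp add: generator_measure_def)

lemma space_H: "space H = UNIV \<times> I"
  using sets_eq_imp_space_eq[OF sets_H] by (simp add: space_restrict_space)

lemma emeasure_H:
  "B \<in> sets borel \<Longrightarrow> s \<in> I \<Longrightarrow> t \<in> I \<Longrightarrow> s \<le> t \<Longrightarrow>
     emeasure H (B \<times> {s<..t}) = ennreal (measure (\<eta> t) B - measure (\<eta> s) B)"
  using meas unfolding generator_measure_def time_pairs_def by auto

lemma rect_sets: 
  assumes "B \<in> sets borel" "J \<in> sets borel" "J \<subseteq> I"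
  shows "B \<times> J \<in> sets H"
proof -
  have "B \<times> J \<in> sets borel" using assms by (intro borel_Times) auto
  moreover have "B \<times> J = (B \<times> J) \<inter> (UNIV \<times> I)" using assms(3) by auto
  ultimately show ?thesis unfolding sets_H sets_restrict_space by (metis (no_types, lifting) Int_commute image_eqI)
qed

lemma measurable_H: "f \<in> borel_measurable borel \<Longrightarrow> f \<in> borel_measurable H"
  unfolding measurable_cong_sets[OF sets_H refl] by (rule measurable_restrict_space1)

lemma interval_subset:
  assumes "s \<in> I" "t \<in> I"
  shows "{s..t} \<subseteq> I" "{s<..t} \<subseteq> I"
proof -
  show "{s..t} \<subseteq> I"
  proof
    fix r assume "r \<in> {s..t}"
    then have "0 \<le> r" "r \<le> t" using nonneg_time[OF assms(1)] by auto
    then show "r \<in> I" by (rule down_closed[OF assms(2)])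
  qed
  then show "{s<..t} \<subseteq> I" by (meson greaterThanAtMost_subseteq_atLeastAtMost_iff order_refl order_trans)
qed

text \<open>The total mass is continuous in time, so the measure of \<open>\<real> \<times> {s}\<close> is at most an increment of the mass over
  arbitrarily short intervals.\<close>

lemma null_slice: 
  assumes "s \<in> I"
  shows "emeasure H (UNIV \<times> {s}) = 0"
proof (cases "s = 0")
  case True
  then show ?thesis using meas by (simp add: generator_measure_def)
next
  case False
  then have s: "s > 0" using nonneg_time[OF assms] by simp
  define r where "r = (\<lambda>k::nat. s - s / real (Suc k))"
  have r: "0 \<le> r k" "r k < s" "r k \<in> I" for k
  proof -
    show "0 \<le> r k" "r k < s" using s by (auto simp: r_def field_simps)
    then show "r k \<in> I" using down_closed[OF assms] by simp
  qed
  have "(\<lambda>k. s * (1 / real (Suc k))) \<longlonglongrightarrow> s * 0" by (intro tendsto_intros LIMSEQ_Suc[OF lim_1_over_n])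
  then have "(\<lambda>k. s - s / real (Suc k)) \<longlonglongrightarrow> s - 0" by (intro tendsto_intros) simp
  then have "r \<longlonglongrightarrow> s" by (simp add: r_def[abs_def])
  then have "(\<lambda>k. mass (r k)) \<longlonglongrightarrow> mass s"
    using continuous_mass[unfolded continuous_on_sequentially, rule_format, of s r] r assms by (simp add: o_def)
  then have "(\<lambda>k. ennreal (mass s - mass (r k))) \<longlonglongrightarrow> ennreal (mass s - mass s)"
    by (intro tendsto_ennrealI tendsto_intros)
  moreover have "emeasure H (UNIV \<times> {s}) \<le> ennreal (mass s - mass (r k))" for k
  proof -
    have "emeasure H (UNIV \<times> {s}) \<le> emeasure H (UNIV \<times> {r k<..s})"
      using r[of k] assms by (intro emeasure_mono rect_sets interval_subset) auto
    then show ?thesis using emeasure_H[of UNIV "r k" s] r[of k] assms by (simp add: mass_def)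
  qed
  ultimately have "emeasure H (UNIV \<times> {s}) \<le> ennreal (mass s - mass s)"
    by (intro LIMSEQ_le_const) auto
  then show ?thesis by simp
qed

lemma emeasure_H_closed:
  assumes "B \<in> sets borel" "s \<in> I" "t \<in> I" "s \<le> t"
  shows "emeasure H (B \<times> {s..t}) = ennreal (measure (\<eta> t) B - measure (\<eta> s) B)"
proof -
  have e: "B \<times> {s..t} = (B \<times> {s}) \<union> (B \<times> {s<..t})" using assms(4) by auto
  have m: "B \<times> {s} \<in> sets H" "B \<times> {s<..t} \<in> sets H" "UNIV \<times> {s} \<in> sets H"
    using assms interval_subset(2)[OF assms(2,3)] by (simp_all add: rect_sets)
  have "emeasure H (B \<times> {s}) \<le> emeasure H (UNIV \<times> {s})" using m by (intro emeasure_mono) auto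
  then have z: "emeasure H (B \<times> {s}) = 0" using null_slice[OF assms(2)] by simp
  have "emeasure H (B \<times> {s..t}) = emeasure H (B \<times> {s}) + emeasure H (B \<times> {s<..t})"
    unfolding e using m by (intro plus_emeasure[symmetric]) auto
  then show ?thesis using z emeasure_H[OF assms] by simp
qed

text \<open>All estimates below come from this bound: the strip over \<open>[s, t]\<close> has measure \<open>mass t - mass s\<close>, and these
  increments add up to a bounded quantity over any partition.\<close>

lemma set_integrable_H:
  fixes f :: "real \<times> real \<Rightarrow> 'b::{banach, second_countable_topology}"
  assumes f: "(\<lambda>p. indicator (UNIV \<times> {s..t}) p *\<^sub>R f p) \<in> borel_measurable borel"
    and st: "s \<in> I" "t \<in> I" "s \<le> t" and bd: "\<And>x r. r \<in> {s..t} \<Longrightarrow> norm (f (x, r)) \<le> B"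
  shows "set_integrable H (UNIV \<times> {s..t}) f"
    and "norm (set_lebesgue_integral H (UNIV \<times> {s..t}) f) \<le> B * (mass t - mass s)"
proof -
  let ?A = "UNIV \<times> {s..t} :: (real \<times> real) set"
  have A: "?A \<in> sets H" "emeasure H ?A = ennreal (mass t - mass s)"
    using st interval_subset emeasure_H_closed[of UNIV s t] by (auto intro!: rect_sets simp: mass_def)
  have B0: "0 \<le> B" using order_trans[OF norm_ge_zero bd[of s 0]] st by simp
  have i: "integrable H (\<lambda>p. indicator ?A p *\<^sub>R B)"
    using A by (intro integrable_scaleR_left integrable_real_indicator) auto
  have le: "norm (indicator ?A p *\<^sub>R f p) \<le> indicator ?A p *\<^sub>R B" for p
    using bd by (cases p) (auto simp: indicator_def)
  have int: "integrable H (\<lambda>p. indicator ?A p *\<^sub>R f p)"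
  proof (rule Bochner_Integration.integrable_bound[OF i measurable_H[OF f] AE_I2])
    fix p show "norm (indicator ?A p *\<^sub>R f p) \<le> norm (indicator ?A p *\<^sub>R B)"
      using le[of p] by (rule order_trans) simp
  qed
  then show "set_integrable H ?A f" by (simp add: set_integrable_def)
  have "norm (set_lebesgue_integral H ?A f) \<le> (\<integral>p. norm (indicator ?A p *\<^sub>R f p) \<partial>H)"
    unfolding set_lebesgue_integral_def by (rule integral_norm_bound)
  also have "\<dots> \<le> (\<integral>p. indicator ?A p *\<^sub>R B \<partial>H)"
    by (intro integral_mono integrable_norm int i le)
  also have "\<dots> = measure H ?A * B"
    using A by simp
  also have "measure H ?A = mass t - mass s"
    using A(2) mass_mono[OF st] by (simp add: measure_def)
  finally show "norm (set_lebesgue_integral H ?A f) \<le> B * (mass t - mass s)" by (simp add: mult.commute)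
qed

text \<open>Because \<open>\<eta>\<^sub>0 = 0\<close>, the measure \<open>\<eta>\<^sub>t\<close> is a marginal of the measure on the strip over \<open>[0, t]\<close>; integrals over
  strips thereby become differences of integrals against \<open>\<eta>\<close>.\<close>

lemma eta_eq_distr:
  assumes "t \<in> I"
  shows "distr (restrict_space H (UNIV \<times> {0..t})) borel fst = \<eta> t"
proof (rule measure_eqI)
  interpret e: finite_borel_measure "\<eta> t" by (rule fin_eta[OF assms])
  show "sets (distr (restrict_space H (UNIV \<times> {0..t})) borel fst) = sets (\<eta> t)"
    using e.M_is_borel by simp
  fix B assume "B \<in> sets (distr (restrict_space H (UNIV \<times> {0..t})) borel fst)"
  then have B: "B \<in> sets borel" by simp
  have A: "UNIV \<times> {0..t} \<inter> space H \<in> sets H"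
    using interval_subset[OF zero_in assms] by (intro sets.Int rect_sets) auto
  have f: "fst \<in> borel_measurable (restrict_space H (UNIV \<times> {0..t}))"
    by (intro measurable_restrict_space1 measurable_H) (simp add: borel_prod[symmetric])
  have e: "fst -` B \<inter> space (restrict_space H (UNIV \<times> {0..t})) = B \<times> {0..t}"
    using interval_subset[OF zero_in assms] by (auto simp: space_restrict_space space_H)
  have "emeasure (distr (restrict_space H (UNIV \<times> {0..t})) borel fst) B = emeasure H (B \<times> {0..t})"
    using f B A by (simp add: emeasure_distr e emeasure_restrict_space Times_subset_cancel2 Sigma_mono)
  also have "\<dots> = ennreal (measure (\<eta> t) B)"
    using emeasure_H_closed[OF B zero_in assms] nonneg_time[OF assms] by (simp add: eta_0)
  also have "\<dots> = emeasure (\<eta> t) B" by (simp add: e.emeasure_eq_measure)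
  finally show "emeasure (distr (restrict_space H (UNIV \<times> {0..t})) borel fst) B = emeasure (\<eta> t) B" .
qed

lemma integral_eta:
  fixes h :: "real \<Rightarrow> 'b::{banach, second_countable_topology}"
  assumes t: "t \<in> I" and h: "h \<in> borel_measurable borel"
  shows "(\<integral>x. h x \<partial>\<eta> t) = set_lebesgue_integral H (UNIV \<times> {0..t}) (\<lambda>p. h (fst p))"
proof -
  have f: "fst \<in> borel_measurable (restrict_space H (UNIV \<times> {0..t}))"
    by (intro measurable_restrict_space1 measurable_H) (simp add: borel_prod[symmetric])
  have A: "UNIV \<times> {0..t} \<inter> space H \<in> sets H"
    using interval_subset[OF zero_in t] by (intro sets.Int rect_sets) auto
  have "(\<integral>x. h x \<partial>\<eta> t) = (\<integral>p. h (fst p) \<partial>restrict_space H (UNIV \<times> {0..t}))"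
    by (subst eta_eq_distr[OF t, symmetric]) (rule integral_distr[OF f h])
  then show ?thesis
    using integral_restrict_space[OF A, of "\<lambda>p. h (fst p)"] by (simp only: set_lebesgue_integral_def)
qed

lemma measurable_fst_indicator:
  fixes h :: "real \<Rightarrow> 'b::{banach, second_countable_topology}"
  assumes "h \<in> borel_measurable borel"
  shows "(\<lambda>p::real\<times>real. indicator (UNIV \<times> {s..t}) p *\<^sub>R h (fst p)) \<in> borel_measurable borel"
proof -
  have 1: "(\<lambda>p::real\<times>real. h (fst p)) \<in> borel_measurable borel"
    by (rule measurable_compose[OF _ assms]) (simp add: borel_prod[symmetric])
  have 2: "UNIV \<times> {s..t} \<in> sets (borel :: (real\<times>real) measure)" by (intro borel_Times) auto
  show ?thesis using 1 2 by (intro borel_measurable_scaleR borel_measurable_indicator)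
qed

lemma integral_eta_diff:
  fixes h :: "real \<Rightarrow> 'b::{banach, second_countable_topology}"
  assumes st: "s \<in> I" "t \<in> I" "s \<le> t" and h: "h \<in> borel_measurable borel" "\<And>x. norm (h x) \<le> B"
  shows "set_lebesgue_integral H (UNIV \<times> {s..t}) (\<lambda>p. h (fst p)) = (\<integral>x. h x \<partial>\<eta> t) - (\<integral>x. h x \<partial>\<eta> s)"
    and "set_integrable H (UNIV \<times> {s..t}) (\<lambda>p. h (fst p))"
    and "norm ((\<integral>x. h x \<partial>\<eta> t) - (\<integral>x. h x \<partial>\<eta> s)) \<le> B * (mass t - mass s)"
proof -
  have i: "set_integrable H (UNIV \<times> {a..b}) (\<lambda>p. h (fst p))" if "a \<in> I" "b \<in> I" "a \<le> b" for a b
    using h by (intro set_integrable_H(1)[OF measurable_fst_indicator that]) auto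
  show "set_integrable H (UNIV \<times> {s..t}) (\<lambda>p. h (fst p))" by (rule i[OF st])
  have u: "UNIV \<times> {0..t} = (UNIV \<times> {0..s}) \<union> (UNIV \<times> {s..t})"
    using st(3) nonneg_time[OF st(1)] by auto
  have ae: "AE p in H. \<not> (p \<in> UNIV \<times> {0..s} \<and> p \<in> UNIV \<times> {s..t})"
    by (rule AE_I[where N = "UNIV \<times> {s}"]) (use st null_slice in \<open>auto intro!: rect_sets\<close>)
  have "set_lebesgue_integral H (UNIV \<times> {0..t}) (\<lambda>p. h (fst p)) =
      set_lebesgue_integral H (UNIV \<times> {0..s}) (\<lambda>p. h (fst p)) + set_lebesgue_integral H (UNIV \<times> {s..t}) (\<lambda>p. h (fst p))"
    unfolding u using st nonneg_time interval_subset zero_in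
    by (intro set_integral_Un_AE[OF ae] rect_sets i) auto
  then show e: "set_lebesgue_integral H (UNIV \<times> {s..t}) (\<lambda>p. h (fst p)) = (\<integral>x. h x \<partial>\<eta> t) - (\<integral>x. h x \<partial>\<eta> s)"
    by (simp add: integral_eta[OF st(1) h(1)] integral_eta[OF st(2) h(1)])
  show "norm ((\<integral>x. h x \<partial>\<eta> t) - (\<integral>x. h x \<partial>\<eta> s)) \<le> B * (mass t - mass s)"
    unfolding e[symmetric] using h by (intro set_integrable_H(2)[OF measurable_fst_indicator st]) auto
qed

end

section \<open>The integral equation on short time intervals\<close>

lemma F_class_props:
  assumes "f \<in> F_class" "z \<in> \<complex>\<^sup>+"
  shows "Im (f z) \<ge> Im z" "f z \<in> \<complex>\<^sup>+"
proof -
  obtain \<mu> where \<mu>: "real_distribution \<mu>" "f z = F_transform \<mu> z"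
    using assms unfolding F_class_def by auto
  show "Im (f z) \<ge> Im z" using F_transform_Im_ge(2)[OF \<mu>(1)] assms(2) by (simp add: \<mu>(2) UHP_iff)
  then show "f z \<in> \<complex>\<^sup>+" using assms(2) by (simp add: UHP_iff)
qed

lemma continuous_Cauchy_transform:
  assumes "finite_borel_measure \<mu>"
  shows "continuous_on \<complex>\<^sup>+ (Cauchy_transform \<mu>)"
  unfolding continuous_on_sequentially
proof (intro allI ballI impI)
  fix x :: "nat \<Rightarrow> complex" and a assume a: "a \<in> \<complex>\<^sup>+" and x: "(\<forall>n. x n \<in> \<complex>\<^sup>+) \<and> x \<longlonglongrightarrow> a"
  have "weak_conv_finite (\<lambda>_. \<mu>) \<mu>" by (simp add: weak_conv_finite_def)
  then show "(Cauchy_transform \<mu> \<circ> x) \<longlonglongrightarrow> Cauchy_transform \<mu> a"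
    unfolding comp_def by (rule Cauchy_transform_tendsto) (use assms a x in \<open>auto simp: UHP_iff\<close>)
qed

lemma continuous_F_class:
  assumes "f \<in> F_class"
  shows "continuous_on \<complex>\<^sup>+ f"
proof -
  obtain \<mu> where \<mu>: "real_distribution \<mu>" "\<And>z. z \<in> \<complex>\<^sup>+ \<Longrightarrow> f z = 1 / Cauchy_transform \<mu> z"
    using assms unfolding F_class_def F_transform_def by auto
  have "continuous_on \<complex>\<^sup>+ (\<lambda>z. 1 / Cauchy_transform \<mu> z)"
    using F_transform_Im_ge(1)[OF \<mu>(1)] real_distribution.finite_borel_measure_M[OF \<mu>(1)]
    by (intro continuous_intros continuous_Cauchy_transform) (auto simp: UHP_iff)
  then show ?thesis using \<mu>(2) by (simp cong: continuous_on_cong)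
qed

lemma loc_unif_continuous_on_sequentially:
  fixes f :: "'a::metric_space \<Rightarrow> complex \<Rightarrow> complex"
  assumes f: "loc_unif_continuous_on S f" and K: "compact K" "K \<subseteq> \<complex>\<^sup>+"
    and \<tau>: "\<And>n. \<tau> n \<in> S" "l \<in> S" "\<tau> \<longlonglongrightarrow> l"
  shows "uniform_limit K (\<lambda>n. f (\<tau> n)) (f l) sequentially"
proof (rule uniform_limitI)
  fix e :: real assume e: "e > 0"
  have "uniform_limit K f (f l) (at l within S)"
    using f K \<tau>(2) unfolding loc_unif_continuous_on_def by blast
  from uniform_limitD[OF this e] obtain d where d: "d > 0"
    "\<And>\<sigma>. \<sigma> \<in> S \<Longrightarrow> \<sigma> \<noteq> l \<Longrightarrow> dist \<sigma> l < d \<Longrightarrow> \<forall>x\<in>K. dist (f \<sigma> x) (f l x) < e"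
    unfolding eventually_at by blast
  have "\<forall>\<^sub>F n in sequentially. dist (\<tau> n) l < d" by (rule tendstoD[OF \<tau>(3) d(1)])
  then show "\<forall>\<^sub>F n in sequentially. \<forall>x\<in>K. dist (f (\<tau> n) x) (f l x) < e"
  proof eventually_elim
    case (elim n)
    show ?case
    proof (cases "\<tau> n = l")
      case True then show ?thesis using e by simp
    next
      case False then show ?thesis using d(2)[OF \<tau>(1) False elim] by simp
    qed
  qed
qed

text \<open>Turns continuity in time for locally uniform convergence into joint continuity in space and time.\<close>

lemma loc_unif_joint_continuous:
  fixes f :: "'a::metric_space \<Rightarrow> complex \<Rightarrow> complex"
  assumes f: "loc_unif_continuous_on S f" and c: "\<And>\<tau>. \<tau> \<in> S \<Longrightarrow> continuous_on \<complex>\<^sup>+ (f \<tau>)"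
  shows "continuous_on (\<complex>\<^sup>+ \<times> S) (\<lambda>(z, \<tau>). f \<tau> z)"
  unfolding continuous_on_sequentially
proof (intro allI ballI impI)
  fix x :: "nat \<Rightarrow> complex \<times> 'a" and a assume a: "a \<in> \<complex>\<^sup>+ \<times> S" and x: "(\<forall>n. x n \<in> \<complex>\<^sup>+ \<times> S) \<and> x \<longlonglongrightarrow> a"
  define z where "z = (\<lambda>n. fst (x n))"
  define \<tau> where "\<tau> = (\<lambda>n. snd (x n))"
  have z: "z n \<in> \<complex>\<^sup>+" "\<tau> n \<in> S" for n using x by (auto simp: z_def \<tau>_def mem_Times_iff)
  have l: "fst a \<in> \<complex>\<^sup>+" "snd a \<in> S" "z \<longlonglongrightarrow> fst a" "\<tau> \<longlonglongrightarrow> snd a"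
    using a x by (auto simp: z_def \<tau>_def mem_Times_iff intro: tendsto_fst tendsto_snd)
  define K where "K = insert (fst a) (range z)"
  have K: "compact K" "K \<subseteq> \<complex>\<^sup>+" unfolding K_def using compact_insert_limit[OF l(3)] z l by auto
  have 1: "uniform_limit K (\<lambda>n. f (\<tau> n)) (f (snd a)) sequentially"
    by (rule loc_unif_continuous_on_sequentially[OF f K z(2) l(2,4)])
  have 2: "(\<lambda>n. f (snd a) (z n)) \<longlonglongrightarrow> f (snd a) (fst a)"
    using c[OF l(2), unfolded continuous_on_sequentially, rule_format, of "fst a" z] l z by (simp add: o_def)
  have "(\<lambda>n. f (\<tau> n) (z n) - f (snd a) (z n)) \<longlonglongrightarrow> 0"
  proof (rule tendstoI)
    fix e :: real assume "e > 0"
    from uniform_limitD[OF 1 this] show "\<forall>\<^sub>F n in sequentially. dist (f (\<tau> n) (z n) - f (snd a) (z n)) 0 < e"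
      by eventually_elim (simp add: K_def dist_norm)
  qed
  from tendsto_add[OF this 2] have "(\<lambda>n. f (\<tau> n) (z n)) \<longlonglongrightarrow> f (snd a) (fst a)" by simp
  then show "((\<lambda>(z, \<tau>). f \<tau> z) \<circ> x) \<longlonglongrightarrow> (\<lambda>(z, \<tau>). f \<tau> z) a"
    by (simp add: comp_def split_def z_def \<tau>_def)
qed

locale REF = generator_with_measure +
  fixes g :: "real \<times> real \<Rightarrow> complex \<Rightarrow> complex"
  assumes ref: "P_REF I g"
    and integral_eq: "\<forall>(s, t)\<in>time_pairs I. \<forall>z\<in>\<complex>\<^sup>+.
          g (s, t) z = z + complex_of_real (\<gamma> s) - complex_of_real (\<gamma> t) +
            (CLINT p:UNIV \<times> {s..t}|H.
               (case p of (x, r) \<Rightarrow>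
                  (1 + complex_of_real x * g (r, t) z) / (complex_of_real x - g (r, t) z)))"
begin

text \<open>The function \<open>\<Phi>\<^sub>t\<close> of the introduction.  Its increments in \<open>t\<close> are what the integral equation would give if the
  flow stood still.\<close>

definition drift :: "real \<Rightarrow> complex \<Rightarrow> complex" where
  "drift t w = (CLINT x|\<eta> t. nev_kernel w x) - complex_of_real (\<gamma> t)"

lemma pairs: "(s, t) \<in> time_pairs I \<longleftrightarrow> s \<in> I \<and> t \<in> I \<and> s \<le> t"
  by (simp add: time_pairs_def)

lemma g_F_class: "s \<in> I \<Longrightarrow> t \<in> I \<Longrightarrow> s \<le> t \<Longrightarrow> g (s, t) \<in> F_class"
  using ref by (auto simp: P_REF_def pairs)

lemma g_refl: "s \<in> I \<Longrightarrow> Im z > 0 \<Longrightarrow> g (s, s) z = z"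
  using ref by (auto simp: P_REF_def UHP_iff)

lemma g_comp: "s \<in> I \<Longrightarrow> t \<in> I \<Longrightarrow> u \<in> I \<Longrightarrow> s \<le> t \<Longrightarrow> t \<le> u \<Longrightarrow> Im z > 0 \<Longrightarrow> g (s, t) (g (t, u) z) = g (s, u) z"
  using ref by (auto simp: P_REF_def UHP_iff)

lemma g_Im: "s \<in> I \<Longrightarrow> t \<in> I \<Longrightarrow> s \<le> t \<Longrightarrow> Im z > 0 \<Longrightarrow> Im (g (s, t) z) \<ge> Im z"
  using F_class_props(1)[OF g_F_class] by (simp add: UHP_iff)

lemma g_joint_continuous: "continuous_on (\<complex>\<^sup>+ \<times> time_pairs I) (\<lambda>(z, \<tau>). g \<tau> z)"
  using ref by (intro loc_unif_joint_continuous continuous_F_class) (auto simp: P_REF_def)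

lemma g_continuous_left:
  assumes st: "s \<in> I" "t \<in> I" and z: "Im z > 0"
  shows "continuous_on {s..t} (\<lambda>r. g (r, t) z)"
proof -
  have "continuous_on {s..t} (\<lambda>r. (\<lambda>(z, \<tau>). g \<tau> z) (z, (r, t)))"
    by (rule continuous_on_compose2[OF g_joint_continuous])
       (use st z interval_subset(1)[OF st] in \<open>auto simp: UHP_iff pairs intro!: continuous_intros\<close>)
  then show ?thesis by simp
qed

lemma g_eq:
  assumes "s \<in> I" "t \<in> I" "s \<le> t" "Im z > 0"
  shows "g (s, t) z = z + complex_of_real (\<gamma> s) - complex_of_real (\<gamma> t) +
     set_lebesgue_integral H (UNIV \<times> {s..t}) (\<lambda>p. nev_kernel (g (snd p, t) z) (fst p))"
proof -
  have "(s, t) \<in> time_pairs I" "z \<in> \<complex>\<^sup>+" using assms by (auto simp: pairs UHP_iff)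
  then show ?thesis using integral_eq by (auto simp: nev_kernel_def split_def)
qed

lemma measurable_flow_kernel:
  assumes st: "s \<in> I" "t \<in> I" and z: "Im z > 0"
  shows "(\<lambda>p. indicator (UNIV \<times> {s..t}) p *\<^sub>R nev_kernel (g (snd p, t) z) (fst p)) \<in> borel_measurable borel"
proof (rule borel_measurable_continuous_on_indicator)
  show "UNIV \<times> {s..t} \<in> sets (borel :: (real\<times>real) measure)" by (intro borel_Times) auto
  have c: "continuous_on (UNIV \<times> {s..t}) (\<lambda>p::real\<times>real. g (snd p, t) z)"
    by (rule continuous_on_compose2[OF g_continuous_left[OF st z]]) (auto intro!: continuous_intros)
  have nz: "complex_of_real (fst p) - g (snd p, t) z \<noteq> 0" if "p \<in> UNIV \<times> {s..t}" for p
  proof -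
    have "snd p \<in> I" "snd p \<le> t" using that interval_subset(1)[OF st] by auto
    then have "Im (g (snd p, t) z) > 0" using g_Im[OF _ st(2) _ z] z by fastforce
    then show ?thesis using UHP_neq_real[of "g (snd p, t) z" "fst p"] by auto
  qed
  show "continuous_on (UNIV \<times> {s..t}) (\<lambda>p. nev_kernel (g (snd p, t) z) (fst p))"
    unfolding nev_kernel_def using nz by (intro continuous_intros c) auto
qed

text \<open>The displacement differs from the increment of the drift only because the kernel is evaluated at the moving
  point instead of at \<open>z\<close>, and the kernel is Lipschitz.\<close>

lemma one_step:
  assumes st: "s \<in> I" "t \<in> I" "s \<le> t" and d: "d > 0" "Im z \<ge> d" and R: "norm z + 1 \<le> R" and \<theta>: "\<theta> \<le> 1"
    and near: "\<And>r. r \<in> {s..t} \<Longrightarrow> norm (g (r, t) z - z) \<le> \<theta>"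
  shows "norm (g (s, t) z - z - (drift t z - drift s z)) \<le> kernel_lip d R * \<theta> * (mass t - mass s)"
proof -
  let ?A = "UNIV \<times> {s..t} :: (real \<times> real) set"
  have z: "Im z > 0" using d by linarith
  have zR: "norm z \<le> R" using R by linarith
  have mz: "nev_kernel z \<in> borel_measurable borel" by measurable
  have bz: "norm (nev_kernel z x) \<le> kernel_bound d R" for x by (rule norm_nev_kernel[OF d zR])
  have gI: "Im (g (r, t) z) \<ge> d" "norm (g (r, t) z) \<le> R" if r: "r \<in> {s..t}" for r
  proof -
    have "r \<in> I" "r \<le> t" using r interval_subset(1)[OF st(1,2)] by auto
    then show "Im (g (r, t) z) \<ge> d" using g_Im[OF _ st(2) _ z] d by fastforce
    have "norm (g (r, t) z) \<le> norm (g (r, t) z - z) + norm z" using norm_triangle_ineq[of "g (r, t) z - z" z] by simp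
    then show "norm (g (r, t) z) \<le> R" using near[OF r] \<theta> R by linarith
  qed
  have lip0: "kernel_lip d R \<ge> 0" using kernel_consts_pos[OF d(1), of R] order_trans[OF norm_ge_zero zR] by linarith
  have m1: "(\<lambda>p. indicator ?A p *\<^sub>R nev_kernel (g (snd p, t) z) (fst p)) \<in> borel_measurable borel"
    by (rule measurable_flow_kernel[OF st(1,2) z])
  have m2: "(\<lambda>p. indicator ?A p *\<^sub>R nev_kernel z (fst p)) \<in> borel_measurable borel"
    by (rule measurable_fst_indicator[OF mz])
  have m: "(\<lambda>p. indicator ?A p *\<^sub>R (nev_kernel (g (snd p, t) z) (fst p) - nev_kernel z (fst p))) \<in> borel_measurable borel"
    unfolding scaleR_diff_right by (rule borel_measurable_diff[OF m1 m2])
  have i1: "set_integrable H ?A (\<lambda>p. nev_kernel (g (snd p, t) z) (fst p))"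
    by (rule set_integrable_H(1)[OF m1 st, of "kernel_bound d R"]) (use gI d in \<open>auto intro: norm_nev_kernel\<close>)
  note i2 = integral_eta_diff[OF st mz bz]
  have "g (s, t) z - z - (drift t z - drift s z) =
      set_lebesgue_integral H ?A (\<lambda>p. nev_kernel (g (snd p, t) z) (fst p)) - set_lebesgue_integral H ?A (\<lambda>p. nev_kernel z (fst p))"
    unfolding g_eq[OF st z] i2(1) drift_def by simp
  also have "\<dots> = set_lebesgue_integral H ?A (\<lambda>p. nev_kernel (g (snd p, t) z) (fst p) - nev_kernel z (fst p))"
    by (rule set_integral_diff(2)[OF i1 i2(2), symmetric])
  finally have eq: "g (s, t) z - z - (drift t z - drift s z) =
      set_lebesgue_integral H ?A (\<lambda>p. nev_kernel (g (snd p, t) z) (fst p) - nev_kernel z (fst p))" .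
  show ?thesis unfolding eq
  proof (rule set_integrable_H(2)[OF m st])
    fix x r assume r: "r \<in> {s..t}"
    have "norm (nev_kernel (g (r, t) z) x - nev_kernel z x) \<le> kernel_lip d R * norm (g (r, t) z - z)"
      by (rule nev_kernel_lipschitz[OF d(1) gI[OF r] d(2) zR])
    also have "\<dots> \<le> kernel_lip d R * \<theta>" using near[OF r] lip0 by (intro mult_left_mono) auto
    finally show "norm (nev_kernel (g (snd (x, r), t) z) (fst (x, r)) - nev_kernel z (fst (x, r))) \<le> kernel_lip d R * \<theta>" by simp
  qed
qed

text \<open>A bootstrap: as long as the flow stays within distance \<open>1\<close> of \<open>z\<close>, the kernel is bounded by \<open>kernel_bound\<close>
  and the integral equation gives the better distance \<open>\<theta> < 1\<close>.  By continuity the distance \<open>1\<close> is never reached.\<close>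

lemma small_step_a_priori:
  assumes st: "s \<in> I" "t \<in> I" "s \<le> t" and d: "d > 0" "Im z \<ge> d" and R: "norm z + 1 \<le> R" and \<theta>: "\<theta> < 1"
    and small: "\<And>p. p \<in> {s..t} \<Longrightarrow> \<bar>\<gamma> p - \<gamma> t\<bar> + kernel_bound d R * (mass t - mass p) \<le> \<theta>"
    and r: "r \<in> {s..t}"
  shows "norm (g (r, t) z - z) \<le> \<theta>"
proof (rule ccontr)
  assume neg: "\<not> ?thesis"
  have z: "Im z > 0" using d by linarith
  define h where "h = (\<lambda>r. norm (g (r, t) z - z))"
  have hc: "continuous_on {s..t} h" unfolding h_def
    by (intro continuous_intros g_continuous_left[OF st(1,2) z])
  have ht: "h t = 0" using g_refl[OF st(2) z] by (simp add: h_def)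
  have step: "h p \<le> \<theta>" if p: "p \<in> {s..t}" and near: "\<And>q. q \<in> {p..t} \<Longrightarrow> h q \<le> 1" for p
  proof -
    have pI: "p \<in> I" "p \<le> t" using p interval_subset(1)[OF st(1,2)] by auto
    have gI: "Im (g (q, t) z) \<ge> d" "norm (g (q, t) z) \<le> R" if q: "q \<in> {p..t}" for q
    proof -
      have "q \<in> I" "q \<le> t" using q interval_subset(1)[OF pI(1) st(2)] by auto
      then show "Im (g (q, t) z) \<ge> d" using g_Im[OF _ st(2) _ z] d by fastforce
      have "norm (g (q, t) z) \<le> norm (g (q, t) z - z) + norm z" using norm_triangle_ineq[of "g (q, t) z - z" z] by simp
      then show "norm (g (q, t) z) \<le> R" using near[OF q] R unfolding h_def by linarith
    qed
    have "norm (set_lebesgue_integral H (UNIV \<times> {p..t}) (\<lambda>p. nev_kernel (g (snd p, t) z) (fst p))) \<le> kernel_bound d R * (mass t - mass p)"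
      by (rule set_integrable_H(2)[OF measurable_flow_kernel[OF pI(1) st(2) z] pI(1) st(2) pI(2)])
         (use gI d in \<open>auto intro: norm_nev_kernel\<close>)
    moreover have "g (p, t) z - z = complex_of_real (\<gamma> p - \<gamma> t) +
        set_lebesgue_integral H (UNIV \<times> {p..t}) (\<lambda>p. nev_kernel (g (snd p, t) z) (fst p))"
      by (subst g_eq[OF pI(1) st(2) pI(2) z]) simp
    ultimately have "h p \<le> \<bar>\<gamma> p - \<gamma> t\<bar> + kernel_bound d R * (mass t - mass p)"
      unfolding h_def by (simp only:) (rule order_trans[OF norm_triangle_ineq], simp only: norm_of_real add_left_mono)
    then show ?thesis using small[OF p] by linarith
  qed
  have "\<not> h r \<le> \<theta>" using neg by (simp add: h_def)
  then obtain r2 where r2: "r2 \<in> {r..t}" "h r2 > 1" using step[OF r] by (meson not_le)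
  have sub: "{r2..t} \<subseteq> {s..t}" using r r2 by auto
  have c2: "continuous_on {r2..t} h" by (rule continuous_on_subset[OF hc sub])
  define S where "S = {x \<in> {r2..t}. h x = 1}"
  have "\<exists>x. r2 \<le> x \<and> x \<le> t \<and> h x = 1"
    by (rule IVT2') (use r2 ht c2 in auto)
  then have Sne: "S \<noteq> {}" by (auto simp: S_def)
  have "closed S" unfolding S_def by (rule continuous_closed_preimage_constant[OF c2]) simp
  moreover have "bounded S" by (rule bounded_subset[OF bounded_closed_interval[of r2 t]]) (auto simp: S_def)
  ultimately have Sc: "compact S" by (simp add: compact_eq_bounded_closed)
  \<comment> \<open>The last time before \<open>t\<close> at which the distance \<open>1\<close> is attained.\<close>
  obtain r3 where r3: "r3 \<in> S" "\<And>x. x \<in> S \<Longrightarrow> x \<le> r3"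
    using compact_attains_sup[OF Sc Sne] by blast
  have "h q \<le> 1" if q: "q \<in> {r3..t}" for q
  proof (rule ccontr)
    assume "\<not> h q \<le> 1"
    then have "q > r3" using q r3 by (cases "q = r3") (auto simp: S_def)
    have "\<exists>x. q \<le> x \<and> x \<le> t \<and> h x = 1"
      by (rule IVT2') (use \<open>\<not> h q \<le> 1\<close> ht q r3 in \<open>auto simp: S_def intro: continuous_on_subset[OF c2]\<close>)
    then obtain x where "q \<le> x" "x \<le> t" "h x = 1" by blast
    then have "x \<in> S" using q r3 by (auto simp: S_def)
    then show False using r3(2)[of x] \<open>q \<le> x\<close> \<open>q > r3\<close> by linarith
  qed
  then have "h r3 \<le> \<theta>" using r3 sub by (intro step) (auto simp: S_def)
  then show False using r3 \<theta> by (auto simp: S_def)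
qed

text \<open>The drift is an affine function of the Cauchy transform of \<open>\<eta>\<^sub>t\<close>, with a factor that vanishes at \<open>\<i>\<close>.  The values
  away from \<open>\<i>\<close> therefore determine \<open>\<eta>\<^sub>t\<close>, and the value at \<open>\<i>\<close> isolates the total mass and \<open>\<gamma>\<^sub>t\<close>.\<close>

lemma drift_resolvent:
  assumes "t \<in> I" "Im w > 0"
  shows "drift t w = w * mass t - (1 + w\<^sup>2) * Cauchy_transform (\<eta> t) w - complex_of_real (\<gamma> t)"
proof -
  interpret e: finite_borel_measure "\<eta> t" by (rule fin_eta[OF assms(1)])
  have "(CLINT x|\<eta> t. nev_kernel w x) = (CLINT x|\<eta> t. w - (1 + w\<^sup>2) * (1 / (w - complex_of_real x)))"
    by (simp only: nev_kernel_resolvent[OF assms(2)])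
  also have "\<dots> = (CLINT x|\<eta> t. w) - (CLINT x|\<eta> t. (1 + w\<^sup>2) * (1 / (w - complex_of_real x)))"
    by (intro Bochner_Integration.integral_diff integrable_mult_right integrable_resolvent fin_eta assms) simp
  also have "\<dots> = (CLINT x|\<eta> t. w) - (1 + w\<^sup>2) * Cauchy_transform (\<eta> t) w"
    by (simp only: Bochner_Integration.integral_mult_right_zero Cauchy_transform_def)
  finally show ?thesis
    by (simp add: drift_def mass_def e.borel_UNIV scaleR_conv_of_real mult.commute)
qed

lemma drift_i: "t \<in> I \<Longrightarrow> drift t \<i> = \<i> * mass t - complex_of_real (\<gamma> t)"
  by (simp add: drift_resolvent)

lemma drift_0: "drift 0 w = 0"
  by (simp add: drift_def eta_0 gamma_0)

lemma drift_diff_lipschitz: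
  assumes st: "s \<in> I" "t \<in> I" "s \<le> t" and d: "d > 0" "Im w \<ge> d" "norm w \<le> R" "Im v \<ge> d" "norm v \<le> R"
  shows "norm ((drift t w - drift s w) - (drift t v - drift s v)) \<le> kernel_lip d R * norm (w - v) * (mass t - mass s)"
proof -
  have i: "integrable (\<eta> r) (nev_kernel u)" if "r \<in> I" "Im u \<ge> d" "norm u \<le> R" for r u
    by (rule finite_borel_measure.integrable_bounded[OF fin_eta[OF that(1)] measurable_nev_kernel norm_nev_kernel[OF d(1) that(2,3)]])
  have eq: "(drift t w - drift s w) - (drift t v - drift s v) =
     (CLINT x|\<eta> t. nev_kernel w x - nev_kernel v x) - (CLINT x|\<eta> s. nev_kernel w x - nev_kernel v x)"
    unfolding drift_def by (simp add: Bochner_Integration.integral_diff i st d)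
  show ?thesis unfolding eq
  proof (rule integral_eta_diff(3)[OF st])
    show "(\<lambda>x. nev_kernel w x - nev_kernel v x) \<in> borel_measurable borel" by measurable
    show "norm (nev_kernel w x - nev_kernel v x) \<le> kernel_lip d R * norm (w - v)" for x
      by (rule nev_kernel_lipschitz[OF d(1,2,3,4,5)])
  qed
qed

lemma weakly_continuous_eta: "weakly_continuous_on I \<eta>"
  unfolding weakly_continuous_on_def
proof (intro allI impI, elim conjE)
  fix f :: "real \<Rightarrow> real" assume f: "continuous_on UNIV f" "bounded (range f)"
  then obtain B where B: "\<And>x. norm (f x) \<le> B" by (auto simp: bounded_iff)
  have m: "f \<in> borel_measurable borel" using f by (simp add: borel_measurable_continuous_onI)
  have B0: "0 \<le> B" using order_trans[OF norm_ge_zero B] .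
  have lip: "norm ((\<integral>x. f x \<partial>\<eta> t) - (\<integral>x. f x \<partial>\<eta> s)) \<le> B * \<bar>mass t - mass s\<bar>" if "s \<in> I" "t \<in> I" for s t
  proof (cases "s \<le> t")
    case True
    then show ?thesis using integral_eta_diff(3)[OF that True m B] mass_mono[OF that True] by simp
  next
    case False
    then have "t \<le> s" by simp
    then show ?thesis using integral_eta_diff(3)[OF that(2,1) _ m B] mass_mono[OF that(2,1)]
      by (simp add: norm_minus_commute abs_minus_commute del: real_norm_def)
  qed
  show "continuous_on I (\<lambda>\<tau>. \<integral>x. f x \<partial>\<eta> \<tau>)"
    unfolding continuous_on_sequentially
  proof (intro allI ballI impI)
    fix x :: "nat \<Rightarrow> real" and a assume a: "a \<in> I" and x: "(\<forall>n. x n \<in> I) \<and> x \<longlonglongrightarrow> a"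
    have "(\<lambda>n. mass (x n)) \<longlonglongrightarrow> mass a"
      using continuous_mass[unfolded continuous_on_sequentially, rule_format, of a x] a x by (simp add: o_def)
    then have "(\<lambda>n. B * \<bar>mass (x n) - mass a\<bar>) \<longlonglongrightarrow> B * \<bar>mass a - mass a\<bar>" by (intro tendsto_intros)
    then have "(\<lambda>n. B * \<bar>mass (x n) - mass a\<bar>) \<longlonglongrightarrow> 0" by simp
    then have "(\<lambda>n. (\<integral>y. f y \<partial>\<eta> (x n)) - (\<integral>y. f y \<partial>\<eta> a)) \<longlonglongrightarrow> 0"
      by (rule Lim_null_comparison[rotated]) (use lip[OF a] x in simp)
    then show "((\<lambda>\<tau>. \<integral>y. f y \<partial>\<eta> \<tau>) \<circ> x) \<longlonglongrightarrow> (\<integral>y. f y \<partial>\<eta> a)"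
      unfolding comp_def by (rule LIM_zero_cancel)
  qed
qed

text \<open>The errors of the single steps are proportional to increments of the mass and sum to at most
  \<open>kernel_lip d R * \<theta> * mass t\<close>, however fine the partition is.\<close>

lemma telescoping_sum:
  assumes t: "t \<in> I" and P: "P > 0" and d: "d > 0" "Im z \<ge> d" and R: "norm z + 1 \<le> R" and \<theta>: "\<theta> \<le> 1"
    and near: "\<And>r q. 0 \<le> r \<Longrightarrow> r \<le> q \<Longrightarrow> q \<le> t \<Longrightarrow> q - r \<le> t / real P \<Longrightarrow> norm (g (r, q) z - z) \<le> \<theta>"
  shows "norm (drift t z - (\<Sum>j<P. g (real j * t / real P, real (Suc j) * t / real P) z - z)) \<le> kernel_lip d R * \<theta> * mass t"
proof -
  define u where "u = (\<lambda>j. real j * t / real P)"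
  have t0: "t \<ge> 0" by (rule nonneg_time[OF t])
  have u: "0 \<le> u j" "u j \<le> u (Suc j)" "u (Suc j) - u j = t / real P" for j
    using t0 P by (auto simp: u_def field_simps)
  have uI: "u j \<in> I" "u j \<le> t" if "j \<le> P" for j
  proof -
    have "real j * t \<le> real P * t" using that t0 by (intro mult_right_mono) auto
    then show "u j \<le> t" using P by (simp add: u_def field_simps)
    then show "u j \<in> I" by (rule down_closed[OF t u(1)])
  qed
  have uP: "u P = t" "u 0 = 0" using P by (simp_all add: u_def)
  have tel: "drift t z = (\<Sum>j<P. drift (u (Suc j)) z - drift (u j) z)"
    by (simp only: sum_lessThan_telescope[of "\<lambda>j. drift (u j) z"] uP drift_0 diff_0_right)
  have telm: "mass t = (\<Sum>j<P. mass (u (Suc j)) - mass (u j))"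
    by (simp only: sum_lessThan_telescope[of "\<lambda>j. mass (u j)"] uP mass_0 diff_0_right)
  have "norm (drift t z - (\<Sum>j<P. g (u j, u (Suc j)) z - z)) = norm (\<Sum>j<P. g (u j, u (Suc j)) z - z - (drift (u (Suc j)) z - drift (u j) z))"
    unfolding tel by (subst norm_minus_commute) (simp only: sum_subtractf)
  also have "\<dots> \<le> (\<Sum>j<P. kernel_lip d R * \<theta> * (mass (u (Suc j)) - mass (u j)))"
  proof (rule sum_norm_le)
    fix j assume "j \<in> {..<P}"
    then have j: "j \<le> P" "Suc j \<le> P" by auto
    show "norm (g (u j, u (Suc j)) z - z - (drift (u (Suc j)) z - drift (u j) z)) \<le> kernel_lip d R * \<theta> * (mass (u (Suc j)) - mass (u j))"
    proof (rule one_step[OF uI(1)[OF j(1)] uI(1)[OF j(2)] u(2) d R \<theta>])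
      fix r assume "r \<in> {u j..u (Suc j)}"
      then show "norm (g (r, u (Suc j)) z - z) \<le> \<theta>"
        using u(1)[of j] u(3)[of j] uI(2)[OF j(2)] by (intro near) auto
    qed
  qed
  also have "\<dots> = kernel_lip d R * \<theta> * mass t" unfolding telm by (rule sum_distrib_left[symmetric])
  finally show ?thesis unfolding u_def .
qed

end

text \<open>Both flows are followed backwards from \<open>t\<close> through \<open>P\<close> equal steps.  In each step the distance \<open>\<delta>\<close> of the two
  orbits grows to at most \<open>(1 + L \<Delta>N') \<delta> + 2 \<epsilon> + L \<theta> (\<Delta>N + \<Delta>N')\<close>, where \<open>\<Delta>N\<close> and \<open>\<Delta>N'\<close> are the increments of
  the masses: the first term is the Lipschitz bound for the drift, the second the difference of the two drifts and the
  third the error of \<open>one_step\<close>.  The orbit of the second flow stays in the region \<open>|w| \<le> R\<close> because the bound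
  just obtained is at most \<open>1\<close>; this is why the total bound \<open>T\<close> is required to be at most \<open>1\<close> and the first orbit is kept
  within radius \<open>R - 2\<close>.\<close>

lemma euler_comparison:
  assumes A: "REF I \<gamma> \<eta> H g" and B: "REF I \<gamma>' \<eta>' H' g'"
    and d: "d > 0" "Im z \<ge> d" and b: "b \<in> I" and P: "P > 0" and \<theta>: "0 \<le> \<theta>" "\<theta> < 1" and eps: "\<epsilon> \<ge> 0"
    and st: "0 \<le> s" "s \<le> t" "t \<le> b"
    and smallA: "\<And>p q. 0 \<le> p \<Longrightarrow> p \<le> q \<Longrightarrow> q \<le> b \<Longrightarrow> q - p \<le> b / real P \<Longrightarrow>
        \<bar>\<gamma> p - \<gamma> q\<bar> + kernel_bound d R * (measure (\<eta> q) UNIV - measure (\<eta> p) UNIV) \<le> \<theta>"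
    and smallB: "\<And>p q. 0 \<le> p \<Longrightarrow> p \<le> q \<Longrightarrow> q \<le> b \<Longrightarrow> q - p \<le> b / real P \<Longrightarrow>
        \<bar>\<gamma>' p - \<gamma>' q\<bar> + kernel_bound d R * (measure (\<eta>' q) UNIV - measure (\<eta>' p) UNIV) \<le> \<theta>"
    and close: "\<And>t w. 0 \<le> t \<Longrightarrow> t \<le> b \<Longrightarrow> Im w \<ge> d \<Longrightarrow> norm w \<le> R \<Longrightarrow>
        norm (REF.drift \<gamma>' \<eta>' t w - REF.drift \<gamma> \<eta> t w) \<le> \<epsilon>"
    and orbit: "\<And>r. s \<le> r \<Longrightarrow> r \<le> t \<Longrightarrow> norm (g (r, t) z) \<le> R - 2"
    and total: "exp (kernel_lip d R * measure (\<eta>' b) UNIV) *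
        (2 * \<epsilon> * real P + kernel_lip d R * \<theta> * (measure (\<eta> b) UNIV + measure (\<eta>' b) UNIV)) \<le> T" and T: "T \<le> 1"
  shows "norm (g' (s, t) z - g (s, t) z) \<le> T"
proof -
  interpret A: REF I \<gamma> \<eta> H g by (rule A)
  interpret B: REF I \<gamma>' \<eta>' H' g' by (rule B)
  define L where "L = kernel_lip d R"
  note mass = A.mass_def[symmetric] B.mass_def[symmetric]
  have zp: "Im z > 0" using d by linarith
  have I: "r \<in> I" if "0 \<le> r" "r \<le> b" for r using A.down_closed[OF b that] .
  have tI: "t \<in> I" "s \<in> I" using st by (auto intro: I)
  have b0: "b \<ge> 0" using st by linarith
  have R2: "R \<ge> 2" using order_trans[OF norm_ge_zero orbit[OF st(2) order_refl]] by linarith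
  then have L: "L \<ge> 1" "L \<ge> 0" using kernel_consts_pos[OF d(1), of R] by (auto simp: L_def)
  define u where "u = (\<lambda>j. t - real j * (t - s) / real P)"
  have u_dec: "u (Suc j) \<le> u j" "u j \<le> t" for j
  proof -
    have "u (Suc j) = u j - (t - s) / real P" using P by (simp add: u_def field_simps)
    then show "u (Suc j) \<le> u j" using st P by simp
    show "u j \<le> t" using st P by (simp add: u_def)
  qed
  have u_step: "u j - u (Suc j) \<le> b / real P" for j
  proof -
    have "u j - u (Suc j) = (t - s) / real P" using P by (simp add: u_def field_simps)
    also have "\<dots> \<le> b / real P" using st P by (intro divide_right_mono) auto
    finally show ?thesis .
  qed
  have u_ge: "s \<le> u j" if "j \<le> P" for j
  proof -
    have "real j * (t - s) \<le> real P * (t - s)" using that st by (intro mult_right_mono) auto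
    then have "real j * (t - s) / real P \<le> t - s" using P by (simp add: field_simps)
    then show ?thesis by (simp add: u_def)
  qed
  have u0: "u 0 = t" and uP: "u P = s" using P by (auto simp: u_def)
  have uI: "u j \<in> I" if "j \<le> P" for j using u_ge[OF that] u_dec(2)[of j] st by (intro I) auto
  \<comment> \<open>The bound that the recursion for the distance of the orbits propagates.\<close>
  define \<beta> where "\<beta> = (\<lambda>j. exp (L * (B.mass t - B.mass (u j))) * (2 * \<epsilon> * real j + L * \<theta> * ((A.mass t - A.mass (u j)) + (B.mass t - B.mass (u j)))))"
  have \<beta>_le: "\<beta> j \<le> T" if j: "j \<le> P" for j
  proof -
    have m: "A.mass t \<le> A.mass b" "B.mass t \<le> B.mass b" "A.mass (u j) \<le> A.mass t" "B.mass (u j) \<le> B.mass t"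
      using A.mass_mono[OF tI(1) b st(3)] B.mass_mono[OF tI(1) b st(3)]
        A.mass_mono[OF uI[OF j] tI(1) u_dec(2)] B.mass_mono[OF uI[OF j] tI(1) u_dec(2)] by auto
    have "\<beta> j \<le> exp (L * B.mass b) * (2 * \<epsilon> * real P + L * \<theta> * (A.mass b + B.mass b))"
      unfolding \<beta>_def
    proof (rule mult_mono)
      show "exp (L * (B.mass t - B.mass (u j))) \<le> exp (L * B.mass b)"
        using m B.mass_nonneg[of "u j"] L by (simp add: mult_left_mono)
      show "2 * \<epsilon> * real j + L * \<theta> * ((A.mass t - A.mass (u j)) + (B.mass t - B.mass (u j))) \<le> 2 * \<epsilon> * real P + L * \<theta> * (A.mass b + B.mass b)"
        using m A.mass_nonneg[of "u j"] B.mass_nonneg[of "u j"] L \<theta> eps j by (intro add_mono mult_left_mono) auto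
      show "0 \<le> 2 * \<epsilon> * real j + L * \<theta> * ((A.mass t - A.mass (u j)) + (B.mass t - B.mass (u j)))"
        using m L \<theta> eps by (intro add_nonneg_nonneg mult_nonneg_nonneg) auto
    qed simp
    then show ?thesis using total unfolding mass L_def by linarith
  qed
  have main: "j \<le> P \<Longrightarrow> norm (g' (u j, t) z - g (u j, t) z) \<le> \<beta> j" for j
  proof (induction j)
    case 0
    then show ?case using A.g_refl[OF tI(1) zp] B.g_refl[OF tI(1) zp] by (simp add: u0 \<beta>_def)
  next
    case (Suc j)
    then have j: "j \<le> P" "Suc j \<le> P" by auto
    define a where "a = u (Suc j)"
    define c where "c = u j"
    define w where "w = g (c, t) z"
    define v where "v = g' (c, t) z"
    have IH: "norm (v - w) \<le> \<beta> j" using Suc.IH[OF j(1)] by (simp add: v_def w_def c_def)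
    have ac: "a \<in> I" "c \<in> I" "a \<le> c" "c \<le> t" "s \<le> a" "s \<le> c"
      using uI[OF j(1)] uI[OF j(2)] u_dec u_ge[OF j(1)] u_ge[OF j(2)] by (auto simp: a_def c_def)
    have wz: "Im w \<ge> d" "norm w \<le> R - 2"
      using A.g_Im[OF ac(2) tI(1) ac(4) zp] d orbit[OF ac(6,4)] by (auto simp: w_def)
    have vz: "Im v \<ge> d" using B.g_Im[OF ac(2) tI(1) ac(4) zp] d by (auto simp: v_def)
    have vw: "norm (v - w) \<le> 1" using IH \<beta>_le[OF j(1)] T by linarith
    then have vR: "norm v \<le> R - 1" using wz norm_triangle_ineq[of "v - w" w] by simp
    have mesh: "0 \<le> p \<and> p \<le> c \<and> c \<le> b \<and> c - p \<le> b / real P" if "p \<in> {a..c}" for p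
      using that ac st u_step[of j] by (auto simp: a_def c_def)
    have nA: "norm (g (r, c) w - w) \<le> \<theta>" if r: "r \<in> {a..c}" for r
    proof (rule A.small_step_a_priori[OF ac(1-3) d(1) wz(1) _ \<theta>(2) _ r, of R])
      show "norm w + 1 \<le> R" using wz(2) by linarith
    next
      fix p assume "p \<in> {a..c}"
      then have "0 \<le> p" "p \<le> c" "c \<le> b" "c - p \<le> b / real P" using mesh by blast+
      from smallA[OF this] show "\<bar>\<gamma> p - \<gamma> c\<bar> + kernel_bound d R * (A.mass c - A.mass p) \<le> \<theta>" unfolding A.mass_def .
    qed
    have nB: "norm (g' (r, c) v - v) \<le> \<theta>" if r: "r \<in> {a..c}" for r
    proof (rule B.small_step_a_priori[OF ac(1-3) d(1) vz _ \<theta>(2) _ r, of R])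
      show "norm v + 1 \<le> R" using vR by linarith
    next
      fix p assume "p \<in> {a..c}"
      then have "0 \<le> p" "p \<le> c" "c \<le> b" "c - p \<le> b / real P" using mesh by blast+
      from smallB[OF this] show "\<bar>\<gamma>' p - \<gamma>' c\<bar> + kernel_bound d R * (B.mass c - B.mass p) \<le> \<theta>" unfolding B.mass_def .
    qed
    have wR1: "norm w + 1 \<le> R" "norm w \<le> R" and vR1: "norm v + 1 \<le> R" "norm v \<le> R" using wz vR by auto
    have 1: "norm (g (a, c) w - w - (A.drift c w - A.drift a w)) \<le> L * \<theta> * (A.mass c - A.mass a)"
      unfolding L_def by (rule A.one_step[OF ac(1-3) d(1) wz(1) wR1(1) less_imp_le[OF \<theta>(2)] nA])
    have 2: "norm (g' (a, c) v - v - (B.drift c v - B.drift a v)) \<le> L * \<theta> * (B.mass c - B.mass a)"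
      unfolding L_def by (rule B.one_step[OF ac(1-3) d(1) vz vR1(1) less_imp_le[OF \<theta>(2)] nB])
    have 3: "norm ((B.drift c v - B.drift a v) - (B.drift c w - B.drift a w)) \<le> L * norm (v - w) * (B.mass c - B.mass a)"
      unfolding L_def by (rule B.drift_diff_lipschitz[OF ac(1-3) d(1) vz vR1(2) wz(1) wR1(2)])
    have 4: "norm (B.drift r w - A.drift r w) \<le> \<epsilon>" if "0 \<le> r" "r \<le> b" for r
      by (rule close[OF that wz(1) wR1(2)])
    have 4: "norm (B.drift c w - A.drift c w) \<le> \<epsilon>" "norm (B.drift a w - A.drift a w) \<le> \<epsilon>"
      using ac st by (auto intro!: 4)
    define X1 where "X1 = g (a, c) w - w - (A.drift c w - A.drift a w)"
    define X2 where "X2 = g' (a, c) v - v - (B.drift c v - B.drift a v)"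
    define X3 where "X3 = (B.drift c v - B.drift a v) - (B.drift c w - B.drift a w)"
    define X4 where "X4 = B.drift c w - A.drift c w"
    define X5 where "X5 = B.drift a w - A.drift a w"
    have "g' (a, t) z - g (a, t) z = g' (a, c) v - g (a, c) w"
      using A.g_comp[OF ac(1,2) tI(1) ac(3,4) zp] B.g_comp[OF ac(1,2) tI(1) ac(3,4) zp] by (simp add: v_def w_def)
    also have "\<dots> = (v - w) + X3 + (X4 - X5) + (X2 - X1)"
      unfolding X1_def X2_def X3_def X4_def X5_def by simp
    finally have dec: "g' (a, t) z - g (a, t) z = (v - w) + X3 + (X4 - X5) + (X2 - X1)" .
    have tri: "norm (a + b + (c - d) + (e - f)) \<le> norm a + norm b + (norm c + norm d) + (norm e + norm f)" for a b c d e f :: complex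
      using norm_triangle_ineq[of "a + b + (c - d)" "e - f"] norm_triangle_ineq[of "a + b" "c - d"] norm_triangle_ineq[of a b]
        norm_triangle_ineq4[of c d] norm_triangle_ineq4[of e f] by linarith
    have "norm ((v - w) + X3 + (X4 - X5) + (X2 - X1)) \<le> norm (v - w) + norm X3 + (norm X4 + norm X5) + (norm X2 + norm X1)"
      by (rule tri)
    also have "\<dots> \<le> norm (v - w) + L * norm (v - w) * (B.mass c - B.mass a) + (\<epsilon> + \<epsilon>) + (L * \<theta> * (B.mass c - B.mass a) + L * \<theta> * (A.mass c - A.mass a))"
      by (intro add_mono order_refl 1[folded X1_def] 2[folded X2_def] 3[folded X3_def] 4(1)[folded X4_def] 4(2)[folded X5_def])
    also have "\<dots> = norm (v - w) * (1 + L * (B.mass c - B.mass a)) + (2 * \<epsilon> + L * \<theta> * ((A.mass c - A.mass a) + (B.mass c - B.mass a)))"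
      by (simp add: algebra_simps)
    finally have step: "norm (g' (a, t) z - g (a, t) z) \<le>
        norm (v - w) * (1 + L * (B.mass c - B.mass a)) + (2 * \<epsilon> + L * \<theta> * ((A.mass c - A.mass a) + (B.mass c - B.mass a)))"
      unfolding dec .
    define D where "D = L * (B.mass c - B.mass a)"
    define inc where "inc = 2 * \<epsilon> + L * \<theta> * ((A.mass c - A.mass a) + (B.mass c - B.mass a))"
    define S where "S = 2 * \<epsilon> * real j + L * \<theta> * ((A.mass t - A.mass c) + (B.mass t - B.mass c))"
    define E where "E = exp (L * (B.mass t - B.mass c))"
    have mm: "A.mass a \<le> A.mass c" "B.mass a \<le> B.mass c" "A.mass c \<le> A.mass t" "B.mass c \<le> B.mass t"
      using A.mass_mono[OF ac(1-3)] B.mass_mono[OF ac(1-3)] A.mass_mono[OF ac(2) tI(1) ac(4)] B.mass_mono[OF ac(2) tI(1) ac(4)] by auto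
    have D0: "D \<ge> 0" and inc0: "inc \<ge> 0" and S0: "S \<ge> 0" and E1: "E \<ge> 1"
      using mm L \<theta> eps by (auto simp: D_def inc_def S_def E_def)
    have bj: "\<beta> j = E * S" by (simp add: \<beta>_def E_def S_def c_def)
    have "L * (B.mass t - B.mass a) = L * (B.mass t - B.mass c) + D" by (simp add: D_def algebra_simps)
    then have EE: "exp (L * (B.mass t - B.mass a)) = E * exp D" by (simp add: E_def exp_add)
    have SS: "2 * \<epsilon> * real (Suc j) + L * \<theta> * ((A.mass t - A.mass a) + (B.mass t - B.mass a)) = S + inc"
      by (simp add: S_def inc_def algebra_simps)
    have bSj: "\<beta> (Suc j) = E * exp D * (S + inc)" unfolding \<beta>_def a_def[symmetric] EE SS ..
    have "norm (g' (a, t) z - g (a, t) z) \<le> norm (v - w) * (1 + D) + inc" using step by (simp add: D_def inc_def)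
    also have "\<dots> \<le> E * S * exp D + E * exp D * inc"
    proof (rule add_mono)
      show "norm (v - w) * (1 + D) \<le> E * S * exp D"
        using IH[unfolded bj] D0 exp_ge_add_one_self[of D] S0 E1 by (intro mult_mono) auto
      have "1 * 1 \<le> E * exp D" using E1 D0 by (intro mult_mono) auto
      then show "inc \<le> E * exp D * inc" using inc0 mult_right_mono[of 1 "E * exp D" inc] by simp
    qed
    also have "\<dots> = \<beta> (Suc j)" unfolding bSj by (simp add: algebra_simps)
    finally show ?case by (simp add: a_def)
  qed
  from main[OF order_refl] \<beta>_le[OF order_refl] show ?thesis unfolding uP by linarith
qed

section \<open>Generators and reverse evolution families\<close>

lemma compact_time_triangle: "compact {(r, t). 0 \<le> r \<and> r \<le> t \<and> t \<le> (b::real)}"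
proof -
  have "{(r, t). 0 \<le> r \<and> r \<le> t \<and> t \<le> b} = ({0..b} \<times> {0..b}) \<inter> {p. fst p \<le> snd p}" by auto
  moreover have "closed {p::real\<times>real. fst p \<le> snd p}" by (intro closed_Collect_le continuous_intros)
  ultimately show ?thesis by (simp add: compact_Int_closed compact_Times)
qed

lemma exists_fine_mesh:
  fixes b \<delta> :: real
  assumes "\<delta> > 0"
  obtains P :: nat where "P > 0" "b / real P < \<delta>"
proof -
  obtain n :: nat where n: "b / \<delta> < real n" using reals_Archimedean2 by blast
  have "b < \<delta> * real n" using n assms by (simp add: field_simps)
  also have "\<dots> \<le> \<delta> * real (Suc n)" using assms by (intro mult_left_mono) auto
  finally have "b / real (Suc n) < \<delta>" by (simp add: divide_less_eq)
  then show ?thesis using that[of "Suc n"] by simp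
qed

text \<open>Applied to a constant sequence of generators this also gives the joint continuity of the drift.\<close>

lemma drift_cont_conv:
  assumes L: "REF I \<gamma> \<eta> H g" and N: "\<And>n. REF I (\<gamma>n n) (\<eta>n n) (Hn n) (gn n)"
    and conv_\<gamma>: "loc_unif_conv I \<gamma>n \<gamma>" and conv_\<eta>: "weak_conv_loc_unif I \<eta>n \<eta>"
  shows "cont_conv ({w. Im w > 0} \<times> I) (\<lambda>n (w, t). REF.drift (\<gamma>n n) (\<eta>n n) t w) (\<lambda>(w, t). REF.drift \<gamma> \<eta> t w)"
proof (rule cont_convI)
  interpret L: REF I \<gamma> \<eta> H g by (rule L)
  interpret N: REF I "\<gamma>n n" "\<eta>n n" "Hn n" "gn n" for n by (rule N)
  fix r :: "nat \<Rightarrow> nat" and p :: "nat \<Rightarrow> complex \<times> real" and l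
  assume r: "strict_mono r" and p: "\<And>k. p k \<in> {w. Im w > 0} \<times> I" "l \<in> {w. Im w > 0} \<times> I" "p \<longlonglongrightarrow> l"
  define w where "w = (\<lambda>k. fst (p k))"
  define \<tau> where "\<tau> = (\<lambda>k. snd (p k))"
  have m: "Im (w k) > 0" "\<tau> k \<in> I" "Im (fst l) > 0" "snd l \<in> I" for k
    using p(1)[of k] p(2) by (auto simp: w_def \<tau>_def mem_Times_iff)
  have lim: "w \<longlonglongrightarrow> fst l" "\<tau> \<longlonglongrightarrow> snd l"
    unfolding w_def \<tau>_def by (intro tendsto_fst tendsto_snd p(3))+
  have g: "(\<lambda>k. \<gamma>n (r k) (\<tau> k)) \<longlonglongrightarrow> \<gamma> (snd l)"
    using conv_\<gamma>[unfolded loc_unif_conv_iff_cont_conv[OF L.continuous_gamma]] r m(2,4) lim(2) by (rule cont_convD)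
  have e: "weak_conv_finite (\<lambda>k. \<eta>n (r k) (\<tau> k)) (\<eta> (snd l))"
    using conv_\<eta>[unfolded weak_conv_loc_unif_iff_sequential[OF L.weakly_continuous_eta], rule_format, of r \<tau> "snd l"] r m(2,4) lim(2)
    by auto
  have M: "(\<lambda>k. N.mass (r k) (\<tau> k)) \<longlonglongrightarrow> L.mass (snd l)"
    unfolding N.mass_def L.mass_def by (rule weak_conv_finite_mass[OF e N.fin_eta[OF m(2)] L.fin_eta[OF m(4)]])
  have G: "(\<lambda>k. Cauchy_transform (\<eta>n (r k) (\<tau> k)) (w k)) \<longlonglongrightarrow> Cauchy_transform (\<eta> (snd l)) (fst l)"
    by (rule Cauchy_transform_tendsto[OF e N.fin_eta[OF m(2)] L.fin_eta[OF m(4)] lim(1) m(1) m(3)])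
  have "(\<lambda>k. N.drift (r k) (\<tau> k) (w k)) \<longlonglongrightarrow> L.drift (snd l) (fst l)"
    unfolding N.drift_resolvent[OF m(2) m(1)] L.drift_resolvent[OF m(4) m(3)]
    by (intro tendsto_intros M G lim(1) g)
  then show "(\<lambda>k. case p k of (w, t) \<Rightarrow> N.drift (r k) t w) \<longlonglongrightarrow> (case l of (w, t) \<Rightarrow> L.drift t w)"
    by (simp only: w_def \<tau>_def split_def)
qed

lemma weak_conv_loc_unif_mass:
  assumes N: "\<And>n. generator_with_measure I (\<gamma>n n) (\<eta>n n) (Hn n)" and L: "generator_with_measure I \<gamma> \<eta> H"
    and w: "weak_conv_loc_unif I \<eta>n \<eta>" and K: "compact K" "K \<subseteq> I"
  shows "uniform_limit K (\<lambda>n t. measure (\<eta>n n t) UNIV) (\<lambda>t. measure (\<eta> t) UNIV) sequentially"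
proof -
  have "uniform_limit K (\<lambda>n t. \<integral>x. (1::real) \<partial>\<eta>n n t) (\<lambda>t. \<integral>x. (1::real) \<partial>\<eta> t) sequentially"
    using w[unfolded weak_conv_loc_unif_def, rule_format, of K "\<lambda>_. 1"] K by simp
  moreover have "(\<integral>x. (1::real) \<partial>\<eta>n n t) = measure (\<eta>n n t) UNIV" "(\<integral>x. (1::real) \<partial>\<eta> t) = measure (\<eta> t) UNIV" if "t \<in> K" for n t
  proof -
    have t: "t \<in> I" using that K by auto
    interpret N: finite_borel_measure "\<eta>n n t" by (rule generator_with_measure.fin_eta[OF N t])
    interpret L: finite_borel_measure "\<eta> t" by (rule generator_with_measure.fin_eta[OF L t])
    show "(\<integral>x. (1::real) \<partial>\<eta>n n t) = measure (\<eta>n n t) UNIV" "(\<integral>x. (1::real) \<partial>\<eta> t) = measure (\<eta> t) UNIV"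
      by (simp_all add: N.borel_UNIV L.borel_UNIV)
  qed
  ultimately show ?thesis unfolding uniform_limit_iff by simp
qed

text \<open>Convergence of the generators makes the masses, the numbers \<open>\<gamma>\<close> and, on compact sets, the drifts converge
  uniformly.  In particular one mesh serves for almost all \<open>n\<close>, and \<open>euler_comparison\<close> applies.\<close>

theorem REF_convergence:
  assumes L: "REF I \<gamma> \<eta> H g" and N: "\<And>n. REF I (\<gamma>n n) (\<eta>n n) (Hn n) (gn n)"
    and conv_\<gamma>: "loc_unif_conv I \<gamma>n \<gamma>" and conv_\<eta>: "weak_conv_loc_unif I \<eta>n \<eta>"
  shows "loc_unif_conv (\<complex>\<^sup>+ \<times> time_pairs I) (\<lambda>n (z, \<tau>). gn n \<tau> z) (\<lambda>(z, \<tau>). g \<tau> z)"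
  unfolding loc_unif_conv_def
proof (intro allI impI, elim conjE)
  fix K assume K: "compact K" "K \<subseteq> \<complex>\<^sup>+ \<times> time_pairs I"
  interpret L: REF I \<gamma> \<eta> H g by (rule L)
  interpret N: REF I "\<gamma>n n" "\<eta>n n" "Hn n" "gn n" for n by (rule N)
  show "uniform_limit K (\<lambda>n (z, \<tau>). gn n \<tau> z) (\<lambda>(z, \<tau>). g \<tau> z) sequentially"
  proof (cases "K = {}")
    case True
    then show ?thesis by (simp add: uniform_limit_iff)
  next
    case False
    have Kp: "Im (fst p) > 0" "fst (snd p) \<in> I" "snd (snd p) \<in> I" "fst (snd p) \<le> snd (snd p)" if "p \<in> K" for p
      using that K(2) by (auto simp: UHP_iff L.pairs)
    have "\<exists>x\<in>K. \<forall>y\<in>K. Im (fst x) \<le> Im (fst y)"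
      by (intro continuous_attains_inf[OF K(1) False] continuous_intros)
    then obtain p0 where p0: "p0 \<in> K" "\<And>p. p \<in> K \<Longrightarrow> Im (fst p0) \<le> Im (fst p)" by blast
    define d where "d = Im (fst p0)"
    have d: "d > 0" "\<And>p. p \<in> K \<Longrightarrow> Im (fst p) \<ge> d" using p0 Kp(1) by (auto simp: d_def)
    have "\<exists>x\<in>K. \<forall>y\<in>K. snd (snd y) \<le> snd (snd x)"
      by (intro continuous_attains_sup[OF K(1) False] continuous_intros)
    then obtain p1 where p1: "p1 \<in> K" "\<And>p. p \<in> K \<Longrightarrow> snd (snd p) \<le> snd (snd p1)" by blast
    define b where "b = snd (snd p1)"
    have b: "b \<in> I" "\<And>p. p \<in> K \<Longrightarrow> snd (snd p) \<le> b" using p1 Kp(3) by (auto simp: b_def)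
    have b0: "b \<ge> 0" by (rule L.nonneg_time[OF b(1)])
    have sub: "{0..b} \<subseteq> I" by (rule L.interval_subset(1)[OF L.zero_in b(1)])
    let ?T = "{(r, t). 0 \<le> r \<and> r \<le> t \<and> t \<le> b}"
    have cT: "compact (fst ` K \<times> ?T)"
      by (intro compact_Times compact_time_triangle compact_continuous_image K(1) continuous_intros)
    have "fst ` K \<times> ?T \<subseteq> \<complex>\<^sup>+ \<times> time_pairs I"
      using Kp(1) by (auto simp: UHP_iff L.pairs intro!: L.down_closed[OF b(1)])
    then have "bounded ((\<lambda>(z, \<tau>). g \<tau> z) ` (fst ` K \<times> ?T))"
      by (intro compact_imp_bounded compact_continuous_image cT continuous_on_subset[OF L.g_joint_continuous])
    then obtain R1 where R1: "\<forall>y\<in>(\<lambda>(z, \<tau>). g \<tau> z) ` (fst ` K \<times> ?T). norm y \<le> R1" unfolding bounded_iff by blast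
    have orbit: "norm (g (r, t) z) \<le> R1" if "z \<in> fst ` K" "0 \<le> r" "r \<le> t" "t \<le> b" for r t z
      using R1[rule_format, of "g (r, t) z"] that by force
    define R where "R = R1 + 2"
    have "norm (g (0, 0) (fst p0)) \<le> R1" using p0 b0 by (intro orbit) auto
    then have R: "R \<ge> 0" unfolding R_def using norm_ge_zero[of "g (0, 0) (fst p0)"] by linarith
    define C where "C = kernel_bound d R"
    define Lc where "Lc = kernel_lip d R"
    have C: "C \<ge> 0" and Lc: "Lc \<ge> 1" using kernel_consts_pos[OF d(1) R] by (auto simp: C_def Lc_def)
    have ul_\<gamma>: "uniform_limit {0..b} \<gamma>n \<gamma> sequentially"
      using conv_\<gamma> sub by (auto simp: loc_unif_conv_def)
    have ul_m: "uniform_limit {0..b} (\<lambda>n. N.mass n) L.mass sequentially"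
      unfolding N.mass_def[abs_def] L.mass_def[abs_def]
      by (rule weak_conv_loc_unif_mass[OF N.generator_with_measure_axioms L.generator_with_measure_axioms conv_\<eta> _ sub]) simp
    let ?W = "{w. d \<le> Im w \<and> norm w \<le> R}"
    have cW: "compact (?W \<times> {0..b})"
    proof (intro compact_Times)
      have "?W = {w. d \<le> Im w} \<inter> cball 0 R" by auto
      moreover have "closed {w. d \<le> Im w}" by (intro closed_Collect_le continuous_intros)
      ultimately show "compact ?W" by (simp add: closed_Int_compact)
    qed simp
    have Wsub: "?W \<times> {0..b} \<subseteq> {w. Im w > 0} \<times> I" using sub d(1) by auto
    have cc: "cont_conv (?W \<times> {0..b}) (\<lambda>n (w, t). N.drift n t w) (\<lambda>(w, t). L.drift t w)"
      by (rule cont_conv_subset[OF drift_cont_conv[OF L N conv_\<gamma> conv_\<eta>] Wsub])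
    have cd: "continuous_on (?W \<times> {0..b}) (\<lambda>(w, t). L.drift t w)"
      by (rule continuous_on_subset[OF continuous_on_if_cont_conv_const Wsub])
         (rule drift_cont_conv[OF L L loc_unif_conv_const weak_conv_loc_unif_const])
    have ul_d: "uniform_limit (?W \<times> {0..b}) (\<lambda>n (w, t). N.drift n t w) (\<lambda>(w, t). L.drift t w) sequentially"
      by (rule uniform_limit_if_cont_conv[OF cW cd cc])
    show ?thesis
    proof (rule uniform_limitI)
      fix e :: real assume e: "e > 0"
      define T where "T = min (e / 2) 1"
      have T: "T > 0" "T \<le> 1" "T < e" using e by (auto simp: T_def)
      \<comment> \<open>Constants are fixed in the order \<open>\<theta>\<close>, then the number of steps \<open>P\<close>, then \<open>\<epsilon>\<close>: the \<open>\<theta>\<close>-part of the error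
         does not depend on \<open>P\<close>, and the part proportional to \<open>P\<close> is made small by taking \<open>n\<close> large.\<close>
      define M where "M = L.mass b + 1"
      have M: "M \<ge> 1" using L.mass_nonneg[of b] by (simp add: M_def)
      define Q where "Q = exp (Lc * M) * (Lc * (L.mass b + M))"
      have Q: "Q > 0" unfolding Q_def using M L.mass_nonneg[of b] Lc by (intro mult_pos_pos add_nonneg_pos) auto
      define \<theta> where "\<theta> = min (1 / 2) (T / (2 * Q))"
      have \<theta>: "\<theta> > 0" "\<theta> < 1" "\<theta> * Q \<le> T / 2"
      proof -
        show "\<theta> > 0" "\<theta> < 1" using T Q by (auto simp: \<theta>_def)
        have "\<theta> * Q \<le> T / (2 * Q) * Q" using Q by (intro mult_right_mono) (auto simp: \<theta>_def)
        then show "\<theta> * Q \<le> T / 2" using Q by simp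
      qed
      \<comment> \<open>The factor \<open>8\<close> leaves room for one oscillation of the limit and two uniform approximation errors, in \<open>\<gamma>\<close>
         and in the mass.\<close>
      define \<kappa> where "\<kappa> = \<theta> / (8 * (C + 1))"
      have \<kappa>: "\<kappa> > 0" "\<kappa> \<le> \<theta> / 8" "C * \<kappa> \<le> \<theta> / 8"
      proof -
        show "\<kappa> > 0" using \<theta> C by (simp add: \<kappa>_def)
        show "\<kappa> \<le> \<theta> / 8" unfolding \<kappa>_def using \<theta> C by (intro divide_left_mono) auto
        have "C * \<kappa> = \<theta> / 8 * (C / (C + 1))" by (simp add: \<kappa>_def)
        also have "\<dots> \<le> \<theta> / 8 * 1" using \<theta> C by (intro mult_left_mono) auto
        finally show "C * \<kappa> \<le> \<theta> / 8" by simp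
      qed
      have uc: "uniformly_continuous_on {0..b} \<gamma>" "uniformly_continuous_on {0..b} L.mass"
        by (intro compact_uniformly_continuous continuous_on_subset[OF L.continuous_gamma sub] continuous_on_subset[OF L.continuous_mass sub] compact_Icc)+
      obtain \<delta>1 where \<delta>1: "\<delta>1 > 0" "\<And>p q. p \<in> {0..b} \<Longrightarrow> q \<in> {0..b} \<Longrightarrow> dist q p < \<delta>1 \<Longrightarrow> dist (\<gamma> q) (\<gamma> p) < \<kappa>"
        using uc(1) \<kappa>(1) unfolding uniformly_continuous_on_def by meson
      obtain \<delta>2 where \<delta>2: "\<delta>2 > 0" "\<And>p q. p \<in> {0..b} \<Longrightarrow> q \<in> {0..b} \<Longrightarrow> dist q p < \<delta>2 \<Longrightarrow> dist (L.mass q) (L.mass p) < \<kappa>"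
        using uc(2) \<kappa>(1) unfolding uniformly_continuous_on_def by meson
      obtain P :: nat where P: "P > 0" "b / real P < min \<delta>1 \<delta>2"
        using exists_fine_mesh[of "min \<delta>1 \<delta>2" b] \<delta>1(1) \<delta>2(1) by auto
      have close: "\<bar>\<gamma> p - \<gamma> q\<bar> < \<kappa>" "\<bar>L.mass q - L.mass p\<bar> < \<kappa>" if "0 \<le> p" "p \<le> q" "q \<le> b" "q - p \<le> b / real P" for p q
        using \<delta>1(2)[of p q] \<delta>2(2)[of p q] that P(2) by (auto simp: dist_real_def abs_minus_commute)
      define \<epsilon> where "\<epsilon> = T / (4 * real P * exp (Lc * M))"
      have \<epsilon>: "\<epsilon> > 0" "exp (Lc * M) * (2 * \<epsilon> * real P) = T / 2"
        using T P(1) by (auto simp: \<epsilon>_def field_simps)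
      have ev: "\<forall>\<^sub>F n in sequentially. \<forall>t\<in>{0..b}. dist (\<gamma>n n t) (\<gamma> t) < \<kappa>"
        "\<forall>\<^sub>F n in sequentially. \<forall>t\<in>{0..b}. dist (N.mass n t) (L.mass t) < min \<kappa> 1"
        "\<forall>\<^sub>F n in sequentially. \<forall>p\<in>?W \<times> {0..b}. dist (case p of (w, t) \<Rightarrow> N.drift n t w) (case p of (w, t) \<Rightarrow> L.drift t w) < \<epsilon>"
        using uniform_limitD[OF ul_\<gamma>, of \<kappa>] uniform_limitD[OF ul_m, of "min \<kappa> 1"] uniform_limitD[OF ul_d, of \<epsilon>] \<kappa>(1) \<epsilon>(1) by auto
      show "\<forall>\<^sub>F n in sequentially. \<forall>p\<in>K. dist (case p of (z, \<tau>) \<Rightarrow> gn n \<tau> z) (case p of (z, \<tau>) \<Rightarrow> g \<tau> z) < e"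
        using ev
      proof eventually_elim
        case (elim n)
        have g1: "\<bar>\<gamma>n n t - \<gamma> t\<bar> < \<kappa>" "\<bar>N.mass n t - L.mass t\<bar> < \<kappa>" "\<bar>N.mass n t - L.mass t\<bar> < 1" if "0 \<le> t" "t \<le> b" for t
          using elim(1,2) that by (auto simp: dist_real_def)
        have Mn: "N.mass n b \<le> M" using g1(3)[OF b0 order_refl] by (simp add: M_def)
        show ?case
        proof
          fix p assume p: "p \<in> K"
          obtain z s t where pz: "p = (z, (s, t))" by (metis prod.exhaust)
          have z: "Im z \<ge> d" "z \<in> fst ` K" using d(2)[OF p] p by (auto simp: pz intro: rev_image_eqI)
          have st: "0 \<le> s" "s \<le> t" "t \<le> b" using Kp[OF p] b(2)[OF p] L.nonneg_time by (auto simp: pz)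
          have "norm (gn n (s, t) z - g (s, t) z) \<le> T"
          proof (rule euler_comparison[OF L N d(1) z(1) b(1) P(1) less_imp_le[OF \<theta>(1)] \<theta>(2) less_imp_le[OF \<epsilon>(1)] st _ _ _ _ _ T(2), where R = R])
            fix p q :: real assume pq: "0 \<le> p" "p \<le> q" "q \<le> b" "q - p \<le> b / real P"
            have "C * (L.mass q - L.mass p) \<le> C * \<kappa>" using close(2)[OF pq] C by (intro mult_left_mono) auto
            then show "\<bar>\<gamma> p - \<gamma> q\<bar> + kernel_bound d R * (measure (\<eta> q) UNIV - measure (\<eta> p) UNIV) \<le> \<theta>"
              using close(1)[OF pq] \<kappa> \<theta>(1) unfolding C_def[symmetric] L.mass_def[symmetric] by linarith
            have "N.mass n q - N.mass n p \<le> 3 * \<kappa>"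
              using close(2)[OF pq] g1(2)[of p] g1(2)[of q] pq by linarith
            then have "C * (N.mass n q - N.mass n p) \<le> C * (3 * \<kappa>)" using C by (intro mult_left_mono) auto
            moreover have "\<bar>\<gamma>n n p - \<gamma>n n q\<bar> \<le> 3 * \<kappa>"
              using close(1)[OF pq] g1(1)[of p] g1(1)[of q] pq by linarith
            ultimately show "\<bar>\<gamma>n n p - \<gamma>n n q\<bar> + kernel_bound d R * (measure (\<eta>n n q) UNIV - measure (\<eta>n n p) UNIV) \<le> \<theta>"
              using \<kappa> \<theta>(1) unfolding C_def[symmetric] N.mass_def[symmetric] by linarith
          next
            fix t w assume "0 \<le> t" "t \<le> b" "Im w \<ge> d" "norm w \<le> R"
            then have "(w, t) \<in> ?W \<times> {0..b}" by simp
            from elim(3)[rule_format, OF this] show "norm (N.drift n t w - L.drift t w) \<le> \<epsilon>"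
              by (simp add: dist_norm)
          next
            fix r assume "s \<le> r" "r \<le> t"
            then show "norm (g (r, t) z) \<le> R - 2" using orbit[OF z(2), of r t] st by (simp add: R_def)
          next
            have "exp (Lc * N.mass n b) * (2 * \<epsilon> * real P + Lc * \<theta> * (L.mass b + N.mass n b))
                \<le> exp (Lc * M) * (2 * \<epsilon> * real P + Lc * \<theta> * (L.mass b + M))"
              using Mn Lc \<theta>(1) \<epsilon>(1) L.mass_nonneg[of b] N.mass_nonneg[of n b]
              by (intro mult_mono add_mono mult_left_mono) auto
            also have "\<dots> = exp (Lc * M) * (2 * \<epsilon> * real P) + \<theta> * Q"
              by (simp add: Q_def algebra_simps)
            also have "\<dots> \<le> T" using \<epsilon>(2) \<theta>(3) by simp
            finally show "exp (kernel_lip d R * measure (\<eta>n n b) UNIV) *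
              (2 * \<epsilon> * real P + kernel_lip d R * \<theta> * (measure (\<eta> b) UNIV + measure (\<eta>n n b) UNIV)) \<le> T"
              unfolding Lc_def L.mass_def N.mass_def .
          qed
          then show "dist (case p of (z, \<tau>) \<Rightarrow> gn n \<tau> z) (case p of (z, \<tau>) \<Rightarrow> g \<tau> z) < e"
            using T(3) by (simp add: pz dist_norm)
        qed
      qed
    qed
  qed
qed

lemma uniform_limit_Re: "uniform_limit S f g F \<Longrightarrow> uniform_limit S (\<lambda>n x. Re (f n x)) (\<lambda>x. Re (g x)) F"
  by (rule bounded_linear.uniform_limit[OF bounded_linear_Re])

lemma uniform_limit_Im: "uniform_limit S f g F \<Longrightarrow> uniform_limit S (\<lambda>n x. Im (f n x)) (\<lambda>x. Im (g x)) F"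
  by (rule bounded_linear.uniform_limit[OF bounded_linear_Im])

text \<open>Choose a mesh so fine that all flows move \<open>z\<close> by at most \<open>\<theta>\<close> in one step; this is possible for almost all \<open>n\<close>
  simultaneously because the flows converge uniformly.  Then compare the telescoping sums.  The error bounds involve the
  masses of the approximating generators, which are first bounded by the same argument at \<open>z = \<i>\<close>, where the
  imaginary part of the drift is the mass itself.\<close>

lemma drift_uniform_limit:
  assumes L: "REF I \<gamma> \<eta> H g" and N: "\<And>n. REF I (\<gamma>n n) (\<eta>n n) (Hn n) (gn n)"
    and conv: "loc_unif_conv (\<complex>\<^sup>+ \<times> time_pairs I) (\<lambda>n (z, \<tau>). gn n \<tau> z) (\<lambda>(z, \<tau>). g \<tau> z)"
    and b: "b \<in> I" and z: "Im z > 0"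
  shows "uniform_limit {0..b} (\<lambda>n t. REF.drift (\<gamma>n n) (\<eta>n n) t z) (\<lambda>t. REF.drift \<gamma> \<eta> t z) sequentially"
proof -
  interpret L: REF I \<gamma> \<eta> H g by (rule L)
  interpret N: REF I "\<gamma>n n" "\<eta>n n" "Hn n" "gn n" for n by (rule N)
  have b0: "b \<ge> 0" by (rule L.nonneg_time[OF b])
  let ?T = "{(r, t). 0 \<le> r \<and> r \<le> t \<and> t \<le> b}"
  have Tsub: "?T \<subseteq> time_pairs I" by (auto simp: L.pairs intro!: L.down_closed[OF b])
  have ul: "uniform_limit ?T (\<lambda>n \<tau>. gn n \<tau> z) (\<lambda>\<tau>. g \<tau> z) sequentially" if z: "Im z > 0" for z
  proof -
    have "uniform_limit ({z} \<times> ?T) (\<lambda>n (z, \<tau>). gn n \<tau> z) (\<lambda>(z, \<tau>). g \<tau> z) sequentially"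
      by (intro conv[unfolded loc_unif_conv_def, rule_format] conjI compact_Times compact_time_triangle)
         (use Tsub z in \<open>auto simp: UHP_iff\<close>)
    then show ?thesis unfolding uniform_limit_iff by simp
  qed
  have near: "\<exists>P>0. \<forall>\<^sub>F n in sequentially. \<forall>r q. 0 \<le> r \<longrightarrow> r \<le> q \<longrightarrow> q \<le> b \<longrightarrow> q - r \<le> b / real P \<longrightarrow>
      norm (gn n (r, q) z - z) \<le> \<theta> \<and> norm (g (r, q) z - z) \<le> \<theta>" if z: "Im z > 0" and \<theta>: "\<theta> > 0" for z \<theta>
  proof -
    have "continuous_on ?T (\<lambda>\<tau>. (\<lambda>(z, \<tau>). g \<tau> z) (z, \<tau>))"
      by (rule continuous_on_compose2[OF L.g_joint_continuous]) (use Tsub z in \<open>auto simp: UHP_iff intro!: continuous_intros\<close>)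
    then have "uniformly_continuous_on ?T (\<lambda>\<tau>. g \<tau> z)"
      by (intro compact_uniformly_continuous compact_time_triangle) simp
    then obtain \<delta> where \<delta>: "\<delta> > 0" "\<And>x y. x \<in> ?T \<Longrightarrow> y \<in> ?T \<Longrightarrow> dist y x < \<delta> \<Longrightarrow> dist (g y z) (g x z) < \<theta> / 2"
      using \<theta> unfolding uniformly_continuous_on_def by (meson half_gt_zero)
    obtain P :: nat where P: "P > 0" "b / real P < \<delta>" by (rule exists_fine_mesh[OF \<delta>(1)])
    have g1: "norm (g (r, q) z - z) \<le> \<theta> / 2" if "0 \<le> r" "r \<le> q" "q \<le> b" "q - r \<le> b / real P" for r q
    proof -
      have "dist (r, q) (q, q) < \<delta>" using that P(2) by (simp add: dist_Pair_Pair dist_real_def)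
      then have "dist (g (r, q) z) (g (q, q) z) < \<theta> / 2" using that by (intro \<delta>(2)) auto
      then show ?thesis using L.g_refl[of q z] L.down_closed[OF b, of q] z that by (simp add: dist_norm)
    qed
    have "\<forall>\<^sub>F n in sequentially. \<forall>\<tau>\<in>?T. dist (gn n \<tau> z) (g \<tau> z) < \<theta> / 2"
      using uniform_limitD[OF ul[OF z], of "\<theta> / 2"] \<theta> by simp
    then have "\<forall>\<^sub>F n in sequentially. \<forall>r q. 0 \<le> r \<longrightarrow> r \<le> q \<longrightarrow> q \<le> b \<longrightarrow> q - r \<le> b / real P \<longrightarrow>
      norm (gn n (r, q) z - z) \<le> \<theta> \<and> norm (g (r, q) z - z) \<le> \<theta>"
    proof eventually_elim
      case (elim n)
      show ?case
      proof (intro allI impI)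
        fix r q assume rq: "0 \<le> r" "r \<le> q" "q \<le> b" "q - r \<le> b / real P"
        have "norm (gn n (r, q) z - g (r, q) z) < \<theta> / 2" using elim[rule_format, of "(r, q)"] rq by (simp add: dist_norm)
        moreover have "norm (gn n (r, q) z - z) \<le> norm (gn n (r, q) z - g (r, q) z) + norm (g (r, q) z - z)"
          using norm_triangle_ineq[of "gn n (r, q) z - g (r, q) z" "g (r, q) z - z"] by simp
        ultimately show "norm (gn n (r, q) z - z) \<le> \<theta> \<and> norm (g (r, q) z - z) \<le> \<theta>" using g1[OF rq] \<theta> by linarith
      qed
    qed
    then show ?thesis using P(1) by blast
  qed
  have mesh: "q - r \<le> b / real P" if "q - r \<le> t / real P" "t \<le> b" "P > 0" for q r t :: real and P :: nat
    using that divide_right_mono[of t b "real P"] by linarith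
  \<comment> \<open>At \<open>\<i>\<close> with \<open>L \<theta> = 1 / 2\<close>, half of the mass is absorbed on the left-hand side.\<close>
  have "\<exists>M. \<forall>\<^sub>F n in sequentially. N.mass n b \<le> M"
  proof -
    define L1 where "L1 = kernel_lip 1 2"
    define \<theta> where "\<theta> = 1 / (2 * L1)"
    have L1: "L1 \<ge> 1" using kernel_consts_pos[of 1 2] by (simp add: L1_def)
    have \<theta>: "\<theta> > 0" "\<theta> \<le> 1" "L1 * \<theta> = 1 / 2" using L1 by (auto simp: \<theta>_def divide_simps)
    obtain P :: nat where P: "P > 0" "\<forall>\<^sub>F n in sequentially. \<forall>r q. 0 \<le> r \<longrightarrow> r \<le> q \<longrightarrow> q \<le> b \<longrightarrow> q - r \<le> b / real P \<longrightarrow>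
      norm (gn n (r, q) \<i> - \<i>) \<le> \<theta> \<and> norm (g (r, q) \<i> - \<i>) \<le> \<theta>"
      using near[of \<i>, OF _ \<theta>(1)] by auto
    have "\<forall>\<^sub>F n in sequentially. N.mass n b \<le> 2 * (real P * \<theta>)"
      using P(2)
    proof eventually_elim
      case (elim n)
      let ?S = "\<Sum>j<P. gn n (real j * b / real P, real (Suc j) * b / real P) \<i> - \<i>"
      have "norm (N.drift n b \<i> - ?S) \<le> kernel_lip 1 2 * \<theta> * N.mass n b"
        by (rule N.telescoping_sum[OF b P(1) _ _ _ \<theta>(2)]) (use elim in auto)
      then have 1: "norm (N.drift n b \<i> - ?S) \<le> 1 / 2 * N.mass n b" using \<theta>(3)[unfolded L1_def] by (simp only:)
      have "norm ?S \<le> (\<Sum>j<P. \<theta>)"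
      proof (rule sum_norm_le)
        fix j assume "j \<in> {..<P}"
        then have "real (Suc j) * b \<le> real P * b" using b0 by (intro mult_right_mono) auto
        then have "real (Suc j) * b / real P \<le> b" using P(1) by (simp add: field_simps)
        moreover have "real j * b / real P \<le> real (Suc j) * b / real P" using b0 by (intro divide_right_mono mult_right_mono) auto
        moreover have "real (Suc j) * b / real P - real j * b / real P = b / real P" by (simp add: distrib_right add_divide_distrib)
        ultimately show "norm (gn n (real j * b / real P, real (Suc j) * b / real P) \<i> - \<i>) \<le> \<theta>"
          using elim[rule_format, of "real j * b / real P" "real (Suc j) * b / real P"] b0 by simp
      qed
      then have 2: "norm ?S \<le> real P * \<theta>" by simp
      have "N.mass n b = Im (N.drift n b \<i>)" by (simp add: N.drift_i[OF b])
      also have "\<dots> \<le> norm (N.drift n b \<i>)" using abs_Im_le_cmod[of "N.drift n b \<i>"] by linarith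
      also have "\<dots> \<le> norm (N.drift n b \<i> - ?S) + norm ?S"
        using norm_triangle_ineq[of "N.drift n b \<i> - ?S" ?S] by simp
      finally show ?case using 1 2 by linarith
    qed
    then show ?thesis by blast
  qed
  then obtain M where M: "\<forall>\<^sub>F n in sequentially. N.mass n b \<le> M" by blast
  define d where "d = Im z"
  define R where "R = norm z + 1"
  define Lc where "Lc = kernel_lip d R"
  have d: "d > 0" "Im z \<ge> d" using z by (auto simp: d_def)
  have Lc: "Lc \<ge> 1" using kernel_consts_pos[OF d(1), of R] by (simp add: Lc_def R_def)
  show ?thesis
  proof (rule uniform_limitI)
    fix e :: real assume e: "e > 0"
    define Q where "Q = Lc * (max M 0 + L.mass b + 1)"
    have Q: "Q > 0" unfolding Q_def using Lc L.mass_nonneg[of b] by (intro mult_pos_pos) auto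
    define \<theta> where "\<theta> = min 1 (e / (2 * Q))"
    have \<theta>: "\<theta> > 0" "\<theta> \<le> 1" "\<theta> * Q \<le> e / 2"
    proof -
      show "\<theta> > 0" "\<theta> \<le> 1" using e Q by (auto simp: \<theta>_def)
      have "\<theta> * Q \<le> e / (2 * Q) * Q" using Q by (intro mult_right_mono) (auto simp: \<theta>_def)
      then show "\<theta> * Q \<le> e / 2" using Q by simp
    qed
    obtain P :: nat where P: "P > 0" "\<forall>\<^sub>F n in sequentially. \<forall>r q. 0 \<le> r \<longrightarrow> r \<le> q \<longrightarrow> q \<le> b \<longrightarrow> q - r \<le> b / real P \<longrightarrow>
      norm (gn n (r, q) z - z) \<le> \<theta> \<and> norm (g (r, q) z - z) \<le> \<theta>"
      using near[OF z \<theta>(1)] by auto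
    define \<kappa> where "\<kappa> = e / (4 * real P)"
    have \<kappa>: "\<kappa> > 0" "real P * \<kappa> < e / 2" using e P(1) by (auto simp: \<kappa>_def)
    have "\<forall>\<^sub>F n in sequentially. \<forall>\<tau>\<in>?T. dist (gn n \<tau> z) (g \<tau> z) < \<kappa>"
      by (rule uniform_limitD[OF ul[OF z] \<kappa>(1)])
    then show "\<forall>\<^sub>F n in sequentially. \<forall>t\<in>{0..b}. dist (N.drift n t z) (L.drift t z) < e"
      using M P(2)
    proof eventually_elim
      case (elim n)
      show ?case
      proof
        fix t assume t: "t \<in> {0..b}"
        have tI: "t \<in> I" using L.down_closed[OF b] t by auto
        let ?u = "\<lambda>j. (real j * t / real P, real (Suc j) * t / real P)"
        let ?Sn = "\<Sum>j<P. gn n (?u j) z - z" and ?S = "\<Sum>j<P. g (?u j) z - z"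
        have nr: "norm (gn n (r, q) z - z) \<le> \<theta> \<and> norm (g (r, q) z - z) \<le> \<theta>"
          if "0 \<le> r" "r \<le> q" "q \<le> t" "q - r \<le> t / real P" for r q
          using elim(3) that t mesh[OF that(4) _ P(1)] by auto
        have m: "0 \<le> N.mass n t" "0 \<le> L.mass t" "N.mass n t \<le> M" "L.mass t \<le> L.mass b"
          using N.mass_nonneg L.mass_nonneg N.mass_mono[OF tI b, of n] L.mass_mono[OF tI b] t elim(2) by (auto intro: order_trans)
        have 1: "norm (N.drift n t z - ?Sn) \<le> Lc * \<theta> * N.mass n t"
          unfolding Lc_def by (rule N.telescoping_sum[OF tI P(1) d _ \<theta>(2)]) (use nr in \<open>auto simp: R_def\<close>)
        have 2: "norm (L.drift t z - ?S) \<le> Lc * \<theta> * L.mass t"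
          unfolding Lc_def by (rule L.telescoping_sum[OF tI P(1) d _ \<theta>(2)]) (use nr in \<open>auto simp: R_def\<close>)
        have "norm (?Sn - ?S) = norm (\<Sum>j<P. gn n (?u j) z - g (?u j) z)" by (simp add: sum_subtractf)
        also have "\<dots> \<le> (\<Sum>j<P. \<kappa>)"
        proof (rule sum_norm_le)
          fix j assume "j \<in> {..<P}"
          then have "real (Suc j) * t \<le> real P * t" using t by (intro mult_right_mono) auto
          then have "real (Suc j) * t / real P \<le> t" using P(1) by (simp add: field_simps)
          moreover have "real j * t / real P \<le> real (Suc j) * t / real P" using t by (intro divide_right_mono mult_right_mono) auto
          moreover have "0 \<le> real j * t / real P" using t by simp
          ultimately have "?u j \<in> ?T" using t by simp
          from elim(1)[rule_format, OF this] show "norm (gn n (?u j) z - g (?u j) z) \<le> \<kappa>" by (simp only: dist_norm less_imp_le)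
        qed
        finally have 3: "norm (?Sn - ?S) \<le> real P * \<kappa>" by simp
        have "Lc * \<theta> * N.mass n t + Lc * \<theta> * L.mass t = \<theta> * (Lc * (N.mass n t + L.mass t))" by (simp add: algebra_simps)
        also have "\<dots> \<le> \<theta> * Q" unfolding Q_def using m Lc \<theta>(1) by (intro mult_left_mono) auto
        finally have 4: "Lc * \<theta> * N.mass n t + Lc * \<theta> * L.mass t \<le> e / 2" using \<theta>(3) by linarith
        have tri: "norm (a - b) \<le> norm (a - c) + norm (c - c') + norm (b - c')" for a b c c' :: complex
          using norm_triangle_ineq[of "a - c" "c - c'"] norm_triangle_ineq4[of "a - c + (c - c')" "b - c'"] by simp
        show "dist (N.drift n t z) (L.drift t z) < e"
          unfolding dist_norm using tri[of "N.drift n t z" "L.drift t z" ?Sn ?S] 1 2 3 4 \<kappa>(2) by linarith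
      qed
    qed
  qed
qed

text \<open>At \<open>\<i>\<close> the drift yields \<open>\<gamma>\<close> and the masses uniformly in time; at the other points it yields the Cauchy
  transforms of \<open>\<eta>\<^sub>t\<close>.\<close>

theorem REF_convergence_converse:
  assumes L: "REF I \<gamma> \<eta> H g" and N: "\<And>n. REF I (\<gamma>n n) (\<eta>n n) (Hn n) (gn n)"
    and conv: "loc_unif_conv (\<complex>\<^sup>+ \<times> time_pairs I) (\<lambda>n (z, \<tau>). gn n \<tau> z) (\<lambda>(z, \<tau>). g \<tau> z)"
  shows "loc_unif_conv I \<gamma>n \<gamma>" and "t \<in> I \<Longrightarrow> weak_conv_finite (\<lambda>n. \<eta>n n t) (\<eta> t)"
proof -
  interpret L: REF I \<gamma> \<eta> H g by (rule L)
  interpret N: REF I "\<gamma>n n" "\<eta>n n" "Hn n" "gn n" for n by (rule N)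
  have i: "Im \<i> > 0" by simp
  have sub: "{0..b} \<subseteq> I" if "b \<in> I" for b by (rule L.interval_subset(1)[OF L.zero_in that])
  have D: "uniform_limit {0..b} (\<lambda>n t. \<i> * N.mass n t - complex_of_real (\<gamma>n n t)) (\<lambda>t. \<i> * L.mass t - complex_of_real (\<gamma> t)) sequentially"
    if b: "b \<in> I" for b
  proof -
    have "N.drift n t \<i> = \<i> * N.mass n t - complex_of_real (\<gamma>n n t)" "L.drift t \<i> = \<i> * L.mass t - complex_of_real (\<gamma> t)" if "t \<in> {0..b}" for n t
      using N.drift_i L.drift_i sub[OF b] that by auto
    then show ?thesis using drift_uniform_limit[OF L N conv b i] unfolding uniform_limit_iff by simp
  qed
  have g: "uniform_limit {0..b} \<gamma>n \<gamma> sequentially" if b: "b \<in> I" for b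
    using uniform_limit_uminus[OF uniform_limit_Re[OF D[OF b]]] by simp
  show "loc_unif_conv I \<gamma>n \<gamma>"
    unfolding loc_unif_conv_def
  proof (intro allI impI, elim conjE)
    fix K assume K: "compact K" "K \<subseteq> I"
    show "uniform_limit K \<gamma>n \<gamma> sequentially"
    proof (cases "K = {}")
      case True
      then show ?thesis by (simp add: uniform_limit_iff)
    next
      case False
      obtain b where b: "b \<in> K" "\<And>t. t \<in> K \<Longrightarrow> t \<le> b" using compact_attains_sup[OF K(1) False] by blast
      have "b \<in> I" using b K by auto
      moreover have "K \<subseteq> {0..b}" using b K L.nonneg_time by auto
      ultimately show ?thesis using g uniform_limit_on_subset by blast
    qed
  qed
  assume t: "t \<in> I"
  have t0: "t \<in> {0..t}" using L.nonneg_time[OF t] by simp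
  have gt: "(\<lambda>n. \<gamma>n n t) \<longlonglongrightarrow> \<gamma> t" by (rule tendsto_uniform_limitI[OF g[OF t] t0])
  have mt: "(\<lambda>n. N.mass n t) \<longlonglongrightarrow> L.mass t"
    using tendsto_uniform_limitI[OF uniform_limit_Im[OF D[OF t]] t0] by simp
  show "weak_conv_finite (\<lambda>n. \<eta>n n t) (\<eta> t)"
  proof (rule weak_conv_finite_from_Cauchy_transform[OF N.fin_eta[OF t] L.fin_eta[OF t]])
    show "(\<lambda>n. measure (\<eta>n n t) UNIV) \<longlonglongrightarrow> measure (\<eta> t) UNIV" using mt unfolding N.mass_def L.mass_def .
    fix z :: complex assume z: "0 < Im z" "Im z < 1"
    have nz: "1 + z\<^sup>2 \<noteq> 0"
    proof
      assume "1 + z\<^sup>2 = 0"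
      then have "(z - \<i>) * (z + \<i>) = 0" by (simp add: algebra_simps power2_eq_square)
      then have "z - \<i> = 0 \<or> z + \<i> = 0" by (simp only: mult_eq_0_iff)
      then show False using z by (auto simp: complex_eq_iff)
    qed
    have C: "Cauchy_transform E z = (z * m - complex_of_real c - D) / (1 + z\<^sup>2)"
      if "D = z * m - (1 + z\<^sup>2) * Cauchy_transform E z - complex_of_real c" for D E m c
      using nz that by (simp add: field_simps)
    have "(\<lambda>n. N.drift n t z) \<longlonglongrightarrow> L.drift t z"
      by (rule tendsto_uniform_limitI[OF drift_uniform_limit[OF L N conv t z(1)] t0])
    then show "(\<lambda>n. Cauchy_transform (\<eta>n n t) z) \<longlonglongrightarrow> Cauchy_transform (\<eta> t) z"
      unfolding C[OF N.drift_resolvent[OF t z(1)]] C[OF L.drift_resolvent[OF t z(1)]]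
      by (intro tendsto_intros mt gt nz)
  qed
qed

section \<open>Loewner chains\<close>

lemma (in generator_with_measure) integral_mono_time:
  fixes f :: "real \<Rightarrow> real"
  assumes f: "f \<in> borel_measurable borel" "\<And>x. \<bar>f x\<bar> \<le> B" "\<And>x. 0 \<le> f x" and st: "s \<in> I" "t \<in> I" "s \<le> t"
  shows "(\<integral>x. f x \<partial>\<eta> s) \<le> (\<integral>x. f x \<partial>\<eta> t)"
proof -
  have "0 \<le> set_lebesgue_integral H (UNIV \<times> {s..t}) (\<lambda>p. f (fst p))"
    unfolding set_lebesgue_integral_def using f(3) by (intro Bochner_Integration.integral_nonneg) simp
  then show ?thesis using integral_eta_diff(1)[OF st f(1), of B] f(2) by simp
qed

text \<open>For \<open>f \<ge> 0\<close> the integral \<open>\<integral> f d\<eta>\<^sub>t\<close> increases with \<open>t\<close>, so Polya's theorem applies; a bounded \<open>f\<close> is the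
  difference of a nonnegative function and a constant.\<close>

lemma weak_conv_finite_loc_unif:
  assumes N: "\<And>n. REF I (\<gamma>n n) (\<eta>n n) (Hn n) (gn n)" and L: "REF I \<gamma> \<eta> H g"
    and conv: "\<And>t. t \<in> I \<Longrightarrow> weak_conv_finite (\<lambda>n. \<eta>n n t) (\<eta> t)"
  shows "weak_conv_loc_unif I \<eta>n \<eta>"
  unfolding weak_conv_loc_unif_def
proof (intro allI impI, elim conjE)
  interpret L: REF I \<gamma> \<eta> H g by (rule L)
  interpret N: REF I "\<gamma>n n" "\<eta>n n" "Hn n" "gn n" for n by (rule N)
  fix K and f :: "real \<Rightarrow> real" assume K: "compact K" "K \<subseteq> I" and f: "continuous_on UNIV f" "bounded (range f)"
  obtain B where B: "\<And>x. \<bar>f x\<bar> \<le> B" using f(2) by (auto simp: bounded_iff)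
  show "uniform_limit K (\<lambda>n \<tau>. \<integral>x. f x \<partial>\<eta>n n \<tau>) (\<lambda>\<tau>. \<integral>x. f x \<partial>\<eta> \<tau>) sequentially"
  proof (cases "K = {}")
    case True
    then show ?thesis by (simp add: uniform_limit_iff)
  next
    case False
    obtain b where b: "b \<in> K" "\<And>t. t \<in> K \<Longrightarrow> t \<le> b" using compact_attains_sup[OF K(1) False] by blast
    have bI: "b \<in> I" using b K by auto
    have sub: "{0..b} \<subseteq> I" by (rule L.interval_subset(1)[OF L.zero_in bI])
    have Ksub: "K \<subseteq> {0..b}" using b K L.nonneg_time by auto
    have pos: "uniform_limit {0..b} (\<lambda>n t. \<integral>x. \<phi> x \<partial>\<eta>n n t) (\<lambda>t. \<integral>x. \<phi> x \<partial>\<eta> t) sequentially"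
      if \<phi>: "continuous_on UNIV \<phi>" "bounded (range \<phi>)" "\<And>x. 0 \<le> \<phi> x" for \<phi> :: "real \<Rightarrow> real"
    proof (rule mono_uniform_limit)
      obtain C where C: "\<And>x. \<bar>\<phi> x\<bar> \<le> C" using \<phi>(2) by (auto simp: bounded_iff)
      have m: "\<phi> \<in> borel_measurable borel" using \<phi>(1) by (rule borel_measurable_continuous_onI)
      show "(\<integral>x. \<phi> x \<partial>\<eta>n n s) \<le> (\<integral>x. \<phi> x \<partial>\<eta>n n t)" if "0 \<le> s" "s \<le> t" "t \<le> b" for n s t
        using that by (intro N.integral_mono_time[OF m C \<phi>(3)] L.down_closed[OF bI]) auto
      show "continuous_on {0..b} (\<lambda>t. \<integral>x. \<phi> x \<partial>\<eta> t)"
        using L.weakly_continuous_eta \<phi> continuous_on_subset[OF _ sub] unfolding weakly_continuous_on_def by blast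
      show "(\<lambda>n. \<integral>x. \<phi> x \<partial>\<eta>n n t) \<longlonglongrightarrow> (\<integral>x. \<phi> x \<partial>\<eta> t)" if "t \<in> {0..b}" for t
      proof -
        have "t \<in> I" using that sub by blast
        from conv[OF this] \<phi> show ?thesis unfolding weak_conv_finite_def by blast
      qed
    qed
    have p1: "\<And>x. 0 \<le> f x + B" using B by (metis abs_le_D2 add.commute diff_ge_0_iff_ge diff_minus_eq_add minus_le_iff neg_le_iff_le)
    have B0: "0 \<le> B" using order_trans[OF abs_ge_zero B] .
    have cf: "continuous_on UNIV (\<lambda>x. f x + B)" by (intro continuous_intros f(1))
    have "norm (f x + B) \<le> B + B" for x using B[of x] B0 by (simp add: abs_le_iff)
    then have bf: "bounded (range (\<lambda>x. f x + B))" unfolding bounded_iff by blast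
    have "bounded (range (\<lambda>x::real. B))" by simp
    then have u: "uniform_limit {0..b} (\<lambda>n t. (\<integral>x. f x + B \<partial>\<eta>n n t) - (\<integral>x. B \<partial>\<eta>n n t)) (\<lambda>t. (\<integral>x. f x + B \<partial>\<eta> t) - (\<integral>x. B \<partial>\<eta> t)) sequentially"
      by (intro uniform_limit_minus pos cf bf p1 continuous_on_const B0)
    have e: "(\<integral>x. f x + B \<partial>M) - (\<integral>x. B \<partial>M) = (\<integral>x. f x \<partial>M)" if "finite_borel_measure M" for M
    proof -
      interpret finite_borel_measure M by fact
      have "integrable M f" using B f(1) by (intro integrable_bounded[where B = B] borel_measurable_continuous_onI) auto
      then show ?thesis by simp
    qed
    have "uniform_limit {0..b} (\<lambda>n t. \<integral>x. f x \<partial>\<eta>n n t) (\<lambda>t. \<integral>x. f x \<partial>\<eta> t) sequentially"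
    proof -
      have "t \<in> {0..b} \<Longrightarrow> (\<integral>x. f x + B \<partial>\<eta>n n t) - (\<integral>x. B \<partial>\<eta>n n t) = (\<integral>x. f x \<partial>\<eta>n n t)"
        "t \<in> {0..b} \<Longrightarrow> (\<integral>x. f x + B \<partial>\<eta> t) - (\<integral>x. B \<partial>\<eta> t) = (\<integral>x. f x \<partial>\<eta> t)" for n t
        using sub e N.fin_eta L.fin_eta by blast+
      then show ?thesis using u unfolding uniform_limit_iff by (simp del: Bochner_Integration.integral_diff Bochner_Integration.integral_add)
    qed
    then show ?thesis by (rule uniform_limit_on_subset[OF _ Ksub])
  qed
qed

text \<open>The point \<open>w\<^sub>k = f\<^sub>s\<^sub>,\<^sub>t(z)\<close> of the approximating family is the only solution of \<open>f\<^sub>s(w) = f\<^sub>t(z)\<close>.  By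
  Hurwitz's theorem this equation has solutions near the solution of the limiting equation, so \<open>w\<^sub>k\<close> must converge
  to the latter.\<close>

lemma chain_convergence_imp_REF_convergence:
  assumes time: "time_interval I"
    and f: "P_DLC I f" "\<And>n. P_DLC I (fn n)" and g: "P_REF I g" "\<And>n. P_REF I (gn n)"
    and fg: "\<And>t z. t \<in> I \<Longrightarrow> z \<in> \<complex>\<^sup>+ \<Longrightarrow> f t z = g (0, t) z" "\<And>n t z. t \<in> I \<Longrightarrow> z \<in> \<complex>\<^sup>+ \<Longrightarrow> fn n t z = gn n (0, t) z"
    and conv: "loc_unif_conv (\<complex>\<^sup>+ \<times> I) (\<lambda>n (z, t). fn n t z) (\<lambda>(z, t). f t z)"
  shows "loc_unif_conv (\<complex>\<^sup>+ \<times> time_pairs I) (\<lambda>n (z, \<tau>). gn n \<tau> z) (\<lambda>(z, \<tau>). g \<tau> z)"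
proof -
  have gc: "continuous_on (\<complex>\<^sup>+ \<times> time_pairs I) (\<lambda>(z, \<tau>). g \<tau> z)"
    using g(1) by (intro loc_unif_joint_continuous continuous_F_class) (auto simp: P_REF_def)
  have fc: "continuous_on (\<complex>\<^sup>+ \<times> I) (\<lambda>(z, t). f t z)"
    using f(1) by (intro loc_unif_joint_continuous continuous_F_class) (auto simp: P_DLC_def)
  have cc: "cont_conv (\<complex>\<^sup>+ \<times> I) (\<lambda>n (z, t). fn n t z) (\<lambda>(z, t). f t z)"
    using conv unfolding loc_unif_conv_iff_cont_conv[OF fc] .
  have comp: "f s (g (s, t) z) = f t z" "fn n s (gn n (s, t) z) = fn n t z" and UHP: "g (s, t) z \<in> \<complex>\<^sup>+" "gn n (s, t) z \<in> \<complex>\<^sup>+"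
    if "s \<in> I" "t \<in> I" "s \<le> t" "z \<in> \<complex>\<^sup>+" for n s t z
  proof -
    have 0: "0 \<in> I" "0 \<le> s" using time_interval_props(1)[OF time] time_interval_props(2)[OF time that(1)] .
    have F: "g (s, t) \<in> F_class" "gn n (s, t) \<in> F_class"
      using g(1) g(2)[of n] that by (auto simp: P_REF_def time_pairs_def)
    show U: "g (s, t) z \<in> \<complex>\<^sup>+" "gn n (s, t) z \<in> \<complex>\<^sup>+"
      using F_class_props(2)[OF F(1) that(4)] F_class_props(2)[OF F(2) that(4)] .
    have "g (0, s) (g (s, t) z) = g (0, t) z" using g(1) 0 that unfolding P_REF_def by blast
    then show "f s (g (s, t) z) = f t z" using fg(1) U that by simp
    have "gn n (0, s) (gn n (s, t) z) = gn n (0, t) z" using g(2)[of n] 0 that unfolding P_REF_def by blast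
    then show "fn n s (gn n (s, t) z) = fn n t z" using fg(2) U that by simp
  qed
  show ?thesis
    unfolding loc_unif_conv_iff_cont_conv[OF gc]
  proof (rule cont_convI)
    fix r :: "nat \<Rightarrow> nat" and p :: "nat \<Rightarrow> complex \<times> (real \<times> real)" and l
    assume r: "strict_mono r" and p: "\<And>k. p k \<in> \<complex>\<^sup>+ \<times> time_pairs I" "l \<in> \<complex>\<^sup>+ \<times> time_pairs I" "p \<longlonglongrightarrow> l"
    define z where "z = (\<lambda>k. fst (p k))"
    define s where "s = (\<lambda>k. fst (snd (p k)))"
    define t where "t = (\<lambda>k. snd (snd (p k)))"
    define z' where "z' = fst l"
    define s' where "s' = fst (snd l)"
    define t' where "t' = snd (snd l)"
    have m: "z k \<in> \<complex>\<^sup>+" "s k \<in> I" "t k \<in> I" "s k \<le> t k" for k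
      using p(1)[of k] by (auto simp: z_def s_def t_def time_pairs_def mem_Times_iff)
    have m': "z' \<in> \<complex>\<^sup>+" "s' \<in> I" "t' \<in> I" "s' \<le> t'"
      using p(2) by (auto simp: z'_def s'_def t'_def time_pairs_def mem_Times_iff)
    have lim: "z \<longlonglongrightarrow> z'" "s \<longlonglongrightarrow> s'" "t \<longlonglongrightarrow> t'"
      unfolding z_def s_def t_def z'_def s'_def t'_def by (intro tendsto_fst tendsto_snd p(3))+
    define w where "w = (\<lambda>k. gn (r k) (s k, t k) (z k))"
    define w' where "w' = g (s', t') z'"
    have w: "w k \<in> \<complex>\<^sup>+" "fn (r k) (s k) (w k) = fn (r k) (t k) (z k)" for k
      unfolding w_def using UHP(2) comp(2) m by auto
    have w': "w' \<in> \<complex>\<^sup>+" "f s' w' = f t' z'"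
      unfolding w'_def using UHP(1) comp(1) m' by auto
    have "w \<longlonglongrightarrow> w'"
    proof (rule ccontr)
      assume "\<not> w \<longlonglongrightarrow> w'"
      then obtain e0 where e0: "e0 > 0" "\<not> (\<forall>\<^sub>F k in sequentially. dist (w k) w' < e0)" unfolding tendsto_iff by blast
      then have "\<forall>N. \<exists>k\<ge>N. dist (w k) w' \<ge> e0" by (auto simp: eventually_sequentially not_less)
      then have "infinite {k. dist (w k) w' \<ge> e0}" unfolding infinite_nat_iff_unbounded_le by blast
      then obtain q :: "nat \<Rightarrow> nat" where q: "strict_mono q" "\<And>k. q k \<in> {k. dist (w k) w' \<ge> e0}"
        using infinite_enumerate by blast
      \<comment> \<open>The radius is at most \<open>Im w'\<close>, so that the disc lies in the upper half-plane.\<close>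
      define e where "e = min e0 (Im w')"
      have e: "e > 0" "e \<le> e0" "e \<le> Im w'" using e0 w'(1) by (auto simp: e_def UHP_iff)
      define S where "S = ball w' e"
      have SU: "S \<subseteq> \<complex>\<^sup>+"
      proof
        fix \<zeta> assume "\<zeta> \<in> S"
        then have "norm (w' - \<zeta>) < e" by (simp add: S_def dist_norm)
        then have "Im (w' - \<zeta>) < Im w'" using abs_Im_le_cmod[of "w' - \<zeta>"] e(3) by linarith
        then show "\<zeta> \<in> \<complex>\<^sup>+" by (simp add: UHP_iff)
      qed
      have rq: "strict_mono (r \<circ> q)" using r q(1) by (rule strict_mono_o)
      have limq: "(\<lambda>k. z (q k)) \<longlonglongrightarrow> z'" "(\<lambda>k. s (q k)) \<longlonglongrightarrow> s'" "(\<lambda>k. t (q k)) \<longlonglongrightarrow> t'"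
        using LIMSEQ_subseq_LIMSEQ[OF lim(1) q(1)] LIMSEQ_subseq_LIMSEQ[OF lim(2) q(1)] LIMSEQ_subseq_LIMSEQ[OF lim(3) q(1)]
        by (simp_all add: o_def)
      define F where "F = (\<lambda>k \<zeta>. fn (r (q k)) (s (q k)) \<zeta> - fn (r (q k)) (t (q k)) (z (q k)))"
      define G where "G = (\<lambda>\<zeta>. f s' \<zeta> - f t' z')"
      have fU: "f s' holomorphic_on \<complex>\<^sup>+" "inj_on (f s') \<complex>\<^sup>+"
        using f(1) m'(2) by (simp_all add: P_DLC_def)
      have fnU: "fn n a holomorphic_on \<complex>\<^sup>+" "inj_on (fn n a) \<complex>\<^sup>+" if "a \<in> I" for n a
        using f(2)[of n] that by (simp_all add: P_DLC_def)
      note hol = holomorphic_on_subset[OF fU(1) SU] holomorphic_on_subset[OF fnU(1) SU]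
      note inj = fU(2) fnU(2)
      have "G w' \<noteq> 0"
      proof (rule Hurwitz_no_zeros[of S F G])
        show "open S" "connected S" by (simp_all add: S_def)
        show "F k holomorphic_on S" for k unfolding F_def using hol(2)[OF m(2)] by (intro holomorphic_intros)
        show "G holomorphic_on S" unfolding G_def using hol(1) by (intro holomorphic_intros)
        show "w' \<in> S" using e by (simp add: S_def)
        show "\<not> G constant_on S"
        proof
          assume "G constant_on S"
          then obtain y where y: "\<And>x. x \<in> S \<Longrightarrow> G x = y" unfolding constant_on_def by blast
          have mem: "w' + complex_of_real (e / 2) \<in> S" "w' \<in> S" using e by (simp_all add: S_def dist_norm)
          have "G (w' + complex_of_real (e / 2)) = G w'" by (simp only: y[OF mem(1)] y[OF mem(2)])
          then have "f s' (w' + complex_of_real (e / 2)) = f s' w'" by (simp add: G_def)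
          then have "w' + complex_of_real (e / 2) = w'"
            by (rule inj_onD[OF inj(1) _ subsetD[OF SU mem(1)] w'(1)])
          then show False using e by simp
        qed
        show "F k \<zeta> \<noteq> 0" if \<zeta>: "\<zeta> \<in> S" for k \<zeta>
        proof
          assume "F k \<zeta> = 0"
          then have "fn (r (q k)) (s (q k)) \<zeta> = fn (r (q k)) (s (q k)) (w (q k))" using w(2)[of "q k"] by (simp add: F_def)
          then have "\<zeta> = w (q k)" by (rule inj_onD[OF inj(2)[OF m(2)] _ subsetD[OF SU \<zeta>] w(1)])
          then show False using \<zeta> q(2)[of k] e(2) by (simp add: S_def dist_commute)
        qed
        show "uniform_limit K F G sequentially" if K: "compact K" "K \<subseteq> S" for K
        proof (rule uniform_limit_if_cont_conv[OF K(1)])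
          have "continuous_on S G"
            by (rule holomorphic_on_imp_continuous_on) (unfold G_def, intro holomorphic_intros hol(1))
          then show "continuous_on K G" by (rule continuous_on_subset[OF _ K(2)])
          show "cont_conv K F G"
          proof (rule cont_convI)
            fix \<rho> :: "nat \<Rightarrow> nat" and \<zeta> :: "nat \<Rightarrow> complex" and \<zeta>' assume \<rho>: "strict_mono \<rho>" and \<zeta>: "\<And>k. \<zeta> k \<in> K" "\<zeta>' \<in> K" "\<zeta> \<longlonglongrightarrow> \<zeta>'"
            have sm: "strict_mono (\<lambda>k. r (q (\<rho> k)))" using strict_mono_o[OF rq \<rho>] by (simp add: o_def)
            have l: "(\<lambda>k. z (q (\<rho> k))) \<longlonglongrightarrow> z'" "(\<lambda>k. s (q (\<rho> k))) \<longlonglongrightarrow> s'" "(\<lambda>k. t (q (\<rho> k))) \<longlonglongrightarrow> t'"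
              using LIMSEQ_subseq_LIMSEQ[OF limq(1) \<rho>] LIMSEQ_subseq_LIMSEQ[OF limq(2) \<rho>] LIMSEQ_subseq_LIMSEQ[OF limq(3) \<rho>]
              by (simp_all add: o_def)
            have KU: "K \<subseteq> \<complex>\<^sup>+" using K(2) SU by blast
            have "(\<lambda>k. (\<zeta> k, s (q (\<rho> k)))) \<longlonglongrightarrow> (\<zeta>', s')" "(\<lambda>k. (z (q (\<rho> k)), t (q (\<rho> k)))) \<longlonglongrightarrow> (z', t')"
              by (intro tendsto_Pair \<zeta>(3) l)+
            from cont_convD[OF cc sm _ _ this(1)] cont_convD[OF cc sm _ _ this(2)]
            have "(\<lambda>k. fn (r (q (\<rho> k))) (s (q (\<rho> k))) (\<zeta> k)) \<longlonglongrightarrow> f s' \<zeta>'"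
              "(\<lambda>k. fn (r (q (\<rho> k))) (t (q (\<rho> k))) (z (q (\<rho> k)))) \<longlonglongrightarrow> f t' z'"
              using \<zeta>(1,2) KU m m' by auto
            then show "(\<lambda>k. F (\<rho> k) (\<zeta> k)) \<longlonglongrightarrow> G \<zeta>'" unfolding F_def G_def by (rule tendsto_diff)
          qed
        qed
      qed
      then show False using w'(2) by (simp add: G_def)
    qed
    then show "(\<lambda>k. case p k of (z, \<tau>) \<Rightarrow> gn (r k) \<tau> z) \<longlonglongrightarrow> (case l of (z, \<tau>) \<Rightarrow> g \<tau> z)"
      unfolding w_def w'_def z_def s_def t_def z'_def s'_def t'_def split_def by (simp only: prod.collapse)
  qed
qed

section \<open>The equivalence of all modes of convergence\<close>

lemma P_REF_gen_imp_REF: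
  assumes "time_interval I" "generator I \<gamma> \<eta>" "P_REF_gen I \<gamma> \<eta> g"
  shows "\<exists>H. REF I \<gamma> \<eta> H g"
  using assms unfolding P_REF_gen_def REF_def REF_axioms_def generator_with_measure_def by blast

text \<open>Two solutions with the same generator: regard one of them as a constant approximating sequence of the other.\<close>

lemma REF_unique:
  assumes A: "REF I \<gamma> \<eta> H g" and B: "REF I \<gamma> \<eta> H' g'" and \<tau>: "\<tau> \<in> time_pairs I" and z: "z \<in> \<complex>\<^sup>+"
  shows "g' \<tau> z = g \<tau> z"
proof -
  have "loc_unif_conv (\<complex>\<^sup>+ \<times> time_pairs I) (\<lambda>n (z, \<tau>). g' \<tau> z) (\<lambda>(z, \<tau>). g \<tau> z)"
    by (rule REF_convergence[OF A B loc_unif_conv_const weak_conv_loc_unif_const])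
  then have "uniform_limit {(z, \<tau>)} (\<lambda>n (z, \<tau>). g' \<tau> z) (\<lambda>(z, \<tau>). g \<tau> z) sequentially"
    using \<tau> z unfolding loc_unif_conv_def by (elim allE[of _ "{(z, \<tau>)}"] impE) auto
  from tendsto_uniform_limitI[OF this, of "(z, \<tau>)"] have "(\<lambda>n. g' \<tau> z) \<longlonglongrightarrow> g \<tau> z" by simp
  then show ?thesis by (simp add: LIMSEQ_const_iff)
qed

context
  fixes I :: "real set"
    and \<gamma> :: "real \<Rightarrow> real" and \<eta> :: "real \<Rightarrow> real measure"
    and \<gamma>n :: "nat \<Rightarrow> real \<Rightarrow> real" and \<eta>n :: "nat \<Rightarrow> real \<Rightarrow> real measure"
    and c :: "real \<times> real \<Rightarrow> real measure" and cn :: "nat \<Rightarrow> real \<times> real \<Rightarrow> real measure"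
  assumes time: "time_interval I"
    and gen: "generator I \<gamma> \<eta>" "\<And>n. generator I (\<gamma>n n) (\<eta>n n)"
    and c: "classical_hemigroup_gen I \<gamma> \<eta> c" "\<And>n. classical_hemigroup_gen I (\<gamma>n n) (\<eta>n n) (cn n)"
begin

lemma zero_pair: "t \<in> I \<Longrightarrow> (0, t) \<in> time_pairs I"
  using time_interval_props(1,2)[OF time] by (simp add: time_pairs_def)

lemma c_dist: "\<tau> \<in> time_pairs I \<Longrightarrow> real_distribution (c \<tau>)" "\<tau> \<in> time_pairs I \<Longrightarrow> real_distribution (cn n \<tau>)"
  using c(1) c(2)[of n] by (auto simp: classical_hemigroup_gen_def convolution_hemigroup_def)

lemma char_c: "t \<in> I \<Longrightarrow> char (c (0, t)) \<xi> = exp (LK_exponent (\<gamma> t) (\<eta> t) \<xi>)"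
  "t \<in> I \<Longrightarrow> char (cn n (0, t)) \<xi> = exp (LK_exponent (\<gamma>n n t) (\<eta>n n t) \<xi>)"
  using c(1) c(2)[of n] by (auto simp: classical_hemigroup_gen_def LK_exponent_def)

lemma fin_etas: "t \<in> I \<Longrightarrow> finite_borel_measure (\<eta> t)" "t \<in> I \<Longrightarrow> finite_borel_measure (\<eta>n n t)"
  using gen(1) gen(2)[of n] by (auto simp: generator_def)

lemma c_weakly_continuous: "weakly_continuous_on (time_pairs I) c"
  using c(1) by (auto simp: classical_hemigroup_gen_def convolution_hemigroup_def)

lemma zero_pair_map: "continuous_on I (\<lambda>t. (0::real, t))" "(\<lambda>t. (0, t)) ` I \<subseteq> time_pairs I"
  using zero_pair by (auto intro!: continuous_intros)

lemma c0_weakly_continuous: "weakly_continuous_on I (\<lambda>t. c (0, t))"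
  by (rule weakly_continuous_on_compose[OF c_weakly_continuous zero_pair_map])

lemma char_c_pair:
  assumes "(s, t) \<in> time_pairs I"
  shows "char (c (s, t)) \<xi> = char (c (0, t)) \<xi> / char (c (0, s)) \<xi>"
    "char (cn n (s, t)) \<xi> = char (cn n (0, t)) \<xi> / char (cn n (0, s)) \<xi>"
proof -
  have st: "s \<in> I" "t \<in> I" "s \<le> t" "0 \<in> I" "0 \<le> s"
    using assms time_interval_props(1,2)[OF time] by (auto simp: time_pairs_def)
  have "convolution (c (0, s)) (c (s, t)) = c (0, t)" "convolution (cn n (0, s)) (cn n (s, t)) = cn n (0, t)"
    using c(1) c(2)[of n] st by (auto simp: classical_hemigroup_gen_def convolution_hemigroup_def)
  then have "char (c (0, t)) \<xi> = char (c (0, s)) \<xi> * char (c (s, t)) \<xi>"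
    "char (cn n (0, t)) \<xi> = char (cn n (0, s)) \<xi> * char (cn n (s, t)) \<xi>"
    using char_convolution[OF c_dist(1)[OF zero_pair[OF st(1)]] c_dist(1)[OF assms]]
      char_convolution[OF c_dist(2)[OF zero_pair[OF st(1)]] c_dist(2)[OF assms]] by metis+
  then show "char (c (s, t)) \<xi> = char (c (0, t)) \<xi> / char (c (0, s)) \<xi>"
    "char (cn n (s, t)) \<xi> = char (cn n (0, t)) \<xi> / char (cn n (0, s)) \<xi>"
    by (simp_all add: char_c st)
qed

lemma classical_iff_generator:
  assumes \<eta>c: "weakly_continuous_on I \<eta>"
  shows "weak_conv_loc_unif I (\<lambda>n t. cn n (0, t)) (\<lambda>t. c (0, t)) \<longleftrightarrow> loc_unif_conv I \<gamma>n \<gamma> \<and> weak_conv_loc_unif I \<eta>n \<eta>"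
proof -
  have \<gamma>c: "continuous_on I \<gamma>" using gen(1) by (simp add: generator_def)
  have dist: "real_distribution (c (0, t))" "real_distribution (cn n (0, t))" if "t \<in> I" for n t
    using c_dist zero_pair[OF that] by auto
  have fb: "finite_borel_measure M" if "real_distribution M" for M
    using that real_distribution.finite_borel_measure_M by blast
  show ?thesis
  proof (intro iffI conjI)
    assume C: "weak_conv_loc_unif I (\<lambda>n t. cn n (0, t)) (\<lambda>t. c (0, t))"
    have both: "weak_conv_finite (\<lambda>k. \<eta>n (r k) (\<tau> k)) (\<eta> l) \<and> (\<lambda>k. \<gamma>n (r k) (\<tau> k)) \<longlonglongrightarrow> \<gamma> l"
      if r: "strict_mono r" and \<tau>: "\<And>k. \<tau> k \<in> I" "l \<in> I" "\<tau> \<longlonglongrightarrow> l" for r \<tau> l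
    proof -
      have w: "weak_conv_finite (\<lambda>k. cn (r k) (0, \<tau> k)) (c (0, l))"
        using C[unfolded weak_conv_loc_unif_iff_sequential[OF c0_weakly_continuous], rule_format, of r \<tau> l] r \<tau> by auto
      show ?thesis
        using LK_convergence_converse[where Pn = "\<lambda>k. cn (r k) (0, \<tau> k)" and P = "c (0, l)" and \<gamma>n = "\<lambda>k. \<gamma>n (r k) (\<tau> k)"
          and \<eta>n = "\<lambda>k. \<eta>n (r k) (\<tau> k)" and \<gamma> = "\<gamma> l" and \<eta> = "\<eta> l",
          OF dist(2)[OF \<tau>(1)] dist(1)[OF \<tau>(2)] w fin_etas(2)[OF \<tau>(1)] fin_etas(1)[OF \<tau>(2)] char_c(2)[OF \<tau>(1)] char_c(1)[OF \<tau>(2)]]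
        by blast
    qed
    show "loc_unif_conv I \<gamma>n \<gamma>"
      unfolding loc_unif_conv_iff_cont_conv[OF \<gamma>c] by (rule cont_convI) (use both in blast)
    show "weak_conv_loc_unif I \<eta>n \<eta>"
      unfolding weak_conv_loc_unif_iff_sequential[OF \<eta>c] image_subset_iff using both by blast
  next
    assume G: "loc_unif_conv I \<gamma>n \<gamma> \<and> weak_conv_loc_unif I \<eta>n \<eta>"
    show "weak_conv_loc_unif I (\<lambda>n t. cn n (0, t)) (\<lambda>t. c (0, t))"
      unfolding weak_conv_loc_unif_iff_sequential[OF c0_weakly_continuous]
    proof (intro allI impI)
      fix r :: "nat \<Rightarrow> nat" and \<tau> l assume r: "strict_mono r" and \<tau>: "range \<tau> \<subseteq> I" "l \<in> I" "\<tau> \<longlonglongrightarrow> l"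
      have m: "\<tau> k \<in> I" for k using \<tau>(1) by auto
      have g: "(\<lambda>k. \<gamma>n (r k) (\<tau> k)) \<longlonglongrightarrow> \<gamma> l"
        using cont_convD[OF _ r m \<tau>(2,3)] G unfolding loc_unif_conv_iff_cont_conv[OF \<gamma>c] by blast
      have e: "weak_conv_finite (\<lambda>k. \<eta>n (r k) (\<tau> k)) (\<eta> l)"
        using G r \<tau> unfolding weak_conv_loc_unif_iff_sequential[OF \<eta>c] by blast
      show "weak_conv_finite (\<lambda>k. cn (r k) (0, \<tau> k)) (c (0, l))"
        by (rule weak_conv_finite_from_char[OF fb[OF dist(2)[OF m]] fb[OF dist(1)[OF \<tau>(2)]]])
           (unfold char_c(1)[OF \<tau>(2)] char_c(2)[OF m],
            intro tendsto_exp LK_exponent_tendsto[OF g e fin_etas(2)[OF m] fin_etas(1)[OF \<tau>(2)]])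
    qed
  qed
qed

text \<open>The characteristic function of an increment is a quotient of the characteristic functions of the laws started at
  time \<open>0\<close>, which have no zeros.\<close>

lemma classical_pair_iff:
  "weak_conv_loc_unif (time_pairs I) cn c \<longleftrightarrow> weak_conv_loc_unif I (\<lambda>n t. cn n (0, t)) (\<lambda>t. c (0, t))"
proof
  assume "weak_conv_loc_unif (time_pairs I) cn c"
  then show "weak_conv_loc_unif I (\<lambda>n t. cn n (0, t)) (\<lambda>t. c (0, t))"
    by (rule weak_conv_loc_unif_compose[OF _ zero_pair_map])
next
  have fb: "finite_borel_measure M" if "real_distribution M" for M
    using that real_distribution.finite_borel_measure_M by blast
  assume C: "weak_conv_loc_unif I (\<lambda>n t. cn n (0, t)) (\<lambda>t. c (0, t))"
  have ch: "(\<lambda>k. char (cn (r k) (0, \<tau> k)) \<xi>) \<longlonglongrightarrow> char (c (0, l)) \<xi>"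
    if r: "strict_mono r" and \<tau>: "\<And>k. \<tau> k \<in> I" "l \<in> I" "\<tau> \<longlonglongrightarrow> l" for r \<tau> l \<xi>
  proof -
    have w: "weak_conv_finite (\<lambda>k. cn (r k) (0, \<tau> k)) (c (0, l))"
      using C[unfolded weak_conv_loc_unif_iff_sequential[OF c0_weakly_continuous], rule_format, of r \<tau> l] r \<tau> by auto
    have d: "\<And>k. real_distribution (cn (r k) (0, \<tau> k))" "real_distribution (c (0, l))"
      using c_dist zero_pair \<tau> by auto
    show ?thesis by (rule levy_continuity1[OF d weak_conv_finite_imp_weak_conv_m[OF d w]])
  qed
  show "weak_conv_loc_unif (time_pairs I) cn c"
    unfolding weak_conv_loc_unif_iff_sequential[OF c_weakly_continuous]
  proof (intro allI impI)
    fix r :: "nat \<Rightarrow> nat" and \<tau> l assume r: "strict_mono r" and \<tau>: "range \<tau> \<subseteq> time_pairs I" "l \<in> time_pairs I" "\<tau> \<longlonglongrightarrow> l"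
    have m: "\<tau> k \<in> time_pairs I" for k using \<tau>(1) by auto
    have mf: "fst (\<tau> k) \<in> I" "snd (\<tau> k) \<in> I" "fst l \<in> I" "snd l \<in> I" for k
      using m[of k] \<tau>(2) by (auto simp: time_pairs_def)
    have lim: "(\<lambda>k. fst (\<tau> k)) \<longlonglongrightarrow> fst l" "(\<lambda>k. snd (\<tau> k)) \<longlonglongrightarrow> snd l"
      by (intro tendsto_fst tendsto_snd \<tau>(3))+
    have q: "char (c l) \<xi> = char (c (0, snd l)) \<xi> / char (c (0, fst l)) \<xi>"
      "char (cn (r k) (\<tau> k)) \<xi> = char (cn (r k) (0, snd (\<tau> k))) \<xi> / char (cn (r k) (0, fst (\<tau> k))) \<xi>" for k \<xi>
      using char_c_pair(1)[of "fst l" "snd l"] char_c_pair(2)[of "fst (\<tau> k)" "snd (\<tau> k)"] m[of k] \<tau>(2) by simp_all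
    show "weak_conv_finite (\<lambda>k. cn (r k) (\<tau> k)) (c l)"
    proof (rule weak_conv_finite_from_char[OF fb[OF c_dist(2)[OF m]] fb[OF c_dist(1)[OF \<tau>(2)]]])
      fix \<xi>
      show "(\<lambda>k. char (cn (r k) (\<tau> k)) \<xi>) \<longlonglongrightarrow> char (c l) \<xi>"
        unfolding q using char_c(1)[OF mf(3)]
        by (intro tendsto_divide ch[OF r mf(2,4) lim(2)] ch[OF r mf(1,3) lim(1)]) simp
    qed
  qed
qed

end

theorem theorem1p14:
  fixes I :: "real set"
    and \<gamma> :: "real \<Rightarrow> real" and \<eta> :: "real \<Rightarrow> real measure"
    and \<gamma>n :: "nat \<Rightarrow> real \<Rightarrow> real" and \<eta>n :: "nat \<Rightarrow> real \<Rightarrow> real measure"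
    and c m :: "real \<times> real \<Rightarrow> real measure" and cn mn :: "nat \<Rightarrow> real \<times> real \<Rightarrow> real measure"
    and f :: "real \<Rightarrow> complex \<Rightarrow> complex" and fn :: "nat \<Rightarrow> real \<Rightarrow> complex \<Rightarrow> complex"
    and g :: "real \<times> real \<Rightarrow> complex \<Rightarrow> complex" and gn :: "nat \<Rightarrow> real \<times> real \<Rightarrow> complex \<Rightarrow> complex"
  assumes "time_interval I"
    and "generator I \<gamma> \<eta>" and "\<And>n. generator I (\<gamma>n n) (\<eta>n n)"
    and "classical_hemigroup_gen I \<gamma> \<eta> c" and "\<And>n. classical_hemigroup_gen I (\<gamma>n n) (\<eta>n n) (cn n)"
    and "monotone_hemigroup_gen I \<gamma> \<eta> m" and "\<And>n. monotone_hemigroup_gen I (\<gamma>n n) (\<eta>n n) (mn n)"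
    and "P_DLC_gen I \<gamma> \<eta> f" and "\<And>n. P_DLC_gen I (\<gamma>n n) (\<eta>n n) (fn n)"
    and "P_REF_gen I \<gamma> \<eta> g" and "\<And>n. P_REF_gen I (\<gamma>n n) (\<eta>n n) (gn n)"
  shows "all_equivalent
    [weak_conv_loc_unif I (\<lambda>n t. cn n (0, t)) (\<lambda>t. c (0, t)),
     weak_conv_loc_unif (time_pairs I) cn c,
     weak_conv_loc_unif I (\<lambda>n t. mn n (0, t)) (\<lambda>t. m (0, t)),
     weak_conv_loc_unif (time_pairs I) mn m,
     loc_unif_conv (\<complex>\<^sup>+ \<times> I) (\<lambda>n (z, t). fn n t z) (\<lambda>(z, t). f t z),
     loc_unif_conv (\<complex>\<^sup>+ \<times> time_pairs I) (\<lambda>n (z, \<tau>). gn n \<tau> z) (\<lambda>(z, \<tau>). g \<tau> z),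
     loc_unif_conv I \<gamma>n \<gamma> \<and> weak_conv_loc_unif I \<eta>n \<eta>,
     loc_unif_conv I \<gamma>n \<gamma> \<and> (\<forall>t\<in>I. weak_conv_finite (\<lambda>n. \<eta>n n t) (\<eta> t))]"
proof -
  note time = assms(1) and gen = assms(2,3) and c = assms(4,5) and m = assms(6,7) and f = assms(8,9) and g = assms(10,11)
  let ?C1 = "weak_conv_loc_unif I (\<lambda>n t. cn n (0, t)) (\<lambda>t. c (0, t))"
  let ?C2 = "weak_conv_loc_unif (time_pairs I) cn c"
  let ?M1 = "weak_conv_loc_unif I (\<lambda>n t. mn n (0, t)) (\<lambda>t. m (0, t))"
  let ?M2 = "weak_conv_loc_unif (time_pairs I) mn m"
  let ?F1 = "loc_unif_conv (\<complex>\<^sup>+ \<times> I) (\<lambda>n (z, t). fn n t z) (\<lambda>(z, t). f t z)"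
  let ?F2 = "loc_unif_conv (\<complex>\<^sup>+ \<times> time_pairs I) (\<lambda>n (z, \<tau>). gn n \<tau> z) (\<lambda>(z, \<tau>). g \<tau> z)"
  let ?G1 = "loc_unif_conv I \<gamma>n \<gamma> \<and> weak_conv_loc_unif I \<eta>n \<eta>"
  let ?G2 = "loc_unif_conv I \<gamma>n \<gamma> \<and> (\<forall>t\<in>I. weak_conv_finite (\<lambda>n. \<eta>n n t) (\<eta> t))"
  obtain H where L: "REF I \<gamma> \<eta> H g" using P_REF_gen_imp_REF[OF time gen(1) g(1)] by blast
  have "\<exists>H. REF I (\<gamma>n n) (\<eta>n n) H (gn n)" for n by (rule P_REF_gen_imp_REF[OF time gen(2) g(2)])
  then obtain Hn where N: "\<And>n. REF I (\<gamma>n n) (\<eta>n n) (Hn n) (gn n)" by metis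
  have sub: "(\<lambda>t. (0, t)) ` I \<subseteq> time_pairs I" using time_interval_props(1,2)[OF time] by (auto simp: time_pairs_def)
  have zc: "continuous_on I (\<lambda>t. (0::real, t))" by (intro continuous_intros)
  have uniq: "h \<tau> z = g \<tau> z" if h: "P_REF_gen I \<gamma> \<eta> h" and \<tau>: "\<tau> \<in> time_pairs I" and z: "z \<in> \<complex>\<^sup>+" for h \<tau> z
  proof -
    obtain H' where "REF I \<gamma> \<eta> H' h" using P_REF_gen_imp_REF[OF time gen(1) h] by (elim exE)
    then show ?thesis by (rule REF_unique[OF L _ \<tau> z])
  qed
  have uniqn: "h \<tau> z = gn n \<tau> z" if h: "P_REF_gen I (\<gamma>n n) (\<eta>n n) h" and \<tau>: "\<tau> \<in> time_pairs I" and z: "z \<in> \<complex>\<^sup>+" for h n \<tau> z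
  proof -
    obtain H' where "REF I (\<gamma>n n) (\<eta>n n) H' h" using P_REF_gen_imp_REF[OF time gen(2) h] by (elim exE)
    then show ?thesis by (rule REF_unique[OF N _ \<tau> z])
  qed
  have mg: "F_transform (m \<tau>) z = g \<tau> z" "F_transform (mn n \<tau>) z = gn n \<tau> z" if \<tau>: "\<tau> \<in> time_pairs I" and z: "z \<in> \<complex>\<^sup>+" for n \<tau> z
  proof -
    obtain h where h: "P_REF_gen I \<gamma> \<eta> h" "\<forall>\<tau>\<in>time_pairs I. \<forall>z\<in>\<complex>\<^sup>+. F_transform (m \<tau>) z = h \<tau> z"
      using m(1)[unfolded monotone_hemigroup_gen_def] by (elim conjE exE)
    show "F_transform (m \<tau>) z = g \<tau> z"
      by (rule trans[OF h(2)[rule_format, OF \<tau> z] uniq[OF h(1) \<tau> z]])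
    obtain h where h: "P_REF_gen I (\<gamma>n n) (\<eta>n n) h" "\<forall>\<tau>\<in>time_pairs I. \<forall>z\<in>\<complex>\<^sup>+. F_transform (mn n \<tau>) z = h \<tau> z"
      using m(2)[of n, unfolded monotone_hemigroup_gen_def] by (elim conjE exE)
    show "F_transform (mn n \<tau>) z = gn n \<tau> z"
      by (rule trans[OF h(2)[rule_format, OF \<tau> z] uniqn[OF h(1) \<tau> z]])
  qed
  have fg: "f t z = g (0, t) z" "fn n t z = gn n (0, t) z" if t: "t \<in> I" and z: "z \<in> \<complex>\<^sup>+" for n t z
  proof -
    have p: "(0, t) \<in> time_pairs I" using sub t by blast
    obtain h where h: "P_REF_gen I \<gamma> \<eta> h" "\<forall>t\<in>I. \<forall>z\<in>\<complex>\<^sup>+. f t z = h (0, t) z"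
      using f(1)[unfolded P_DLC_gen_def] by (elim conjE exE)
    show "f t z = g (0, t) z"
      by (rule trans[OF h(2)[rule_format, OF t z] uniq[OF h(1) p z]])
    obtain h where h: "P_REF_gen I (\<gamma>n n) (\<eta>n n) h" "\<forall>t\<in>I. \<forall>z\<in>\<complex>\<^sup>+. fn n t z = h (0, t) z"
      using f(2)[of n, unfolded P_DLC_gen_def] by (elim conjE exE)
    show "fn n t z = gn n (0, t) z"
      by (rule trans[OF h(2)[rule_format, OF t z] uniqn[OF h(1) p z]])
  qed
  have md: "real_distribution (m \<tau>)" "real_distribution (mn n \<tau>)" if "\<tau> \<in> time_pairs I" for n \<tau>
    using m(1) m(2)[of n] that by (simp_all add: monotone_hemigroup_gen_def convolution_hemigroup_def)
  have mw: "weakly_continuous_on (time_pairs I) m"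
    using m(1) by (simp add: monotone_hemigroup_gen_def convolution_hemigroup_def)
  note gc = REF.g_joint_continuous[OF L]
  have pc: "continuous_on (\<complex>\<^sup>+ \<times> I) (\<lambda>p. (fst p, (0::real, snd p)))" by (intro continuous_intros)
  have psub: "(\<lambda>p. (fst p, (0, snd p))) ` (\<complex>\<^sup>+ \<times> I) \<subseteq> \<complex>\<^sup>+ \<times> time_pairs I" using sub by auto
  have g0c: "continuous_on (\<complex>\<^sup>+ \<times> I) (\<lambda>(z, t). g (0, t) z)"
    using continuous_on_compose2[OF gc pc psub] by (simp add: split_def)
  have FF: "?F1 \<longleftrightarrow> loc_unif_conv (\<complex>\<^sup>+ \<times> I) (\<lambda>n (z, t). gn n (0, t) z) (\<lambda>(z, t). g (0, t) z)"
    by (rule loc_unif_conv_cong) (auto simp: fg)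
  have M2: "?M2 \<longleftrightarrow> ?F2"
    by (rule weak_conv_loc_unif_iff_F_transform[where S = "time_pairs I" and \<mu> = m and \<mu>n = mn and h = g and hn = gn])
       (fact md mg mw gc)+
  have p0: "(0, t) \<in> time_pairs I" if "t \<in> I" for t using sub that by blast
  have M1: "?M1 \<longleftrightarrow> ?F1"
    unfolding FF
  proof (rule weak_conv_loc_unif_iff_F_transform[where S = I and \<mu> = "\<lambda>t. m (0, t)" and \<mu>n = "\<lambda>n t. mn n (0, t)"
        and h = "\<lambda>t. g (0, t)" and hn = "\<lambda>n t. gn n (0, t)"])
    fix t n assume t: "t \<in> I"
    show "real_distribution (m (0, t))" "real_distribution (mn n (0, t))" by (rule md[OF p0[OF t]])+
    fix z assume z: "z \<in> \<complex>\<^sup>+"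
    show "F_transform (m (0, t)) z = g (0, t) z" "F_transform (mn n (0, t)) z = gn n (0, t) z"
      by (rule mg[OF p0[OF t] z])+
  qed (rule weakly_continuous_on_compose[OF mw zc sub], rule g0c)
  have F21: ?F1 if F2: ?F2
    using loc_unif_conv_compose[OF F2 pc psub] unfolding FF by (simp add: split_def)
  have F12: ?F2 if F1: ?F1
  proof (rule chain_convergence_imp_REF_convergence[OF time _ _ _ _ _ _ F1])
    show "P_DLC I f" "P_DLC I (fn n)" for n using f(1) f(2)[of n] by (simp_all add: P_DLC_gen_def)
    show "P_REF I g" "P_REF I (gn n)" for n using g(1) g(2)[of n] by (simp_all add: P_REF_gen_def)
  qed (fact fg)+
  have GF: ?F2 if G: ?G1
    by (rule REF_convergence[OF L N conjunct1[OF G] conjunct2[OF G]])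
  have FG: ?G2 if F: ?F2
    by (intro conjI ballI REF_convergence_converse[OF L N F])
  have GG: ?G1 if G: ?G2
    by (intro conjI conjunct1[OF G] weak_conv_finite_loc_unif[OF N L] bspec[OF conjunct2[OF G]])
  have C1: "?C1 \<longleftrightarrow> ?G1"
    by (rule classical_iff_generator[OF time gen c REF.weakly_continuous_eta[OF L]])
  have C2: "?C2 \<longleftrightarrow> ?C1"
    by (rule classical_pair_iff[OF time gen c])
  have G2: "?G2 \<longleftrightarrow> ?F2" by (rule iffI[OF GF[OF GG] FG])
  have G1: "?G1 \<longleftrightarrow> ?F2" by (rule iffI[OF GF GG[OF FG]])
  have F1: "?F1 \<longleftrightarrow> ?F2" by (rule iffI[OF F12 F21])
  have eqs: "?C1 = ?F2" "?C2 = ?F2" "?M1 = ?F2"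
    by (rule trans[OF C1 G1], rule trans[OF C2 trans[OF C1 G1]], rule trans[OF M1 F1])
  show ?thesis
    unfolding all_equivalent_def list.set eqs M2 F1 G1 G2 by simp
qed

end
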